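(* Let $b \le B$, let $T_1, T_2, \dots, T_{b+1}$ be B-trees with parameter $B$, and let $k_1, \dots, k_b$ be separator keys such that for every $i$, every key $x\in T_i$ and $y\in T_{i+1}$ satisfy $x<k_i<y$. Let $h_{\max}$ and $h_{\min}$ be the largest and smallest heights among $T_1,\dots,T_{b+1}$. Then a valid B-tree containing exactly the keys $\{k_1,\dots,k_b\}\cup\bigcup_i T_i$ (the B-way join) can be computed in the fork-join I/O model with $O(h_{\max} - h_{\min})$ I/O span and $O(b\cdot(h_{\max} - h_{\min}))$ I/O work.
   Context: A B-tree with parameter $B$ over a totally ordered key set is either an empty (external) node, or a node with keys $k_1<\dots<k_b$ and $b+1$ subtrees $T_1,\dots,T_{b+1}$, such that: $\lceil B/2\rceil \le b \le B$ (except at the root, where $2\le b\le B$); each $T_i$ is a B-tree; every key of $T_{i-1}$ is less than $k_i$ and every key of $T_i$ is greater than $k_i$; and all external nodes have the same depth. The height of an external node is 0, and the height of a non-external node is one more than the height of its children. Cost model (fork-join I/O model): computation is in the shared-memory fork-join model, where a thread may fork up to $B$ parallel child threads and continues once they all finish. Memory is organized in blocks of $B$ words ($B$ is also the B-tree parameter); reading or writing one block costs one unit, while each processor can hold $O(\log n)$ blocks locally and accessing them is free. The I/O work is the total number of block transfers, and the I/O span is the maximum number of block transfers along any path of the computation DAG.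
   Formalization: B-trees here have at least 1 key at the root and at least ⌊B/2⌋ in other nodes (with 2 and ⌈B/2⌉, joining two empty trees by one key has no valid result); k_1<…<k_b is assumed even if some T_i are empty; for h_max = h_min the bounds read O(1) span and O(b) work. *)

theory Defs
  imports "HOL-Library.Discrete_Functions"
begin

section \<open>B-trees\<close>

datatype 'k btree = External | Node "'k list" "'k btree list"

primrec tree_keys :: "'k btree \<Rightarrow> 'k set" where
  "tree_keys External = {}"
| "tree_keys (Node ks ts) = set ks \<union> \<Union> (set (map tree_keys ts))"

primrec height :: "'k btree \<Rightarrow> nat" where
  "height External = 0"
| "height (Node ks ts) = Suc (Max (set (map height ts)))"

primrec external_depths :: "'k btree \<Rightarrow> nat set" where
  "external_depths External = {0}"
| "external_depths (Node ks ts) = Suc ` \<Union> (set (map external_depths ts))"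

text \<open>
  Lists are indexed from 0, so the key \<open>ks ! i\<close> lies between the subtrees \<open>ts ! i\<close> and
  \<open>ts ! Suc i\<close>. Sortedness of \<open>ks\<close> is not implied by the second conjunct, because the
  subtrees may be empty.
\<close>

definition separated :: "'k::linorder list \<Rightarrow> 'k btree list \<Rightarrow> bool" where
  "separated ks ts \<longleftrightarrow> sorted_wrt (<) ks \<and>
     (\<forall>i<length ks. (\<forall>x\<in>tree_keys (ts ! i). x < ks ! i) \<and>
                    (\<forall>y\<in>tree_keys (ts ! Suc i). ks ! i < y))"

text \<open>
  \<open>node_bounds B lo t\<close>: the root of \<open>t\<close> has at least \<open>lo\<close> keys, every other node satisfies
  the bounds for inner nodes.

  The numerical lower bounds deserve care. Demanding 2 keys in the root would leave no tree
  with exactly one key, and for \<open>B = 4\<close> none with 5, 6 or 7 keys; the customary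
  condition, used here, is that the root has at least 2 subtrees, i.e. at least 1 key.
  For inner nodes the minimum is half of \<open>B\<close>. For odd \<open>B\<close> this half has to be
  rounded down: if it were rounded up, an overfull node (\<open>B + 1\<close> keys) could not be split
  into a separator and two legal nodes, and for \<open>B = 3\<close> there would be no tree with 4 keys.
  Every tree satisfying the stricter bounds \<open>2\<close> and \<open>\<lceil>B/2\<rceil>\<close> satisfies the ones below,
  and for even \<open>B\<close> the two bounds for inner nodes agree.
\<close>

inductive node_bounds :: "nat \<Rightarrow> nat \<Rightarrow> 'k::linorder btree \<Rightarrow> bool" for B where
  "node_bounds B lo External"
| "\<lbrakk> lo \<le> length ks; length ks \<le> B; length ts = length ks + 1; separated ks ts;
     \<forall>t\<in>set ts. node_bounds B (B div 2) t \<rbrakk>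
   \<Longrightarrow> node_bounds B lo (Node ks ts)"

definition B_tree :: "nat \<Rightarrow> 'k::linorder btree \<Rightarrow> bool" where
  "B_tree B t \<longleftrightarrow> node_bounds B 1 t \<and>
     (\<forall>d\<in>external_depths t. \<forall>e\<in>external_depths t. d = e)"


section \<open>The fork-join I/O model\<close>

text \<open>
  The shared memory is an unbounded array of words; block \<open>j\<close> consists of the words
  \<open>j * B, \<dots>, j * B + B - 1\<close>. A word holds a key or a number (a counter or an address).
\<close>

datatype 'k word = Key 'k | Num nat

type_synonym 'k mem = "nat \<Rightarrow> 'k word"
type_synonym 'k local = "'k word list"

definition word_keys :: "'k word set \<Rightarrow> 'k set" where
  "word_keys A = {k. Key k \<in> A}"

definition block :: "nat \<Rightarrow> 'k mem \<Rightarrow> nat \<Rightarrow> 'k word list" where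
  "block B m j = map m [j * B ..< (j + 1) * B]"

text \<open>
  A thread is determined by the contents of its local memory (which includes its program
  counter), and a program says what a thread does next. Local computation is free, so it is
  an arbitrary function of the local memory. The last argument of \<open>Read\<close>, \<open>Write\<close>
  and \<open>Fork\<close> is the local memory with which the thread continues; after \<open>Read\<close> the
  block that was read is appended to it. \<open>Write j u l\<close> transfers one block and changes its
  words at the offsets in \<open>dom u\<close>. \<open>Fork ls l\<close> starts one child per element of
  \<open>ls\<close>; children return results through the shared memory.
\<close>

datatype 'k instr =
    Halt
  | Read nat "'k local"
  | Write nat "nat \<Rightarrow> 'k word option" "'k local"
  | Fork "'k local list" "'k local"

type_synonym 'k program = "'k local \<Rightarrow> 'k instr"

definition write_block :: "nat \<Rightarrow> 'k mem \<Rightarrow> nat \<Rightarrow> (nat \<Rightarrow> 'k word option) \<Rightarrow> 'k mem" where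
  "write_block B m j u =
     (\<lambda>a. if a div B = j then (case u (a mod B) of Some w \<Rightarrow> w | None \<Rightarrow> m a) else m a)"

text \<open>
  \<open>cache\<close> is the capacity of a local memory in blocks, \<open>max_args\<close> the number of
  words that can be passed to a child, and numbers stored in words are below
  \<open>word_bound\<close>.
\<close>

record machine =
  block_size :: nat
  cache :: nat
  max_args :: nat
  word_bound :: nat

definition words_ok :: "machine \<Rightarrow> 'k word set \<Rightarrow> bool" where
  "words_ok M A \<longleftrightarrow> (\<forall>v. Num v \<in> A \<longrightarrow> v < word_bound M)"

definition local_ok :: "machine \<Rightarrow> 'k local \<Rightarrow> bool" where
  "local_ok M l \<longleftrightarrow> length l \<le> cache M * block_size M \<and> words_ok M (set l)"

record 'k outcome =
  final_local :: "'k local"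
  final_mem :: "'k mem"
  reads :: "nat set"   \<comment> \<open>block indices\<close>
  writes :: "nat set"  \<comment> \<open>word addresses\<close>
  io_work :: nat
  io_span :: nat

text \<open>
  The children of a fork all start from the memory at the time of the fork. They must be
  free of races: no word is written by two of them, and no block read by one of them is
  changed by another. Hence the result does not depend on the schedule, and each
  child's writes take effect in the memory \<open>m'\<close> in which the parent continues.
\<close>

definition race_free :: "nat \<Rightarrow> nat \<Rightarrow> (nat \<Rightarrow> 'k outcome) \<Rightarrow> bool" where
  "race_free B n r \<longleftrightarrow> (\<forall>i<n. \<forall>j<n. i \<noteq> j \<longrightarrow>
     writes (r i) \<inter> writes (r j) = {} \<and> (\<lambda>a. a div B) ` writes (r i) \<inter> reads (r j) = {})"

definition merged :: "nat \<Rightarrow> 'k mem \<Rightarrow> (nat \<Rightarrow> 'k outcome) \<Rightarrow> 'k mem \<Rightarrow> bool" where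
  "merged n m r m' \<longleftrightarrow>
     (\<forall>i<n. \<forall>a\<in>writes (r i). m' a = final_mem (r i) a) \<and>
     (\<forall>a. a \<notin> (\<Union>i<n. writes (r i)) \<longrightarrow> m' a = m a)"

text \<open>
  \<open>exec M P l m r\<close>: on the machine \<open>M\<close>, a thread of the program \<open>P\<close> with local memory
  \<open>l\<close>, started in the memory \<open>m\<close>, terminates with outcome \<open>r\<close>. Keys are atomic: a
  thread can only store keys that are present in its local memory, it cannot compute new ones.
\<close>

inductive exec :: "machine \<Rightarrow> 'k program \<Rightarrow> 'k local \<Rightarrow> 'k mem \<Rightarrow> 'k outcome \<Rightarrow> bool"
  for M :: machine and P :: "'k program" where
  exec_halt:
    "\<lbrakk> local_ok M l; P l = Halt \<rbrakk>
     \<Longrightarrow> exec M P l m \<lparr> final_local = l, final_mem = m, reads = {}, writes = {},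
                        io_work = 0, io_span = 0 \<rparr>"
| exec_read:
    "\<lbrakk> local_ok M l; P l = Read j l';
       word_keys (set l') \<subseteq> word_keys (set l);
       exec M P (l' @ block (block_size M) m j) m r \<rbrakk>
     \<Longrightarrow> exec M P l m (r \<lparr> reads := insert j (reads r),
                           io_work := io_work r + 1, io_span := io_span r + 1 \<rparr>)"
| exec_write:
    "\<lbrakk> local_ok M l; P l = Write j u l';
       dom u \<subseteq> {..<block_size M}; words_ok M (ran u);
       word_keys (ran u \<union> set l') \<subseteq> word_keys (set l);
       exec M P l' (write_block (block_size M) m j u) r \<rbrakk>
     \<Longrightarrow> exec M P l m (r \<lparr> writes := (\<lambda>i. j * block_size M + i) ` dom u \<union> writes r,
                           io_work := io_work r + 1, io_span := io_span r + 1 \<rparr>)"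
| exec_fork:
    "\<lbrakk> local_ok M l; P l = Fork ls l';
       length ls \<le> block_size M;
       \<forall>x\<in>set ls. length x \<le> max_args M;
       word_keys (\<Union> (set ` set ls) \<union> set l') \<subseteq> word_keys (set l);
       \<forall>i<length ls. exec M P (ls ! i) m (s i);
       race_free (block_size M) (length ls) s;
       merged (length ls) m s m';
       exec M P l' m' r \<rbrakk>
     \<Longrightarrow> exec M P l m (r \<lparr> reads := (\<Union>i<length ls. reads (s i)) \<union> reads r,
                           writes := (\<Union>i<length ls. writes (s i)) \<union> writes r,
                           io_work := (\<Sum>i<length ls. io_work (s i)) + io_work r,
                           io_span := Max (insert 0 ((\<lambda>i. io_span (s i)) ` {..<length ls}))
                                      + io_span r \<rparr>)"


section \<open>Representation of B-trees in memory\<close>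

definition stored :: "'k mem \<Rightarrow> nat \<Rightarrow> 'k word list \<Rightarrow> bool" where
  "stored m a ws \<longleftrightarrow> (\<forall>i<length ws. m (a + i) = ws ! i)"

text \<open>
  \<open>btree_at B m f p t\<close>: the tree \<open>t\<close> is represented by the pointer \<open>p\<close>, using only
  blocks with index below \<open>f\<close>. The null pointer 0 represents an external node. Any other pointer
  \<open>p\<close> denotes the four blocks \<open>4 * p, \<dots>, 4 * p + 3\<close>: the height of the node and its
  number of keys, the keys (at most \<open>B\<close>), and the child pointers (at most \<open>B + 1\<close>,
  hence two blocks).
\<close>

inductive btree_at :: "nat \<Rightarrow> 'k mem \<Rightarrow> nat \<Rightarrow> nat \<Rightarrow> 'k btree \<Rightarrow> bool" for B m f where
  "btree_at B m f 0 External"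
| "\<lbrakk> p \<noteq> 0; 4 * p + 4 \<le> f;
     stored m (4 * p * B) [Num (height (Node ks ts)), Num (length ks)];
     stored m ((4 * p + 1) * B) (map Key ks);
     stored m ((4 * p + 2) * B) (map Num ps);
     length ps = length ts;
     \<forall>i<length ts. btree_at B m f (ps ! i) (ts ! i) \<rbrakk>
   \<Longrightarrow> btree_at B m f p (Node ks ts)"

text \<open>
  The input of a join: the separators are stored in block \<open>q\<close>, the pointers to
  the trees in blocks \<open>q + 1\<close> and \<open>q + 2\<close>. The blocks from \<open>f\<close> on
  (with arbitrary contents) are not part of the input and serve as free space.
\<close>

definition join_input ::
  "nat \<Rightarrow> 'k mem \<Rightarrow> nat \<Rightarrow> nat \<Rightarrow> 'k list \<Rightarrow> 'k btree list \<Rightarrow> bool" where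
  "join_input B m f q ks ts \<longleftrightarrow> q + 3 \<le> f \<and> stored m (q * B) (map Key ks) \<and>
     (\<exists>ps. length ps = length ts \<and> stored m ((q + 1) * B) (map Num ps) \<and>
           (\<forall>i<length ts. btree_at B m f (ps ! i) (ts ! i)))"

definition join_keys :: "'k list \<Rightarrow> 'k btree list \<Rightarrow> 'k set" where
  "join_keys ks ts = set ks \<union> (\<Union>t\<in>set ts. tree_keys t)"

definition h_max :: "'k btree list \<Rightarrow> nat" where
  "h_max ts = Max (height ` set ts)"

definition h_min :: "'k btree list \<Rightarrow> nat" where
  "h_min ts = Min (height ` set ts)"

text \<open>
  The machine used for inputs with \<open>n\<close> keys: local memories of \<open>O(log n)\<close> blocks and
  \<open>O(1)\<close> words passed to each child, where \<open>c\<close> is the constant in both bounds.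
\<close>

definition fork_join_machine :: "nat \<Rightarrow> nat \<Rightarrow> nat \<Rightarrow> nat \<Rightarrow> machine" where
  "fork_join_machine c B n W =
     \<lparr> block_size = B, cache = c * (floor_log n + 1), max_args = c, word_bound = W \<rparr>"

end

theory Submission
  imports Defs
begin

text \<open>
  Call a tree tall if it has the maximal height \<open>h\<close>. Each maximal run of lower trees, together with
  the outermost children of its tall neighbours, is a join problem of maximal height \<open>h - 1\<close>; these
  problems have disjoint sets of separators and are solved recursively in parallel, each giving a
  sequence of trees of height \<open>h - 1\<close>. In between lie the remaining children of the tall roots, so
  dissolving these roots leaves one long sequence of trees of height \<open>h - 1\<close>, which is cut evenly into
  nodes of height \<open>h\<close>. At most \<open>w + 1\<close> nodes arise if there are \<open>w\<close> separators, since a group of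
  \<open>x\<close> trees yields at most \<open>x\<close> trees. Hence a call takes \<open>O(1)\<close> span and \<open>O(w)\<close> work per
  level, and the recursion ends at the minimal height because no lower trees are left. Underfull roots
  do no harm: they are dissolved, and every recursive problem contains a child of a tall root,
  which has enough keys to fill a node.

  Cutting preserves the inorder traversal, so order invariants reduce to sortedness of that list.
  All offsets are prefix sums that the coordinating thread computes locally; data is moved only by
  threads that copy at most \<open>B + 1\<close> consecutive words.
\<close>

section \<open>Executions\<close>

text \<open>The model has no allocator and a fork must be free of races, so scratch space is
  assigned in advance: the region of a call is determined by its depth and its first separator, a
  pair that no two calls share because parallel problems have disjoint sets of separators. Depths
  are bounded by the maximal height, and this is at most \<open>f\<close>, since nodes of different
  heights occupy different pages; hence all addresses are polynomial in \<open>B + f\<close>. Input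
  pages are never overwritten: dissolved roots are only read, and every new node goes to fresh
  space. A level with \<open>w\<close> separators moves up to \<open>(w + 1) * (B + 1)\<close>
  pointers, but they form \<open>O(w)\<close> runs of at most \<open>B + 1\<close> consecutive
  words. Each run is copied by one thread in 4 transfers, and \<open>O(w)\<close> threads fit into a
  constant number of forks of width \<open>B\<close>. Cutting into \<open>r \<ge> 2\<close> nodes
  only happens with more than \<open>(r - 1) * (B + 1)\<close> children, which suffices for
  \<open>B div 2 + 1\<close> children in each node. If a single node arises, it contains all keys of
  a tallest root, and these provide its lower bound.\<close>

definition mem_ok :: "nat \<Rightarrow> 'k mem \<Rightarrow> bool" where
  "mem_ok W m \<longleftrightarrow> (\<forall>a v. m a = Num v \<longrightarrow> v < W)"

text \<open>Footprints and costs enter as upper bounds, since disjointness of the bounds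
  \<open>R\<close> and \<open>Wr\<close> of parallel threads is what is checked against races.
  \<open>mem_ok\<close> is carried along because a read appends an entire block, garbage included,
  to a local memory that must satisfy \<open>local_ok\<close>.\<close>

definition runs :: "machine \<Rightarrow> 'k program \<Rightarrow> 'k local \<Rightarrow> 'k mem \<Rightarrow> nat set \<Rightarrow> nat set \<Rightarrow> nat \<Rightarrow> nat
    \<Rightarrow> ('k local \<Rightarrow> 'k mem \<Rightarrow> bool) \<Rightarrow> bool" where
  "runs M P l m R Wr wk sp Q \<longleftrightarrow> (\<exists>r. exec M P l m r \<and> reads r \<subseteq> R \<and> writes r \<subseteq> Wr \<and>
     io_work r \<le> wk \<and> io_span r \<le> sp \<and> Q (final_local r) (final_mem r) \<and>
     (\<forall>a. a \<notin> writes r \<longrightarrow> final_mem r a = m a) \<and> mem_ok (word_bound M) (final_mem r))"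

text \<open>The new postcondition may be derived with the frame outside \<open>Wr\<close>, so it can
  speak about memory that the thread never touches.\<close>

lemma runs_weaken:
  assumes "runs M P l m R Wr wk sp Q" "R \<subseteq> R'" "Wr \<subseteq> Wr'" "wk \<le> wk'" "sp \<le> sp'"
    "\<And>l' m'. \<lbrakk>mem_ok (word_bound M) m'; \<And>a. a \<notin> Wr \<Longrightarrow> m' a = m a; Q l' m'\<rbrakk> \<Longrightarrow> Q' l' m'"
  shows "runs M P l m R' Wr' wk' sp' Q'"
proof -
  from assms(1) obtain r where r: "exec M P l m r" "reads r \<subseteq> R" "writes r \<subseteq> Wr"
     "io_work r \<le> wk" "io_span r \<le> sp" "Q (final_local r) (final_mem r)"
     "\<And>a. a \<notin> writes r \<Longrightarrow> final_mem r a = m a" "mem_ok (word_bound M) (final_mem r)"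
    unfolding runs_def by blast
  have "Q' (final_local r) (final_mem r)"
    using r by (intro assms(6)) auto
  then show ?thesis
    unfolding runs_def using r assms(2-5) by (intro exI[of _ r]) auto
qed

lemma runs_halt:
  assumes "local_ok M l" "P l = Halt" "mem_ok (word_bound M) m" "Q l m"
  shows "runs M P l m R Wr wk sp Q"
  unfolding runs_def
  by (intro exI[of _ "\<lparr> final_local = l, final_mem = m, reads = {}, writes = {}, io_work = 0, io_span = 0 \<rparr>"] conjI
      exec_halt) (use assms in auto)

lemma runs_read:
  assumes "local_ok M l" "P l = Read j l'" "word_keys (set l') \<subseteq> word_keys (set l)" "j \<in> R"
    "runs M P (l' @ block (block_size M) m j) m R Wr wk sp Q"
  shows "runs M P l m R Wr (Suc wk) (Suc sp) Q"
proof -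
  from assms(5) obtain r where r: "exec M P (l' @ block (block_size M) m j) m r" "reads r \<subseteq> R" "writes r \<subseteq> Wr"
     "io_work r \<le> wk" "io_span r \<le> sp" "Q (final_local r) (final_mem r)"
     "\<And>a. a \<notin> writes r \<Longrightarrow> final_mem r a = m a" "mem_ok (word_bound M) (final_mem r)"
    unfolding runs_def by blast
  show ?thesis
    unfolding runs_def using exec_read[OF assms(1-3) r(1)] r(2-) assms(4)
    by (intro exI[of _ "r\<lparr>reads := insert j (reads r), io_work := io_work r + 1, io_span := io_span r + 1\<rparr>"]) auto
qed

lemma write_block_other:
  "a \<notin> (\<lambda>i. j * B + i) ` dom u \<Longrightarrow> write_block B m j u a = m a"
  unfolding write_block_def
  by (auto split: option.splits) (metis div_mult_mod_eq domI image_eqI)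

lemma mem_ok_write_block:
  assumes "mem_ok W m" "\<And>v. Num v \<in> ran u \<Longrightarrow> v < W"
  shows "mem_ok W (write_block B m j u)"
  using assms unfolding mem_ok_def write_block_def
  by (auto split: option.splits if_splits intro: ranI)

lemma runs_write:
  assumes "local_ok M l" "P l = Write j u l'" "dom u \<subseteq> {..<block_size M}" "words_ok M (ran u)"
    "word_keys (ran u \<union> set l') \<subseteq> word_keys (set l)"
    "(\<lambda>i. j * block_size M + i) ` dom u \<subseteq> Wr"
    "runs M P l' (write_block (block_size M) m j u) R Wr wk sp Q"
  shows "runs M P l m R Wr (Suc wk) (Suc sp) Q"
proof -
  from assms(7) obtain r where r: "exec M P l' (write_block (block_size M) m j u) r" "reads r \<subseteq> R" "writes r \<subseteq> Wr"
     "io_work r \<le> wk" "io_span r \<le> sp" "Q (final_local r) (final_mem r)"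
     "\<And>a. a \<notin> writes r \<Longrightarrow> final_mem r a = write_block (block_size M) m j u a" "mem_ok (word_bound M) (final_mem r)"
    unfolding runs_def by blast
  show ?thesis
    unfolding runs_def using exec_write[OF assms(1-5) r(1)] r(2-) assms(6)
    by (intro exI[of _ "r\<lparr>writes := (\<lambda>i. j * block_size M + i) ` dom u \<union> writes r, io_work := io_work r + 1, io_span := io_span r + 1\<rparr>"])
      (auto simp: write_block_other)
qed

text \<open>Child \<open>i\<close> is verified on its own and establishes \<open>Qs i\<close> in its
  private final memory \<open>mi\<close>. The continuation learns that the merged memory agrees with
  \<open>mi\<close> off the ranges of the other children, including words that nobody writes, so an
  assertion of child \<open>i\<close> carries over as soon as it avoids the other
  \<open>Ws j\<close>.\<close>

lemma runs_fork:
  fixes ls :: "'k local list"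
  assumes l: "local_ok M l" "P l = Fork ls l'" "length ls \<le> block_size M"
    "\<forall>x\<in>set ls. length x \<le> max_args M"
    "word_keys (\<Union> (set ` set ls) \<union> set l') \<subseteq> word_keys (set l)"
    and ok: "mem_ok (word_bound M) m"
    and ch: "\<And>i. i < length ls \<Longrightarrow> runs M P (ls ! i) m (Rs i) (Ws i) (wks i) sp1 (\<lambda>_. Qs i)"
    and sub: "\<And>i. i < length ls \<Longrightarrow> Rs i \<subseteq> R" "\<And>i. i < length ls \<Longrightarrow> Ws i \<subseteq> Wr"
    and disj: "\<And>i j. \<lbrakk>i < length ls; j < length ls; i \<noteq> j\<rbrakk> \<Longrightarrow> Ws i \<inter> Ws j = {}"
      "\<And>i j. \<lbrakk>i < length ls; j < length ls; i \<noteq> j\<rbrakk> \<Longrightarrow> (\<lambda>a. a div block_size M) ` Ws i \<inter> Rs j = {}"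
    and cont: "\<And>m'. \<lbrakk>mem_ok (word_bound M) m';
        \<And>i. i < length ls \<Longrightarrow> \<exists>mi. Qs i mi \<and> (\<forall>a. (\<forall>j<length ls. j \<noteq> i \<longrightarrow> a \<notin> Ws j) \<longrightarrow> m' a = mi a);
        \<And>a. (\<forall>j<length ls. a \<notin> Ws j) \<Longrightarrow> m' a = m a\<rbrakk>
        \<Longrightarrow> runs M P l' m' R Wr wk sp Q"
    and wk: "(\<Sum>i<length ls. wks i) + wk \<le> wk'" and sp: "sp1 + sp \<le> sp'"
  shows "runs M P l m R Wr wk' sp' Q"
proof -
  let ?n = "length ls"
  have "\<forall>i. \<exists>r. i < ?n \<longrightarrow> exec M P (ls ! i) m r \<and> reads r \<subseteq> Rs i \<and> writes r \<subseteq> Ws i \<and>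
     io_work r \<le> wks i \<and> io_span r \<le> sp1 \<and> Qs i (final_mem r) \<and>
     (\<forall>a. a \<notin> writes r \<longrightarrow> final_mem r a = m a) \<and> mem_ok (word_bound M) (final_mem r)"
    using ch unfolding runs_def by blast
  then obtain s where s0: "\<forall>i. i < ?n \<longrightarrow> exec M P (ls ! i) m (s i) \<and> reads (s i) \<subseteq> Rs i \<and> writes (s i) \<subseteq> Ws i \<and>
     io_work (s i) \<le> wks i \<and> io_span (s i) \<le> sp1 \<and> Qs i (final_mem (s i)) \<and>
     (\<forall>a. a \<notin> writes (s i) \<longrightarrow> final_mem (s i) a = m a) \<and> mem_ok (word_bound M) (final_mem (s i))"
    by metis
  then have s: "\<And>i. i < ?n \<Longrightarrow> exec M P (ls ! i) m (s i)" "\<And>i. i < ?n \<Longrightarrow> reads (s i) \<subseteq> Rs i"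
     "\<And>i. i < ?n \<Longrightarrow> writes (s i) \<subseteq> Ws i" "\<And>i. i < ?n \<Longrightarrow> io_work (s i) \<le> wks i"
     "\<And>i. i < ?n \<Longrightarrow> io_span (s i) \<le> sp1" "\<And>i. i < ?n \<Longrightarrow> Qs i (final_mem (s i))"
     "\<And>i a. i < ?n \<Longrightarrow> a \<notin> writes (s i) \<Longrightarrow> final_mem (s i) a = m a"
     "\<And>i. i < ?n \<Longrightarrow> mem_ok (word_bound M) (final_mem (s i))" by blast+
  \<comment> \<open>The choice is harmless: the bounds \<open>Ws\<close> are disjoint, so at most
    one child writes a given word.\<close>
  define m' where "m' = (\<lambda>a. if \<exists>i<?n. a \<in> writes (s i) then final_mem (s (SOME i. i < ?n \<and> a \<in> writes (s i))) a else m a)"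
  have uniq: "i = j" if "i < ?n" "j < ?n" "a \<in> writes (s i)" "a \<in> writes (s j)" for i j a
    using disj(1)[of i j] s(3)[of i] s(3)[of j] that by auto
  have m'1: "m' a = final_mem (s i) a" if "i < ?n" "a \<in> writes (s i)" for i a
  proof -
    have "(SOME i. i < ?n \<and> a \<in> writes (s i)) = i"
      by (rule some_equality) (use that uniq in auto)
    then show ?thesis unfolding m'_def using that by auto
  qed
  have m'2: "m' a = m a" if "\<And>i. i < ?n \<Longrightarrow> a \<notin> writes (s i)" for a
    unfolding m'_def using that by auto
  have mg: "merged ?n m s m'"
    unfolding merged_def using m'1 m'2 by auto
  have rf: "race_free (block_size M) ?n s"
    unfolding race_free_def
  proof (intro allI impI)
    fix i j assume ij: "i < ?n" "j < ?n" "i \<noteq> j"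
    have "(\<lambda>a. a div block_size M) ` writes (s i) \<subseteq> (\<lambda>a. a div block_size M) ` Ws i"
      using s(3) ij by blast
    with disj[OF ij] s(2,3) ij show "writes (s i) \<inter> writes (s j) = {} \<and>
          (\<lambda>a. a div block_size M) ` writes (s i) \<inter> reads (s j) = {}"
      by blast
  qed
  have "mem_ok (word_bound M) m'"
    unfolding mem_ok_def
  proof (intro allI impI)
    fix a v assume *: "m' a = Num v"
    show "v < word_bound M"
    proof (cases "\<exists>i<?n. a \<in> writes (s i)")
      case True
      then obtain i where "i < ?n" "a \<in> writes (s i)" by blast
      with m'1 * s(8) show ?thesis unfolding mem_ok_def by metis
    next
      case False with * ok m'2 show ?thesis unfolding mem_ok_def by metis
    qed
  qed
  moreover have "\<exists>mi. Qs i mi \<and> (\<forall>a. (\<forall>j<?n. j \<noteq> i \<longrightarrow> a \<notin> Ws j) \<longrightarrow> m' a = mi a)" if i: "i < ?n" for i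
  proof (intro exI[of _ "final_mem (s i)"] conjI allI impI)
    show "Qs i (final_mem (s i))" using s(6) i .
    fix a assume a: "\<forall>j<?n. j \<noteq> i \<longrightarrow> a \<notin> Ws j"
    show "m' a = final_mem (s i) a"
    proof (cases "a \<in> writes (s i)")
      case True then show ?thesis using m'1 i by simp
    next
      case False
      then have "m' a = m a" using a s(3) by (intro m'2) blast
      then show ?thesis using s(7)[OF i False] by simp
    qed
  qed
  moreover have "m' a = m a" if "\<forall>j<?n. a \<notin> Ws j" for a
    using that s(3) by (intro m'2) blast
  ultimately have "runs M P l' m' R Wr wk sp Q" by (rule cont)
  then obtain r where r: "exec M P l' m' r" "reads r \<subseteq> R" "writes r \<subseteq> Wr"
     "io_work r \<le> wk" "io_span r \<le> sp" "Q (final_local r) (final_mem r)"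
     "\<And>a. a \<notin> writes r \<Longrightarrow> final_mem r a = m' a" "mem_ok (word_bound M) (final_mem r)"
    unfolding runs_def by blast
  let ?r = "r \<lparr> reads := (\<Union>i<?n. reads (s i)) \<union> reads r,
                           writes := (\<Union>i<?n. writes (s i)) \<union> writes r,
                           io_work := (\<Sum>i<?n. io_work (s i)) + io_work r,
                           io_span := Max (insert 0 ((\<lambda>i. io_span (s i)) ` {..<?n})) + io_span r \<rparr>"
  have "exec M P l m ?r"
    using exec_fork[of M l P ls l' m s m' r, OF l _ rf mg r(1)] s(1) by blast
  moreover have "reads ?r \<subseteq> R" using r(2) s(2) sub(1) by fastforce
  moreover have "writes ?r \<subseteq> Wr" using r(3) s(3) sub(2) by fastforce
  moreover have "io_work ?r \<le> wk'"
    using sum_mono[of "{..<?n}" "\<lambda>i. io_work (s i)" wks] s(4) r(4) wk by simp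
  moreover have "io_span ?r \<le> sp'"
  proof -
    have "Max (insert 0 ((\<lambda>i. io_span (s i)) ` {..<?n})) \<le> sp1"
      using s(5) by (intro Max.boundedI) auto
    moreover have "io_span ?r = Max (insert 0 ((\<lambda>i. io_span (s i)) ` {..<?n})) + io_span r"
      by (simp del: Max_insert)
    ultimately show ?thesis using r(5) sp by linarith
  qed
  moreover have "\<forall>a. a \<notin> writes ?r \<longrightarrow> final_mem ?r a = m a"
    using r(7) m'2 by auto
  ultimately show ?thesis
    unfolding runs_def using r(6,8) by (intro exI[of _ ?r]) auto
qed

section \<open>Straight-line threads and copying jobs\<close>

datatype 'k act = ARead nat | AWrite nat "nat \<Rightarrow> 'k word option" | AFork "nat list list" | AStop nat

type_synonym 'k code = "('k word list \<Rightarrow> 'k act) list"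

text \<open>A running thread has the local memory \<open>Num t # Num pc # rest\<close> with at least
  3 words in \<open>rest\<close>, which leaves the lengths 1 and 4 for the final memory
  \<open>[Num p]\<close> and the initial one. An empty fork transfers nothing and has span 0; it
  serves as a free step that replaces the local memory, to install code 0 at the start and to
  discard everything but the result at the end.\<close>

definition interp :: "(nat \<Rightarrow> 'k code) \<Rightarrow> 'k program" where
  "interp cd l =
    (if length l = 1 then Halt
     else if length l = 4 then Fork [] (Num 0 # Num 0 # l)
     else case l of
       Num t # Num pc # rest \<Rightarrow>
         if pc < length (cd t) then
           (case (cd t ! pc) rest of
              ARead j \<Rightarrow> Read j (Num t # Num (Suc pc) # rest)
            | AWrite j u \<Rightarrow> Write j u (Num t # Num (Suc pc) # rest)
            | AFork as \<Rightarrow> Fork (map (map Num) as) (Num t # Num (Suc pc) # rest)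
            | AStop p \<Rightarrow> Fork [] [Num p])
         else Halt
     | _ \<Rightarrow> Halt)"

text \<open>\<open>Copy s n d\<close> moves \<open>n\<close> words from \<open>s\<close> to
  \<open>d\<close>; \<open>Store n d v w\<close> puts the number \<open>v\<close> at
  \<open>d\<close> and \<open>w\<close> into the words behind it. Stores let computed headers and
  pointers be written in parallel with the copies.\<close>

datatype job = Copy nat nat nat | Store nat nat nat nat

fun job_args :: "job \<Rightarrow> nat list" where
  "job_args (Copy s n d) = [s, n, d, 0, 0, 0]"
| "job_args (Store n d v w) = [0, n, d, 1, v, w]"

fun job_range :: "job \<Rightarrow> nat set" where
  "job_range (Copy s n d) = {d..<d + n}"
| "job_range (Store n d v w) = {d..<d + n}"

text \<open>A \<open>Store\<close> runs the same code as a \<open>Copy\<close> with source 0, so it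
  reads the blocks 0 and 1 and ignores them.\<close>

fun job_reads :: "nat \<Rightarrow> job \<Rightarrow> nat set" where
  "job_reads B (Copy s n d) = {s div B, Suc (s div B)}"
| "job_reads B (Store n d v w) = {0, 1}"

fun job_done :: "'k mem \<Rightarrow> job \<Rightarrow> 'k mem \<Rightarrow> bool" where
  "job_done m (Copy s n d) m' \<longleftrightarrow> (\<forall>i<n. m' (d + i) = m (s + i))"
| "job_done m (Store n d v w) m' \<longleftrightarrow> (\<forall>i<n. m' (d + i) = Num (if i = 0 then v else w))"

text \<open>\<open>B + 1\<close> is the largest length for which an interval lies in two consecutive
  blocks whatever its offset, and just enough for the child pointers of a full node.\<close>

fun job_ok :: "nat \<Rightarrow> nat \<Rightarrow> job \<Rightarrow> bool" where
  "job_ok B W (Copy s n d) \<longleftrightarrow> n \<le> Suc B \<and> s < W \<and> d < W"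
| "job_ok B W (Store n d v w) \<longleftrightarrow> n \<le> 2 \<and> d < W \<and> v < W \<and> w < W"

fun num_of :: "'k word \<Rightarrow> nat" where
  "num_of (Num v) = v"
| "num_of (Key k) = 0"

abbreviation arg :: "'k word list \<Rightarrow> nat \<Rightarrow> nat" where
  "arg rest i \<equiv> num_of (rest ! i)"

text \<open>The local memory of a job is \<open>[B, src, len, dst, mode, v, w]\<close>, followed by the blocks read.\<close>

definition job_val :: "'k word list \<Rightarrow> nat \<Rightarrow> 'k word" where
  "job_val rest i = (if arg rest 4 = 1 then rest ! (if i = 0 then 5 else 6)
     else rest ! (7 + arg rest 1 mod arg rest 0 + i))"

text \<open>Two source blocks and two target blocks are always accessed, at a cost of exactly 4,
  even if the second one contributes no word. The writes change only words of the target interval,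
  so different jobs may fill parts of the same block in parallel.\<close>

definition job_code :: "'k code" where
  "job_code =
    [\<lambda>rest. ARead (arg rest 1 div arg rest 0),
     \<lambda>rest. ARead (Suc (arg rest 1 div arg rest 0)),
     \<lambda>rest. let B = arg rest 0; n = arg rest 2; o1 = arg rest 3 mod B in
       AWrite (arg rest 3 div B)
        (\<lambda>i. if o1 \<le> i \<and> i < o1 + n \<and> i < B then Some (job_val rest (i - o1)) else None),
     \<lambda>rest. let B = arg rest 0; n = arg rest 2; o1 = arg rest 3 mod B in
       AWrite (Suc (arg rest 3 div B))
        (\<lambda>i. if i + B < o1 + n \<and> i < B then Some (job_val rest (i + B - o1)) else None)]"

lemma div_mod_block:
  assumes "(x::nat) < B"
  shows "(k * B + x) div B = k" "(k * B + x) mod B = x"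
  using assms by simp_all

lemma block_nth: "i < B \<Longrightarrow> block B m j ! i = m (j * B + i)"
  unfolding block_def by simp

lemma length_block [simp]: "length (block B m j) = B"
  unfolding block_def by simp

lemma set_block_ok: "mem_ok (word_bound M) m \<Longrightarrow> words_ok M (set (block B m j))"
  unfolding block_def words_ok_def mem_ok_def by auto

lemma words_ok_Un [simp]: "words_ok M (A \<union> C) \<longleftrightarrow> words_ok M A \<and> words_ok M C"
  unfolding words_ok_def by auto

lemma words_ok_Num [simp]: "words_ok M (insert (Num v) A) \<longleftrightarrow> v < word_bound M \<and> words_ok M A"
  unfolding words_ok_def by auto

lemma word_keys_Num [simp]: "word_keys (insert (Num v) A) = word_keys A"
  unfolding word_keys_def by auto

lemma word_keys_Num_image [simp]: "word_keys (Num ` A) = {}"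
  unfolding word_keys_def by auto

lemma word_keys_Un: "word_keys (A \<union> C) = word_keys A \<union> word_keys C"
  unfolding word_keys_def by auto

lemma word_keys_mono: "A \<subseteq> C \<Longrightarrow> word_keys A \<subseteq> word_keys C"
  unfolding word_keys_def by auto

section \<open>Rules for threads of straight-line code\<close>

locale fork_join =
  fixes M :: machine and B W :: nat and cd :: "nat \<Rightarrow> 'k code"
  assumes block_size [simp]: "block_size M = B"
    and word_bound [simp]: "word_bound M = W"
    and B_ge: "2 \<le> B"
    and cache_ge: "64 \<le> cache M"
    and max_args_ge: "64 \<le> max_args M"
    and W_ge: "4 < W"
    and code_length: "\<And>t. length (cd t) < W"
    and job_cd: "cd 1 = job_code"
begin

lemma B_pos [simp]: "0 < B" "B \<noteq> 0" using B_ge by auto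

text \<open>62 blocks of data and the two words \<open>Num t\<close> and \<open>Num pc\<close> fit
  into the 64 blocks of \<open>cache_ge\<close>. The lower bound 3 keeps the local memory away from
  the lengths 1 and 4, which \<open>interp\<close> treats specially.\<close>

definition rest_ok :: "'k word list \<Rightarrow> bool" where
  "rest_ok rest \<longleftrightarrow> 3 \<le> length rest \<and> length rest \<le> 62 * B \<and> words_ok M (set rest)"

text \<open>\<open>is\<close> are the instructions that the thread still has to execute.\<close>

definition thr :: "nat \<Rightarrow> 'k code \<Rightarrow> 'k word list \<Rightarrow> 'k mem \<Rightarrow> nat set \<Rightarrow> nat set \<Rightarrow> nat \<Rightarrow> nat
    \<Rightarrow> ('k local \<Rightarrow> 'k mem \<Rightarrow> bool) \<Rightarrow> bool" where
  "thr t is rest m R Wr wk sp Q \<longleftrightarrow>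
    (\<forall>pc. pc \<le> length (cd t) \<longrightarrow> drop pc (cd t) = is \<longrightarrow>
       runs M (interp cd) (Num t # Num pc # rest) m R Wr wk sp Q)"

lemma local_okI:
  assumes "rest_ok rest" "t < 4" "pc \<le> length (cd t)"
  shows "local_ok M (Num t # Num pc # rest)"
proof -
  have "64 * B \<le> cache M * B" using cache_ge by simp
  then have "Suc (Suc (length rest)) \<le> cache M * B"
    using assms(1) B_ge unfolding rest_ok_def by linarith
  then show ?thesis
    using assms W_ge code_length[of t] unfolding rest_ok_def local_ok_def by simp
qed

lemma rest_ok_block:
  assumes "rest_ok rest" "mem_ok W m" "length rest + B \<le> 62 * B"
  shows "rest_ok (rest @ block B m j)"
  using assms set_block_ok[of M m B j] unfolding rest_ok_def by simp

lemma drop_Cons_step: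
  assumes "drop pc xs = i # is"
  shows "pc < length xs" "xs ! pc = i" "drop (Suc pc) xs = is"
proof -
  show "pc < length xs"
    using assms by (rule contrapos_pp) simp
  then have "drop pc xs = xs ! pc # drop (Suc pc) xs" by (rule Cons_nth_drop_Suc[symmetric])
  then show "xs ! pc = i" "drop (Suc pc) xs = is" using assms by simp_all
qed

lemma interp_step:
  assumes "rest_ok rest" "drop pc (cd t) = i # is"
  shows "interp cd (Num t # Num pc # rest) = (case i rest of
              ARead j \<Rightarrow> Read j (Num t # Num (Suc pc) # rest)
            | AWrite j u \<Rightarrow> Write j u (Num t # Num (Suc pc) # rest)
            | AFork as \<Rightarrow> Fork (map (map Num) as) (Num t # Num (Suc pc) # rest)
            | AStop p \<Rightarrow> Fork [] [Num p])"
  using assms drop_Cons_step[OF assms(2)] unfolding interp_def rest_ok_def by auto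

lemma thr_nil:
  assumes "rest_ok rest" "t < 4" "mem_ok W m" "\<And>l. Q l m"
  shows "thr t [] rest m R Wr wk sp Q"
  unfolding thr_def
proof (intro allI impI)
  fix pc assume pc: "pc \<le> length (cd t)" "drop pc (cd t) = []"
  show "runs M (interp cd) (Num t # Num pc # rest) m R Wr wk sp Q"
  proof (rule runs_halt)
    show "interp cd (Num t # Num pc # rest) = Halt"
      using pc assms(1) unfolding interp_def rest_ok_def by auto
  qed (use assms pc local_okI in auto)
qed

lemma thr_read:
  assumes "rest_ok rest" "t < 4" "mem_ok W m" "length rest + B \<le> 62 * B" "i rest = ARead j" "j \<in> R"
    "rest_ok (rest @ block B m j) \<Longrightarrow> thr t is (rest @ block B m j) m R Wr wk sp Q"
  shows "thr t (i # is) rest m R Wr (Suc wk) (Suc sp) Q"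
  unfolding thr_def
proof (intro allI impI)
  fix pc assume pc: "pc \<le> length (cd t)" "drop pc (cd t) = i # is"
  note d = drop_Cons_step[OF pc(2)]
  have "runs M (interp cd) (Num t # Num (Suc pc) # rest @ block B m j) m R Wr wk sp Q"
    using assms(7)[OF rest_ok_block[OF assms(1,3,4)]] d unfolding thr_def by auto
  then show "runs M (interp cd) (Num t # Num pc # rest) m R Wr (Suc wk) (Suc sp) Q"
    using assms pc interp_step[OF assms(1) pc(2)] local_okI
    by (intro runs_read[where l' = "Num t # Num (Suc pc) # rest"]) auto
qed

lemma thr_write:
  assumes "rest_ok rest" "t < 4" "mem_ok W m" "i rest = AWrite j u"
    "dom u \<subseteq> {..<B}" "ran u \<subseteq> set rest" "(\<lambda>i. j * B + i) ` dom u \<subseteq> Wr"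
    "mem_ok W (write_block B m j u) \<Longrightarrow> thr t is rest (write_block B m j u) R Wr wk sp Q"
  shows "thr t (i # is) rest m R Wr (Suc wk) (Suc sp) Q"
  unfolding thr_def
proof (intro allI impI)
  fix pc assume pc: "pc \<le> length (cd t)" "drop pc (cd t) = i # is"
  note d = drop_Cons_step[OF pc(2)]
  have wr: "words_ok M (ran u)"
    using assms(1,6) unfolding rest_ok_def words_ok_def by auto
  then have "mem_ok W (write_block B m j u)"
    by (intro mem_ok_write_block assms(3)) (auto simp: words_ok_def)
  then have "runs M (interp cd) (Num t # Num (Suc pc) # rest) (write_block B m j u) R Wr wk sp Q"
    using assms(8) d unfolding thr_def by auto
  then show "runs M (interp cd) (Num t # Num pc # rest) m R Wr (Suc wk) (Suc sp) Q"
    using assms pc interp_step[OF assms(1) pc(2)] local_okI wr word_keys_mono[OF assms(6)]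
    by (intro runs_write[where l' = "Num t # Num (Suc pc) # rest" and u = u and j = j])
      (auto simp: word_keys_Un)
qed

lemma thr_fork:
  assumes "rest_ok rest" "t < 4" "mem_ok W m" "i rest = AFork ls" "length ls \<le> B"
    "\<And>as. as \<in> set ls \<Longrightarrow> length as \<le> 64"
    and ch: "\<And>i. i < length ls \<Longrightarrow> runs M (interp cd) (map Num (ls ! i)) m (Rs i) (Ws i) (wks i) sp1 (\<lambda>_. Qs i)"
    and sub: "\<And>i. i < length ls \<Longrightarrow> Rs i \<subseteq> R" "\<And>i. i < length ls \<Longrightarrow> Ws i \<subseteq> Wr"
    and disj: "\<And>i j. \<lbrakk>i < length ls; j < length ls; i \<noteq> j\<rbrakk> \<Longrightarrow> Ws i \<inter> Ws j = {}"
      "\<And>i j. \<lbrakk>i < length ls; j < length ls; i \<noteq> j\<rbrakk> \<Longrightarrow> (\<lambda>a. a div B) ` Ws i \<inter> Rs j = {}"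
    and cont: "\<And>m'. \<lbrakk>mem_ok W m';
        \<And>i. i < length ls \<Longrightarrow> \<exists>mi. Qs i mi \<and> (\<forall>a. (\<forall>j<length ls. j \<noteq> i \<longrightarrow> a \<notin> Ws j) \<longrightarrow> m' a = mi a);
        \<And>a. (\<forall>j<length ls. a \<notin> Ws j) \<Longrightarrow> m' a = m a\<rbrakk>
        \<Longrightarrow> thr t is rest m' R Wr wk sp Q"
    and wk: "(\<Sum>i<length ls. wks i) + wk \<le> wk'" and sp: "sp1 + sp \<le> sp'"
  shows "thr t (i # is) rest m R Wr wk' sp' Q"
  unfolding thr_def
proof (intro allI impI)
  fix pc assume pc: "pc \<le> length (cd t)" "drop pc (cd t) = i # is"
  note d = drop_Cons_step[OF pc(2)]
  show "runs M (interp cd) (Num t # Num pc # rest) m R Wr wk' sp' Q"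
  proof (rule runs_fork[where ls = "map (map Num) ls" and l' = "Num t # Num (Suc pc) # rest"
        and Rs = Rs and Ws = Ws and wks = wks and ?sp1.0 = sp1 and Qs = Qs and wk = wk and sp = sp])
    show "word_keys (\<Union> (set ` set (map (map Num) ls)) \<union> set (Num t # Num (Suc pc) # rest))
      \<subseteq> word_keys (set (Num t # Num pc # rest))"
      by (auto simp: word_keys_def)
    fix m' assume "mem_ok (word_bound M) m'"
      "\<And>i. i < length (map (map Num :: _ \<Rightarrow> 'k word list) ls) \<Longrightarrow> \<exists>mi. Qs i mi \<and> (\<forall>a. (\<forall>j<length (map (map Num :: _ \<Rightarrow> 'k word list) ls). j \<noteq> i \<longrightarrow> a \<notin> Ws j) \<longrightarrow> m' a = mi a)"
      "\<And>a. \<forall>j<length (map (map Num :: _ \<Rightarrow> 'k word list) ls). a \<notin> Ws j \<Longrightarrow> m' a = m a"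
    then have "thr t is rest m' R Wr wk sp Q" by (intro cont) auto
    then show "runs M (interp cd) (Num t # Num (Suc pc) # rest) m' R Wr wk sp Q"
      using d unfolding thr_def by auto
  qed (use assms pc interp_step[OF assms(1) pc(2)] local_okI max_args_ge in \<open>auto intro: order_trans\<close>)
qed

lemma thr_start:
  assumes "thr t (cd t) (map Num as) m R Wr wk sp Q"
  shows "runs M (interp cd) (map Num (t # 0 # as)) m R Wr wk sp Q"
  using assms unfolding thr_def by auto

lemma rest_ok_map_Num: "3 \<le> length as \<Longrightarrow> length as \<le> 62 * B \<Longrightarrow> \<forall>a\<in>set as. a < W \<Longrightarrow> rest_ok (map Num as)"
  unfolding rest_ok_def words_ok_def by auto

lemma thr_weaken:
  assumes "thr t is rest m R Wr wk sp Q" "R \<subseteq> R'" "Wr \<subseteq> Wr'" "wk \<le> wk'" "sp \<le> sp'"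
    "\<And>l' m'. \<lbrakk>mem_ok W m'; \<And>a. a \<notin> Wr \<Longrightarrow> m' a = m a; Q l' m'\<rbrakk> \<Longrightarrow> Q' l' m'"
  shows "thr t is rest m R' Wr' wk' sp' Q'"
  using assms(1) runs_weaken[OF _ assms(2-5)] assms(6) unfolding thr_def by (metis word_bound)

text \<open>After the two reads the local memory contains the \<open>2 * B\<close> words from the
  beginning of the source block on, so word \<open>s + i\<close> is found at position
  \<open>7 + s mod B + i\<close>. The bound on \<open>W\<close> covers \<open>B\<close> and the
  length \<open>n\<close>, which are passed as numbers.\<close>

lemma job_runs:
  assumes ok: "job_ok B W j" and m: "mem_ok W m" and BW: "2 * B < W"
  shows "runs M (interp cd) (map Num (1 # 0 # B # job_args j)) m (job_reads B j) (job_range j) 4 4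
     (\<lambda>_ m'. job_done m j m')"
proof -
  obtain s n d md v w where j: "job_args j = [s, n, d, md, v, w]" by (cases j) auto
  have rng: "job_range j = {d..<d + n}" and rds: "job_reads B j = {s div B, Suc (s div B)}"
    using j by (cases j; auto)+
  have n: "n \<le> Suc B" using ok j B_ge by (cases j) auto
  have md: "md = 1 \<Longrightarrow> n \<le> 2" using ok j by (cases j) auto
  have lt: "s < W" "n < W" "d < W" "md < W" "v < W" "w < W"
    using ok j BW W_ge by (cases j; auto)+
  let ?r0 = "map Num (B # job_args j) :: 'k word list"
  let ?rest = "(?r0 @ block B m (s div B)) @ block B m (Suc (s div B))"
  have r0: "rest_ok ?r0"
    using lt BW B_ge j by (intro rest_ok_map_Num) auto
  have l0: "length ?r0 = 7" using j by simp
  have len: "length ?rest = 7 + 2 * B" using l0 by simp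
  have rest0: "arg ?rest 0 = B" "arg ?rest 1 = s" "arg ?rest 2 = n" "arg ?rest 3 = d" "arg ?rest 4 = md"
    "?rest ! 5 = Num v" "?rest ! 6 = Num w"
    using j by (auto simp: nth_append nth_Cons')
  have nth: "?rest ! (7 + x) = m (s div B * B + x)" if "x < 2 * B" for x
  proof (cases "x < B")
    case True then show ?thesis by (simp add: nth_append l0 block_nth j nth_Cons')
  next
    case False
    then have "x - B < B" using that by simp
    then show ?thesis using False by (simp add: nth_append l0 block_nth j nth_Cons' algebra_simps)
  qed
  have val: "job_val ?rest i = m (s + i)" if "md \<noteq> 1" "i < n" for i
  proof -
    have "s mod B + i < 2 * B" using that n mod_less_divisor[of B s] B_pos(1) by linarith
    then have "?rest ! (7 + (s mod B + i)) = m (s div B * B + (s mod B + i))" by (rule nth)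
    then show ?thesis using that rest0
      unfolding job_val_def by (simp add: add.assoc[symmetric])
  qed
  have val1: "job_val ?rest i = Num (if i = 0 then v else w)" if "md = 1" for i
    unfolding job_val_def using that rest0 by simp
  have inrest: "job_val ?rest i \<in> set ?rest" if "i < n" for i
  proof (cases "md = 1")
    case True
    have "?rest ! 5 \<in> set ?rest" "?rest ! 6 \<in> set ?rest"
      by (rule nth_mem, use len in linarith)+
    then show ?thesis using val1[OF True] rest0 by auto
  next
    case False
    have "s mod B + i < 2 * B" using that n mod_less_divisor[of B s] B_pos(1) by linarith
    then have "?rest ! (7 + (s mod B + i)) \<in> set ?rest"
      by (intro nth_mem) (use len in linarith)
    then show ?thesis unfolding job_val_def rest0 using False by (simp only: if_False add.assoc)
  qed
  \<comment> \<open>The target interval begins at offset \<open>d mod B\<close> of its first block.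
    \<open>u1\<close> is its part in that block and \<open>u2\<close> the overflow, whose offset
    \<open>i\<close> is position \<open>i + B\<close> counted from the first block.\<close>
  define u1 where "u1 = (\<lambda>i. if d mod B \<le> i \<and> i < d mod B + n \<and> i < B then Some (job_val ?rest (i - d mod B)) else None)"
  define u2 where "u2 = (\<lambda>i. if i + B < d mod B + n \<and> i < B then Some (job_val ?rest (i + B - d mod B)) else None)"
  let ?m1 = "write_block B m (d div B) u1"
  let ?m2 = "write_block B ?m1 (Suc (d div B)) u2"
  have dd: "d div B * B + d mod B = d" by simp
  have dB: "d mod B < B" by simp
  have w1: "(\<lambda>i. d div B * B + i) ` dom u1 \<subseteq> {d..<d+n}"
  proof
    fix x assume "x \<in> (\<lambda>i. d div B * B + i) ` dom u1"
    then obtain i where i: "x = d div B * B + i" "d mod B \<le> i" "i < d mod B + n"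
      unfolding u1_def by (auto split: if_splits)
    then show "x \<in> {d..<d+n}" unfolding atLeastLessThan_iff using dd by linarith
  qed
  have w2: "(\<lambda>i. Suc (d div B) * B + i) ` dom u2 \<subseteq> {d..<d+n}"
  proof
    fix x assume "x \<in> (\<lambda>i. Suc (d div B) * B + i) ` dom u2"
    then obtain i where i: "x = Suc (d div B) * B + i" "i + B < d mod B + n"
      unfolding u2_def by (auto split: if_splits)
    then show "x \<in> {d..<d+n}" unfolding atLeastLessThan_iff mult_Suc using dd dB by linarith
  qed
  have m2: "?m2 (d + i) = job_val ?rest i" if i: "i < n" for i
  proof (cases "d mod B + i < B")
    case True
    have e: "d + i = d div B * B + (d mod B + i)" by simp
    have q: "(d + i) div B = d div B" "(d + i) mod B = d mod B + i"
      unfolding e by (rule div_mod_block[OF True])+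
    have "?m2 (d + i) = ?m1 (d + i)" unfolding write_block_def[of B ?m1] using q by simp
    also have "\<dots> = job_val ?rest i" unfolding write_block_def u1_def using q True i by simp
    finally show ?thesis .
  next
    case False
    have e: "d + i = Suc (d div B) * B + (d mod B + i - B)"
      using False div_mult_mod_eq[of d B] unfolding mult_Suc by linarith
    have lt: "d mod B + i - B < B" using n i dB by linarith
    have q: "(d + i) div B = Suc (d div B)" "(d + i) mod B = d mod B + i - B"
      unfolding e by (rule div_mod_block[OF lt])+
    show ?thesis unfolding write_block_def[of B ?m1] u2_def using q lt i False by simp
  qed
  have dn: "job_done m j ?m2"
  proof (cases j)
    case (Copy s' n' d')
    then show ?thesis using j m2 val by auto
  next
    case (Store n' d' v' w')
    then show ?thesis using j m2 val1 by auto
  qed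
  have ran1: "ran u1 \<subseteq> set ?rest"
  proof
    fix x assume "x \<in> ran u1"
    then obtain i where "x = job_val ?rest (i - d mod B)" "d mod B \<le> i" "i < d mod B + n"
      unfolding u1_def ran_def by (auto split: if_splits)
    moreover from this have "i - d mod B < n" by linarith
    ultimately show "x \<in> set ?rest" using inrest by blast
  qed
  have ran2: "ran u2 \<subseteq> set ?rest"
  proof
    fix x assume "x \<in> ran u2"
    then obtain i where "x = job_val ?rest (i + B - d mod B)" "i + B < d mod B + n"
      unfolding u2_def ran_def by (auto split: if_splits)
    moreover from this have "i + B - d mod B < n" using dB by linarith
    ultimately show "x \<in> set ?rest" using inrest by blast
  qed
  have "thr 1 (cd 1) ?r0 m {s div B, Suc (s div B)} {d..<d+n} (Suc (Suc (Suc (Suc 0)))) (Suc (Suc (Suc (Suc 0))))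
     (\<lambda>_ m'. job_done m j m')"
    unfolding job_cd job_code_def
  proof (rule thr_read[where j = "s div B"])
    assume r1: "rest_ok (?r0 @ block B m (s div B))"
    show "thr 1 [\<lambda>rest. ARead (Suc (arg rest 1 div arg rest 0)),
     \<lambda>rest. let B = arg rest 0; n = arg rest 2; o1 = arg rest 3 mod B in
       AWrite (arg rest 3 div B)
        (\<lambda>i. if o1 \<le> i \<and> i < o1 + n \<and> i < B then Some (job_val rest (i - o1)) else None),
     \<lambda>rest. let B = arg rest 0; n = arg rest 2; o1 = arg rest 3 mod B in
       AWrite (Suc (arg rest 3 div B))
        (\<lambda>i. if i + B < o1 + n \<and> i < B then Some (job_val rest (i + B - o1)) else None)]
       (?r0 @ block B m (s div B)) m {s div B, Suc (s div B)} {d..<d+n} (Suc (Suc (Suc 0))) (Suc (Suc (Suc 0)))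
     (\<lambda>_ m'. job_done m j m')"
    proof (rule thr_read[where j = "Suc (s div B)"])
      assume r2: "rest_ok ?rest"
      show "thr 1 [\<lambda>rest. let B = arg rest 0; n = arg rest 2; o1 = arg rest 3 mod B in
       AWrite (arg rest 3 div B)
        (\<lambda>i. if o1 \<le> i \<and> i < o1 + n \<and> i < B then Some (job_val rest (i - o1)) else None),
     \<lambda>rest. let B = arg rest 0; n = arg rest 2; o1 = arg rest 3 mod B in
       AWrite (Suc (arg rest 3 div B))
        (\<lambda>i. if i + B < o1 + n \<and> i < B then Some (job_val rest (i + B - o1)) else None)]
        ?rest m {s div B, Suc (s div B)} {d..<d+n} (Suc (Suc 0)) (Suc (Suc 0)) (\<lambda>_ m'. job_done m j m')"
      proof (rule thr_write[where j = "d div B" and u = u1])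
        assume ok1: "mem_ok W ?m1"
        show "thr 1 [\<lambda>rest. let B = arg rest 0; n = arg rest 2; o1 = arg rest 3 mod B in
           AWrite (Suc (arg rest 3 div B))
            (\<lambda>i. if i + B < o1 + n \<and> i < B then Some (job_val rest (i + B - o1)) else None)]
           ?rest ?m1 {s div B, Suc (s div B)} {d..<d+n} (Suc 0) (Suc 0) (\<lambda>_ m'. job_done m j m')"
        proof (rule thr_write[where j = "Suc (d div B)" and u = u2])
          assume ok2: "mem_ok W ?m2"
          show "thr 1 [] ?rest ?m2 {s div B, Suc (s div B)} {d..<d+n} 0 0 (\<lambda>_ m'. job_done m j m')"
            by (rule thr_nil) (use r2 ok2 dn in auto)
        next
          show "dom u2 \<subseteq> {..<B}" unfolding u2_def by (auto split: if_splits)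
        qed (rule r2, simp, rule ok1, simp only: rest0 Let_def u2_def, rule ran2, rule w2)
      next
        show "dom u1 \<subseteq> {..<B}" unfolding u1_def by (auto split: if_splits)
      qed (rule r2, simp, rule m, simp only: rest0 Let_def u1_def, rule ran1, rule w1)
    qed (use r1 m B_ge in \<open>auto simp: j\<close>)
  qed (use r0 m B_ge in \<open>auto simp: j\<close>)
  then have "thr 1 (cd 1) ?r0 m (job_reads B j) (job_range j) 4 4 (\<lambda>_ m'. job_done m j m')"
    unfolding rng rds by (simp add: numeral_eq_Suc)
  from thr_start[OF this] show ?thesis by simp
qed

end

section \<open>Lists of jobs, executed in batches of \<open>B\<close>\<close>

definition jobs_range :: "job list \<Rightarrow> nat set" where
  "jobs_range js = (\<Union>j\<in>set js. job_range j)"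

definition jobs_reads :: "nat \<Rightarrow> job list \<Rightarrow> nat set" where
  "jobs_reads B js = (\<Union>j\<in>set js. job_reads B j)"

text \<open>Disjointness is by position, not by element: a job that occurs twice must have an empty
  range.\<close>

definition jobs_disjoint :: "job list \<Rightarrow> bool" where
  "jobs_disjoint js \<longleftrightarrow> sorted_wrt (\<lambda>i j. job_range i \<inter> job_range j = {}) js"

definition jobs_done :: "'k mem \<Rightarrow> job list \<Rightarrow> 'k mem \<Rightarrow> bool" where
  "jobs_done m js m' \<longleftrightarrow> (\<forall>j\<in>set js. job_done m j m') \<and> (\<forall>a. a \<notin> jobs_range js \<longrightarrow> m' a = m a)"

lemma jobs_range_simps [simp]:
  "jobs_range [] = {}" "jobs_range (j # js) = job_range j \<union> jobs_range js"
  "jobs_range (js @ js') = jobs_range js \<union> jobs_range js'"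
  "jobs_range (concat jss) = (\<Union>js\<in>set jss. jobs_range js)"
  unfolding jobs_range_def by auto

lemma jobs_reads_simps [simp]:
  "jobs_reads B [] = {}" "jobs_reads B (j # js) = job_reads B j \<union> jobs_reads B js"
  "jobs_reads B (js @ js') = jobs_reads B js \<union> jobs_reads B js'"
  "jobs_reads B (concat jss) = (\<Union>js\<in>set jss. jobs_reads B js)"
  unfolding jobs_reads_def by auto

lemma jobs_disjoint_Nil [simp]: "jobs_disjoint []"
  unfolding jobs_disjoint_def by simp

lemma jobs_disjoint_Cons [simp]:
  "jobs_disjoint (j # js) \<longleftrightarrow> job_range j \<inter> jobs_range js = {} \<and> jobs_disjoint js"
  unfolding jobs_disjoint_def jobs_range_def by auto

lemma jobs_disjoint_append:
  "jobs_disjoint (js @ js') \<longleftrightarrow> jobs_disjoint js \<and> jobs_disjoint js' \<and> jobs_range js \<inter> jobs_range js' = {}"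
  unfolding jobs_disjoint_def sorted_wrt_append jobs_range_def by blast

lemma jobs_disjoint_concat:
  assumes "\<And>i. i \<in> {a..<b} \<Longrightarrow> jobs_disjoint (f i)"
    "\<And>i j. \<lbrakk>a \<le> i; i < j; j < b\<rbrakk> \<Longrightarrow> jobs_range (f i) \<inter> jobs_range (f j) = {}"
  shows "jobs_disjoint (concat (map f [a..<b]))"
  using assms
proof (induction b)
  case (Suc b)
  show ?case
  proof (cases "a \<le> b")
    case True
    have "jobs_disjoint (concat (map f [a..<b]))"
      by (rule Suc.IH) (use Suc.prems in auto)
    moreover have "jobs_disjoint (f b)" using Suc.prems(1)[of b] True by simp
    moreover have "jobs_range (f i) \<inter> jobs_range (f b) = {}" if "i \<in> {a..<b}" for i
      using Suc.prems(2)[of i b] that by simp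
    ultimately have "jobs_disjoint (concat (map f [a..<b]) @ f b)"
      unfolding jobs_disjoint_append by fastforce
    then show ?thesis using True by simp
  qed simp
qed simp

lemma jobs_disjoint_nth:
  assumes "jobs_disjoint js" "i < length js" "j < length js" "i \<noteq> j"
  shows "job_range (js ! i) \<inter> job_range (js ! j) = {}"
proof (cases "i < j")
  case True then show ?thesis
    using assms sorted_wrt_nth_less[of _ js i j] unfolding jobs_disjoint_def by blast
next
  case False then have "j < i" using assms(4) by simp
  then show ?thesis
    using assms sorted_wrt_nth_less[of _ js j i] unfolding jobs_disjoint_def by blast
qed

lemma jobs_done_concat:
  assumes "jobs_done m (concat (map f xs)) m'" "x \<in> set xs" "j \<in> set (f x)"
  shows "job_done m j m'"
  using assms unfolding jobs_done_def by auto

lemma add_div_block: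
  fixes s :: nat
  assumes "0 < B" "i \<le> B"
  shows "(s + i) div B = s div B \<or> (s + i) div B = Suc (s div B)"
proof -
  have "s mod B < B" using assms(1) by simp
  have e: "s + i = s div B * B + (s mod B + i)" by simp
  show ?thesis
  proof (cases "s mod B + i < B")
    case True
    then show ?thesis using div_mod_block(1)[OF True, of "s div B"] e by metis
  next
    case False
    then have e': "s + i = Suc (s div B) * B + (s mod B + i - B)"
      using e unfolding mult_Suc by linarith
    have "s mod B + i - B < B" using \<open>s mod B < B\<close> assms(2) by linarith
    from div_mod_block(1)[OF this, of "Suc (s div B)"] show ?thesis using e' by metis
  qed
qed

text \<open>Later batches start from a memory that earlier ones have changed. Since no job writes to
  a block that some job reads, each of them can still be described relative to the memory before the
  whole list.\<close>

lemma job_done_src: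
  assumes "job_done m1 j m'" "job_ok B W j" "0 < B"
    "\<And>a. a div B \<in> job_reads B j \<Longrightarrow> m1 a = m a"
  shows "job_done m j m'"
proof (cases j)
  case (Copy s n d)
  have "m1 (s + i) = m (s + i)" if "i < n" for i
    using assms(2,3) that Copy add_div_block[of B i s] by (intro assms(4)) auto
  then show ?thesis using assms(1) Copy by simp
qed (use assms in auto)

text \<open>A fork has at most \<open>B\<close> children, so a list of at most \<open>K * B\<close>
  jobs takes \<open>K\<close> forks; those past the end of the list have no children. The number
  \<open>K\<close> is static because the code is straight-line, whereas the list is computed from
  the local memory.\<close>

definition fan :: "nat \<Rightarrow> ('k word list \<Rightarrow> job list) \<Rightarrow> 'k code" where
  "fan K js = map (\<lambda>k rest. AFork (map (\<lambda>j. 1 # 0 # arg rest 0 # job_args j)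
      (take (arg rest 0) (drop (k * arg rest 0) (js rest))))) [0..<K]"

definition read_blocks :: "nat \<Rightarrow> ('k word list \<Rightarrow> nat) \<Rightarrow> 'k code" where
  "read_blocks n base = map (\<lambda>i rest. ARead (base rest + i)) [0..<n]"

context fork_join begin

text \<open>The invariant before fork \<open>k\<close> is that the first \<open>k * B\<close> jobs
  are done relative to the original memory \<open>m\<close>. A job costs 4 units of work and a fork
  at most 4 of span.\<close>

lemma thr_fan:
  assumes r: "rest_ok rest" "t < 4" "mem_ok W m" "arg rest 0 = B" "js rest = js0"
    and len: "length js0 \<le> K * B" and BW: "2 * B < W"
    and ok: "\<And>j. j \<in> set js0 \<Longrightarrow> job_ok B W j" and dj: "jobs_disjoint js0"
    and rw: "(\<lambda>a. a div B) ` jobs_range js0 \<inter> jobs_reads B js0 = {}"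
    and sub: "jobs_reads B js0 \<subseteq> R" "jobs_range js0 \<subseteq> Wr"
    and cont: "\<And>m'. mem_ok W m' \<Longrightarrow> jobs_done m js0 m' \<Longrightarrow> thr t is rest m' R Wr wk sp Q"
  shows "thr t (fan K js @ is) rest m R Wr (4 * length js0 + wk) (4 * K + sp) Q"
proof -
  define f where "f = (\<lambda>k rest. AFork (map (\<lambda>j. 1 # 0 # arg rest 0 # job_args j)
      (take (arg rest 0) (drop (k * arg rest 0) (js rest)))) :: 'k act)"
  have "thr t (map f [k..<K] @ is) rest m1 R Wr (4 * (length js0 - k * B) + wk) (4 * (K - k) + sp) Q"
    if "k \<le> K" "mem_ok W m1" "jobs_done m (take (k * B) js0) m1" for k m1
    using that
  proof (induction k arbitrary: m1 rule: inc_induct)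
    case base
    then show ?case using cont len by simp
  next
    case (step k)
    define c where "c = take B (drop (k * B) js0)"
    have cl: "length c \<le> B" "length c + (length js0 - Suc k * B) = length js0 - k * B"
      unfolding c_def by auto
    have cn: "c ! i = js0 ! (k * B + i)" "k * B + i < length js0" if "i < length c" for i
      using that unfolding c_def by auto
    have cs: "j \<in> set js0" if "j \<in> set c" for j
      using that unfolding c_def by (meson in_set_dropD in_set_takeD)
    have tk: "take (Suc k * B) js0 = take (k * B) js0 @ c"
      unfolding c_def mult_Suc by (metis add.commute take_add)
    have dis: "job_range (c ! i) \<inter> job_range (c ! j) = {}" if "i < length c" "j < length c" "i \<noteq> j" for i j
      using jobs_disjoint_nth[OF dj, of "k * B + i" "k * B + j"] cn that by simp
    have dis2: "jobs_range (take (k * B) js0) \<inter> jobs_range c = {}"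
    proof -
      have "js0 = (take (k * B) js0 @ c) @ drop (Suc k * B) js0" using tk by (metis append_take_drop_id)
      then show ?thesis using dj jobs_disjoint_append by metis
    qed
    have rsub: "job_range j \<subseteq> jobs_range js0" "job_reads B j \<subseteq> jobs_reads B js0" if "j \<in> set js0" for j
      using that unfolding jobs_range_def jobs_reads_def by auto
    have tsub: "jobs_range (take (k * B) js0) \<subseteq> jobs_range js0"
      unfolding jobs_range_def using set_take_subset by fast
    have "[k..<K] = k # [Suc k..<K]" using step.hyps by (simp add: upt_conv_Cons)
    then have "thr t (map f [k..<K] @ is) rest m1 R Wr (4 * (length js0 - k * B) + wk) (4 * (K - k) + sp) Q
      \<longleftrightarrow> thr t (f k # map f [Suc k..<K] @ is) rest m1 R Wr (4 * (length js0 - k * B) + wk) (4 * (K - k) + sp) Q"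
      by simp
    also have \<dots>
    proof (rule thr_fork[where ls = "map (\<lambda>j. 1 # 0 # B # job_args j) c" and Rs = "\<lambda>i. job_reads B (c ! i)"
          and Ws = "\<lambda>i. job_range (c ! i)" and wks = "\<lambda>_. 4" and ?sp1.0 = 4 and Qs = "\<lambda>i. job_done m1 (c ! i)"
          and wk = "4 * (length js0 - Suc k * B) + wk" and sp = "4 * (K - Suc k) + sp"])
      show "f k rest = AFork (map (\<lambda>j. 1 # 0 # B # job_args j) c)"
        unfolding f_def c_def using r by simp
      show "runs M (interp cd) (map Num (map (\<lambda>j. 1 # 0 # B # job_args j) c ! i)) m1 (job_reads B (c ! i))
          (job_range (c ! i)) 4 4 (\<lambda>_. job_done m1 (c ! i))" if "i < length (map (\<lambda>j. 1 # 0 # B # job_args j) c)" for i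
        using job_runs[OF ok[OF cs] step.prems(1) BW, of "c ! i"] that by simp
      show "length as \<le> 64" if "as \<in> set (map (\<lambda>j. 1 # 0 # B # job_args j) c)" for as
      proof -
        have "length (job_args j) = 6" for j by (cases j) auto
        then show ?thesis using that by auto
      qed
      show "(\<lambda>a. a div B) ` job_range (c ! i) \<inter> job_reads B (c ! j) = {}"
        if "i < length (map (\<lambda>j. 1 # 0 # B # job_args j) c)" "j < length (map (\<lambda>j. 1 # 0 # B # job_args j) c)" for i j
        using rw rsub[OF cs[OF nth_mem]] that by (fastforce simp: disjoint_iff)
      fix m' assume m': "mem_ok W m'"
        "\<And>i. i < length (map (\<lambda>j. 1 # 0 # B # job_args j) c) \<Longrightarrow>
            \<exists>mi. job_done m1 (c ! i) mi \<and> (\<forall>a. (\<forall>j<length (map (\<lambda>j. 1 # 0 # B # job_args j) c). j \<noteq> i \<longrightarrow> a \<notin> job_range (c ! j)) \<longrightarrow> m' a = mi a)"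
        "\<And>a. \<forall>j<length (map (\<lambda>j. 1 # 0 # B # job_args j) c). a \<notin> job_range (c ! j) \<Longrightarrow> m' a = m1 a"
      have d1: "job_done m1 (c ! i) m'" if i: "i < length c" for i
      proof -
        obtain mi where mi: "job_done m1 (c ! i) mi" "\<And>a. (\<forall>j<length c. j \<noteq> i \<longrightarrow> a \<notin> job_range (c ! j)) \<Longrightarrow> m' a = mi a"
          using m'(2)[of i] i by auto
        have "m' a = mi a" if "a \<in> job_range (c ! i)" for a
          using mi(2) dis[of _ i] that i by blast
        then show ?thesis using mi(1) by (cases "c ! i") auto
      qed
      have "job_done m j m'" if j: "j \<in> set (take (Suc k * B) js0)" for j
      proof (cases "j \<in> set c")
        case True
        then obtain i where i: "i < length c" "c ! i = j" by (meson in_set_conv_nth)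
        show ?thesis
        proof (rule job_done_src[where ?m1.0 = m1])
          show "job_done m1 j m'" using d1 i by blast
          show "job_ok B W j" using ok cs True by blast
          show "m1 a = m a" if "a div B \<in> job_reads B j" for a
            using step.prems(2) that rw tsub rsub(2)[OF cs[OF True]] unfolding jobs_done_def by fast
        qed simp
      next
        case False
        then have jt: "j \<in> set (take (k * B) js0)" using j tk by auto
        then have "job_done m j m1" using step.prems(2) unfolding jobs_done_def by blast
        moreover have "m' a = m1 a" if "a \<in> job_range j" for a
        proof (rule m'(3), intro allI impI)
          fix i assume "i < length (map (\<lambda>j. 1 # 0 # B # job_args j) c)"
          then have "c ! i \<in> set c" by simp
          then show "a \<notin> job_range (c ! i)"
            using dis2 jt that unfolding jobs_range_def by blast
        qed
        ultimately show ?thesis by (cases j) auto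
      qed
      moreover have "m' a = m a" if "a \<notin> jobs_range (take (Suc k * B) js0)" for a
      proof -
        have "a \<notin> job_range (c ! i)" if "i < length c" for i
          using \<open>a \<notin> jobs_range (take (Suc k * B) js0)\<close> that nth_mem[OF that] unfolding tk jobs_range_def by auto
        then have "m' a = m1 a" using m'(3) by simp
        also have "m1 a = m a" using step.prems(2) that unfolding tk jobs_done_def by simp
        finally show ?thesis .
      qed
      ultimately have "jobs_done m (take (Suc k * B) js0) m'" unfolding jobs_done_def by blast
      then show "thr t (map f [Suc k..<K] @ is) rest m' R Wr (4 * (length js0 - Suc k * B) + wk) (4 * (K - Suc k) + sp) Q"
        using step.IH m'(1) by blast
    qed (use r cl step subset_trans[OF rsub(2)[OF cs[OF nth_mem]] sub(1)] subset_trans[OF rsub(1)[OF cs[OF nth_mem]] sub(2)] dis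
         in \<open>auto simp del: mult_Suc\<close>)
    finally show ?case .
  qed
  from this[of 0 m] show ?thesis
    using r unfolding fan_def f_def jobs_done_def by simp
qed

text \<open>\<open>base\<close> is evaluated anew for every read, hence it has to be stable when
  blocks are appended to the local memory.\<close>

lemma thr_read_blocks:
  assumes r: "rest_ok rest" "t < 4" "mem_ok W m" "length rest + n * B \<le> 62 * B"
    "\<And>ys. base (rest @ ys) = j" "{j..<j + n} \<subseteq> R"
    and cont: "rest_ok (rest @ map m [j * B..<(j + n) * B]) \<Longrightarrow>
      thr t is (rest @ map m [j * B..<(j + n) * B]) m R Wr wk sp Q"
  shows "thr t (read_blocks n base @ is) rest m R Wr (n + wk) (n + sp) Q"
proof -
  let ?f = "\<lambda>i rest. ARead (base rest + i)"
  have "thr t (map ?f [k..<n] @ is) (rest @ map m [j * B..<(j + k) * B]) m R Wr (n - k + wk) (n - k + sp) Q"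
    if "k \<le> n" "rest_ok (rest @ map m [j * B..<(j + k) * B])" for k
    using that
  proof (induction k rule: inc_induct)
    case base
    then show ?case using cont by simp
  next
    case (step k)
    let ?r = "rest @ map m [j * B..<(j + k) * B]"
    have e: "?r @ block B m (j + k) = rest @ map m [j * B..<(j + Suc k) * B]"
    proof -
      have "[j * B..<(j + Suc k) * B] = [j * B..<(j + k) * B] @ [(j + k) * B..<(j + k + 1) * B]"
        using upt_add_eq_append[of "j * B" "(j + k) * B" B] by (simp add: algebra_simps)
      then show ?thesis unfolding block_def by simp
    qed
    have l: "length ?r = length rest + k * B" by (simp add: algebra_simps)
    have "Suc k * B \<le> n * B" using step.hyps by (intro mult_right_mono) auto
    then have l2: "length ?r + B \<le> 62 * B" using l r(4) unfolding mult_Suc by linarith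
    have "thr t (?f k # map ?f [Suc k..<n] @ is) ?r m R Wr (Suc (n - Suc k + wk)) (Suc (n - Suc k + sp)) Q"
    proof (rule thr_read[where j = "j + k"])
      show "rest_ok (?r @ block B m (j + k)) \<Longrightarrow>
        thr t (map ?f [Suc k..<n] @ is) (?r @ block B m (j + k)) m R Wr (n - Suc k + wk) (n - Suc k + sp) Q"
        unfolding e by (rule step.IH)
    qed (use step r l2 in auto)
    moreover have "[k..<n] = k # [Suc k..<n]" using step.hyps by (simp add: upt_conv_Cons)
    ultimately show ?case using step.hyps by (simp add: Suc_diff_Suc)
  qed
  from this[of 0] show ?thesis using r(1) unfolding read_blocks_def by simp
qed

end

section \<open>Search trees in memory\<close>

text \<open>The inorder traversal of a node, alternating subtree traversals and keys. On lists of
  equal length it ends with a key, so that sequences can be split behind a separator by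
  \<open>weave_append\<close>.\<close>

fun weave :: "'k list list \<Rightarrow> 'k list \<Rightarrow> 'k list" where
  "weave [] ks = []"
| "weave (x # xs) [] = x"
| "weave (x # xs) (k # ks) = x @ k # weave xs ks"

lemma weave_append:
  "length xs = length ks \<Longrightarrow> weave (xs @ ys) (ks @ ls) = weave xs ks @ weave ys ls"
  by (induction xs ks rule: weave.induct) auto

lemma weave_append_Cons:
  "length xs = Suc (length ks) \<Longrightarrow> weave (xs @ ys) (ks @ l # ls) = weave xs ks @ l # weave ys ls"
  by (induction xs ks rule: weave.induct) auto

lemma set_weave:
  "length xs = Suc (length ks) \<Longrightarrow> set (weave xs ks) = (\<Union>x\<in>set xs. set x) \<union> set ks"
proof (induction xs ks rule: weave.induct)
  case (3 x xs k ks)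
  then show ?case by auto
qed auto

text \<open>Comparing each separator with its two neighbouring pieces suffices: the next separator
  lies below everything behind its left piece, so the bound by \<open>k\<close> is carried through
  it by transitivity.\<close>

lemma sorted_weave:
  fixes ks :: "'k::linorder list"
  assumes "length xs = Suc (length ks)"
  shows "sorted_wrt (<) (weave xs ks) \<longleftrightarrow> (\<forall>x\<in>set xs. sorted_wrt (<) x) \<and> sorted_wrt (<) ks \<and>
    (\<forall>i<length ks. (\<forall>x\<in>set (xs ! i). x < ks ! i) \<and> (\<forall>y\<in>set (xs ! Suc i). ks ! i < y))"
  using assms
proof (induction xs ks rule: weave.induct)
  case (3 x xs k ks)
  then obtain y ys where xs: "xs = y # ys" by (cases xs) auto
  have IH: "sorted_wrt (<) (weave xs ks) \<longleftrightarrow> (\<forall>x\<in>set xs. sorted_wrt (<) x) \<and> sorted_wrt (<) ks \<and>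
    (\<forall>i<length ks. (\<forall>x\<in>set (xs ! i). x < ks ! i) \<and> (\<forall>y\<in>set (xs ! Suc i). ks ! i < y))"
    using 3 by simp
  have all: "(\<forall>b\<in>set (weave xs ks). k < b) \<longleftrightarrow> (\<forall>b\<in>set y. k < b) \<and> (\<forall>b\<in>set ks. k < b)"
    if s: "sorted_wrt (<) (weave xs ks)"
  proof (cases ks)
    case Nil then show ?thesis using 3 xs by auto
  next
    case (Cons k2 ks2)
    have "k2 < b" if "b \<in> set (weave ys ks2)" for b
      using s that xs Cons by (auto simp: sorted_wrt_append)
    moreover have "set ks2 \<subseteq> set (weave ys ks2)" using 3 xs Cons set_weave[of ys ks2] by auto
    ultimately show ?thesis using xs Cons by auto (use order.strict_trans in blast)+
  qed
  have split: "(\<forall>i<length (k # ks). (\<forall>a\<in>set ((x # xs) ! i). a < (k # ks) ! i) \<and> (\<forall>b\<in>set ((x # xs) ! Suc i). (k # ks) ! i < b))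
     \<longleftrightarrow> (\<forall>a\<in>set x. a < k) \<and> (\<forall>b\<in>set y. k < b) \<and>
       (\<forall>i<length ks. (\<forall>x\<in>set (xs ! i). x < ks ! i) \<and> (\<forall>y\<in>set (xs ! Suc i). ks ! i < y))"
    unfolding xs by (auto simp: nth_Cons' less_Suc_eq_0_disj)
  have "sorted_wrt (<) (weave (x # xs) (k # ks)) \<longleftrightarrow> sorted_wrt (<) x \<and> (\<forall>a\<in>set x. a < k) \<and>
      (\<forall>b\<in>set (weave xs ks). k < b) \<and> sorted_wrt (<) (weave xs ks)"
    by (auto simp: sorted_wrt_append) (use order.strict_trans in blast)+
  then show ?case
    unfolding split using IH all by auto
qed auto

section \<open>Trees in memory, without the order of the keys\<close>

definition node_at :: "nat \<Rightarrow> 'k mem \<Rightarrow> nat \<Rightarrow> nat \<Rightarrow> 'k list \<Rightarrow> nat list \<Rightarrow> bool" where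
  "node_at B m p h ks ps \<longleftrightarrow> stored m (4 * p * B) [Num h, Num (length ks)] \<and>
     stored m ((4 * p + 1) * B) (map Key ks) \<and> stored m ((4 * p + 2) * B) (map Num ps)"

text \<open>The pointer \<open>p\<close> represents a tree of height \<open>h\<close> with inorder traversal \<open>xs\<close> whose root has at
  least \<open>lo\<close> keys and whose nodes lie in \<open>D\<close>. The order of the keys is ignored: it is the
  sortedness of \<open>xs\<close>, which regrouping leaves alone.\<close>

primrec tree_at :: "nat \<Rightarrow> 'k mem \<Rightarrow> nat set \<Rightarrow> nat \<Rightarrow> nat \<Rightarrow> nat \<Rightarrow> 'k list \<Rightarrow> bool" where
  "tree_at B m D 0 lo p xs \<longleftrightarrow> p = 0 \<and> xs = []"
| "tree_at B m D (Suc h) lo p xs \<longleftrightarrow> p \<noteq> 0 \<and> p \<in> D \<and>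
    (\<exists>ks ps xss. lo \<le> length ks \<and> length ks \<le> B \<and> length ps = Suc (length ks) \<and> length xss = length ps \<and>
      node_at B m p (Suc h) ks ps \<and> xs = weave xss ks \<and>
      (\<forall>i<length ps. tree_at B m D h (B div 2) (ps ! i) (xss ! i)))"

lemma tree_at_mono_lo:
  assumes "tree_at B m D h lo p xs" "lo' \<le> lo"
  shows "tree_at B m D h lo' p xs"
proof (cases h)
  case (Suc h')
  obtain ks ps xss where "p \<noteq> 0" "p \<in> D" "lo \<le> length ks" "length ks \<le> B" "length ps = Suc (length ks)"
     "length xss = length ps" "node_at B m p (Suc h') ks ps" "xs = weave xss ks"
      "\<forall>i<length ps. tree_at B m D h' (B div 2) (ps ! i) (xss ! i)"
    using assms(1) unfolding Suc tree_at.simps by blast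
  then show ?thesis unfolding Suc tree_at.simps using assms(2)
    by (intro conjI exI[of _ ks] exI[of _ ps] exI[of _ xss]) auto
qed (use assms in simp)

lemma page_div:
  fixes p :: nat
  assumes "x < 4 * B"
  shows "(4 * p * B + x) div (4 * B) = p"
proof -
  have "4 * p * B + x = p * (4 * B) + x" by simp
  then show ?thesis using div_mod_block(1)[OF assms, of p] by metis
qed

lemma page_of_block: "a div B div 4 = a div (4 * B)" for a :: nat
  by (simp add: div_mult2_eq[symmetric] mult.commute)

lemma stored_cong:
  assumes "stored m a ws" "\<And>i. i < length ws \<Longrightarrow> m' (a + i) = m (a + i)"
  shows "stored m' a ws"
  using assms unfolding stored_def by simp

lemma node_at_cong:
  assumes "node_at B m p h ks ps" "\<And>a. a div (4 * B) = p \<Longrightarrow> m' a = m a"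
    "length ks \<le> B" "length ps \<le> Suc B" "2 \<le> B"
  shows "node_at B m' p h ks ps"
proof -
  have "stored m' (4 * p * B) [Num h, Num (length ks)]"
    using assms unfolding node_at_def
    by (elim conjE stored_cong) (auto intro!: assms(2) page_div)
  moreover have "stored m' ((4 * p + 1) * B) (map Key ks)"
    using assms unfolding node_at_def
  proof (elim conjE stored_cong)
    fix i assume "i < length (map Key ks)"
    then have "(4 * p * B + (B + i)) div (4 * B) = p" using assms by (intro page_div) auto
    then show "m' ((4 * p + 1) * B + i) = m ((4 * p + 1) * B + i)"
      by (intro assms(2)) (simp add: algebra_simps)
  qed
  moreover have "stored m' ((4 * p + 2) * B) (map Num ps)"
    using assms unfolding node_at_def
  proof (elim conjE stored_cong)
    fix i assume "i < length (map Num ps)"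
    then have "(4 * p * B + (2 * B + i)) div (4 * B) = p" using assms by (intro page_div) auto
    then show "m' ((4 * p + 2) * B + i) = m ((4 * p + 2) * B + i)"
      by (intro assms(2)) (simp add: algebra_simps)
  qed
  ultimately show ?thesis unfolding node_at_def by blast
qed

lemma tree_at_cong:
  assumes "tree_at B m D h lo p xs" "\<And>a. a div (4 * B) \<in> D \<Longrightarrow> m' a = m a" "D \<subseteq> D'" "2 \<le> B"
  shows "tree_at B m' D' h lo p xs"
  using assms(1)
proof (induction h arbitrary: lo p xs)
  case (Suc h)
  then obtain ks ps xss where *: "p \<noteq> 0" "p \<in> D" "lo \<le> length ks" "length ks \<le> B" "length ps = Suc (length ks)"
     "length xss = length ps" "node_at B m p (Suc h) ks ps" "xs = weave xss ks"
      "\<And>i. i<length ps \<Longrightarrow> tree_at B m D h (B div 2) (ps ! i) (xss ! i)" by auto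
  have "node_at B m' p (Suc h) ks ps"
    by (rule node_at_cong[OF *(7)]) (use * assms in auto)
  moreover have "tree_at B m' D' h (B div 2) (ps ! i) (xss ! i)" if "i < length ps" for i
    using Suc.IH *(9) that by blast
  ultimately show ?case unfolding tree_at.simps using * assms(3)
    by (intro conjI exI[of _ ks] exI[of _ ps] exI[of _ xss]) auto
qed auto

lemma tree_at_header: "tree_at B m D (Suc h) lo p xs \<Longrightarrow> m (4 * p * B) = Num (Suc h)"
  by (auto simp: node_at_def stored_def)

text \<open>On a descending path every height from \<open>h\<close> down to 1 is stored in the
  header of some page of \<open>D\<close>, and different headers force different pages. This bounds
  the height, and later the depth of the recursion, without a growth argument and also if subtrees
  share pages.\<close>

lemma tree_at_height_le:
  assumes "tree_at B m D h lo p xs" "finite D"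
  shows "h \<le> card D"
proof -
  have "\<exists>q\<in>D. m (4 * q * B) = Num k" if "tree_at B m D h lo p xs" "1 \<le> k" "k \<le> h" for k
    using that
  proof (induction h arbitrary: lo p xs)
    case (Suc h)
    show ?case
    proof (cases "k = Suc h")
      case True
      then show ?thesis using tree_at_header[OF Suc.prems(1)] Suc.prems(1) by auto
    next
      case False
      from Suc.prems(1) obtain p' xs' where "tree_at B m D h (B div 2) p' xs'" by fastforce
      with Suc.IH[OF this] Suc.prems False show ?thesis by auto
    qed
  qed auto
  then obtain g where g: "\<And>k. 1 \<le> k \<Longrightarrow> k \<le> h \<Longrightarrow> g k \<in> D \<and> m (4 * g k * B) = Num k"
    using assms(1) by metis
  have "inj_on g {1..h}"
    by (rule inj_onI) (metis atLeastAtMost_iff g word.inject(2))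
  moreover have "g ` {1..h} \<subseteq> D" using g by auto
  ultimately have "card {1..h} \<le> card D" using assms(2) by (metis card_inj_on_le)
  then show ?thesis by simp
qed

text \<open>The induction also yields that the height is the only external depth. This makes the
  heights of all children of a node equal, as \<open>tree_at\<close> demands by recursing on the
  height.\<close>

lemma btree_at_tree_at:
  fixes t :: "'k::linorder btree"
  assumes "node_bounds B lo t" "\<forall>d\<in>external_depths t. \<forall>e\<in>external_depths t. d = e" "btree_at B m f p t"
  shows "external_depths t = {height t} \<and> (\<exists>xs. tree_at B m {p. 4 * p + 4 \<le> f} (height t) lo p xs \<and>
     set xs = tree_keys t \<and> sorted_wrt (<) xs)"
  using assms
proof (induction arbitrary: p rule: node_bounds.induct)
  case (1 lo)
  then show ?case by (auto elim: btree_at.cases)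
next
  case (2 lo ks ts)
  let ?D = "{p. 4 * p + 4 \<le> f}"
  from 2(7) obtain ps where ps: "p \<noteq> 0" "4 * p + 4 \<le> f"
    "stored m (4 * p * B) [Num (height (Node ks ts)), Num (length ks)]"
    "stored m ((4 * p + 1) * B) (map Key ks)" "stored m ((4 * p + 2) * B) (map Num ps)"
    "length ps = length ts" "\<And>i. i<length ts \<Longrightarrow> btree_at B m f (ps ! i) (ts ! i)"
    by (auto elim: btree_at.cases)
  have uni: "\<forall>d\<in>external_depths t. \<forall>e\<in>external_depths t'. d = e" if "t \<in> set ts" "t' \<in> set ts" for t t'
    using 2(6) that by auto
  have ch: "external_depths (ts ! i) = {height (ts ! i)} \<and> (\<exists>xs. tree_at B m ?D (height (ts ! i)) (B div 2) (ps ! i) xs \<and>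
     set xs = tree_keys (ts ! i) \<and> sorted_wrt (<) xs)" if "i < length ts" for i
    using 2(5) nth_mem[OF that] uni[OF nth_mem[OF that] nth_mem[OF that]] ps(7)[OF that] by blast
  obtain h where h: "h = height (ts ! 0)" by simp
  have ts0: "ts ! 0 \<in> set ts" "0 < length ts" using 2(3) by auto
  have hh: "height t = h" if t: "t \<in> set ts" for t
  proof -
    obtain i where i: "i < length ts" "ts ! i = t" using t by (auto simp: in_set_conv_nth)
    have "height t \<in> external_depths t" "h \<in> external_depths (ts ! 0)"
      using ch[OF i(1)] ch[OF ts0(2)] h i(2) by simp_all
    then show ?thesis using uni[OF t ts0(1)] by blast
  qed
  have "height ` set ts \<subseteq> {h}" using hh by auto
  moreover have "h \<in> height ` set ts" using h ts0(1) by blast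
  ultimately have "height ` set ts = {h}" by blast
  then have ht: "height (Node ks ts) = Suc h" by simp
  have "(\<Union>t\<in>set ts. external_depths t) = {h}"
  proof -
    have "external_depths t = {h}" if t: "t \<in> set ts" for t
    proof -
      obtain i where "i < length ts" "ts ! i = t" using t by (auto simp: in_set_conv_nth)
      then show ?thesis using ch[of i] hh[OF t] by simp
    qed
    then show ?thesis using ts0 by auto
  qed
  then have ed: "external_depths (Node ks ts) = {height (Node ks ts)}" using ht by simp
  obtain xf where xf: "\<And>i. i < length ts \<Longrightarrow> tree_at B m ?D (height (ts ! i)) (B div 2) (ps ! i) (xf i) \<and>
     set (xf i) = tree_keys (ts ! i) \<and> sorted_wrt (<) (xf i)" using ch by metis
  define xss where "xss = map xf [0..<length ts]"
  have xss: "length xss = Suc (length ks)" "\<And>i. i < length ts \<Longrightarrow> xss ! i = xf i"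
    unfolding xss_def using 2(3) by (simp_all del: upt_Suc)
  have set_xss: "set xss = xf ` {..<length ts}" unfolding xss_def by auto
  have "tree_at B m ?D (Suc h) lo p (weave xss ks)"
    using 2(1-3) ps xf hh[OF nth_mem] ht xss by (auto simp: node_at_def intro!: exI[of _ ks] exI[of _ ps] exI[of _ xss])
  moreover have "set (weave xss ks) = tree_keys (Node ks ts)"
  proof -
    have "(\<Union>x\<in>set xss. set x) = (\<Union>i<length ts. tree_keys (ts ! i))" using xf set_xss by auto
    also have "\<dots> = (\<Union>t\<in>set ts. tree_keys t)" by (auto simp: set_conv_nth)
    finally show ?thesis using set_weave[OF xss(1)] by auto
  qed
  moreover have "sorted_wrt (<) (weave xss ks)"
    unfolding sorted_weave[OF xss(1)] using 2(4) xf xss set_xss 2(3) unfolding separated_def by auto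
  ultimately show ?case using ed ht by metis
qed

text \<open>The order that \<open>tree_at\<close> ignores is recovered from sortedness of the single
  list \<open>xs\<close>, which \<open>sorted_weave\<close> distributes to the pieces and the
  separators of every node.\<close>

lemma tree_at_btree_at:
  fixes xs :: "'k::linorder list"
  assumes "tree_at B m D h lo p xs" "sorted_wrt (<) xs" "D \<subseteq> {p. 4 * p + 4 \<le> f}"
  shows "\<exists>t. btree_at B m f p t \<and> node_bounds B lo t \<and> external_depths t = {h} \<and> height t = h \<and> tree_keys t = set xs"
  using assms(1,2)
proof (induction h arbitrary: lo p xs)
  case 0
  then show ?case
    by (intro exI[of _ External]) (auto intro: btree_at.intros node_bounds.intros)
next
  case (Suc h)
  then obtain ks ps xss where *: "p \<noteq> 0" "p \<in> D" "lo \<le> length ks" "length ks \<le> B" "length ps = Suc (length ks)"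
     "length xss = length ps" "node_at B m p (Suc h) ks ps" "xs = weave xss ks"
      "\<And>i. i<length ps \<Longrightarrow> tree_at B m D h (B div 2) (ps ! i) (xss ! i)" by auto
  have xl: "length xss = Suc (length ks)" using * by simp
  have sw: "(\<forall>x\<in>set xss. sorted_wrt (<) x)" "sorted_wrt (<) ks"
    "\<And>i. i < length ks \<Longrightarrow> (\<forall>x\<in>set (xss ! i). x < ks ! i) \<and> (\<forall>y\<in>set (xss ! Suc i). ks ! i < y)"
    using Suc.prems(2) unfolding *(8) sorted_weave[OF xl] by auto
  have "\<forall>i. \<exists>t. i < length ps \<longrightarrow> btree_at B m f (ps ! i) t \<and> node_bounds B (B div 2) t \<and> external_depths t = {h} \<and> height t = h \<and> tree_keys t = set (xss ! i)"
    using Suc.IH *(9) sw(1) *(6) by (metis nth_mem)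
  then obtain tf where tf: "\<And>i. i < length ps \<Longrightarrow> btree_at B m f (ps ! i) (tf i) \<and> node_bounds B (B div 2) (tf i)
      \<and> external_depths (tf i) = {h} \<and> height (tf i) = h \<and> tree_keys (tf i) = set (xss ! i)" by metis
  define ts where "ts = map tf [0..<length ps]"
  have ts: "length ts = length ps" "\<And>i. i < length ps \<Longrightarrow> ts ! i = tf i" "set ts = tf ` {..<length ps}"
    unfolding ts_def by auto
  have "height ` set ts = {h}" using tf ts(3) *(5) by auto
  then have ht: "height (Node ks ts) = Suc h" by simp
  have "(\<Union>t\<in>set ts. external_depths t) = {h}" using tf ts(3) *(5) by auto
  then have ed: "external_depths (Node ks ts) = {Suc h}" by simp
  have "(\<Union>t\<in>set ts. tree_keys t) = (\<Union>x\<in>set xss. set x)"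
    using tf ts(3) *(6) by (auto simp: set_conv_nth)
  then have tk: "tree_keys (Node ks ts) = set xs" using set_weave[OF xl] *(8) by auto
  have "separated ks ts" unfolding separated_def using sw tf ts *(5) by auto
  then have "node_bounds B lo (Node ks ts)"
    using * ts tf by (intro node_bounds.intros) auto
  moreover have "btree_at B m f p (Node ks ts)"
    using * ts tf assms(3) ht unfolding node_at_def by (intro btree_at.intros) auto
  ultimately show ?case using ht ed tk by blast
qed

section \<open>Regrouping a sequence of trees\<close>

definition next_tall :: "(nat \<Rightarrow> bool) \<Rightarrow> nat \<Rightarrow> nat \<Rightarrow> nat" where
  "next_tall T hi j = (LEAST e. j \<le> e \<and> (T e \<or> e = hi))"

text \<open>Index \<open>s\<close> denotes the separator between the trees \<open>s\<close> and
  \<open>Suc s\<close>. The second alternative is the only one in which a group has no tall tree on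
  its left. The separators that belong to no group are those between two tall trees
  (\<open>adjacent\<close>).\<close>

definition group_start :: "(nat \<Rightarrow> bool) \<Rightarrow> nat \<Rightarrow> nat \<Rightarrow> nat \<Rightarrow> bool" where
  "group_start T lo hi s \<longleftrightarrow> lo \<le> s \<and> s < hi \<and> (T s \<and> \<not> T (Suc s) \<or> s = lo \<and> \<not> T s)"

definition adjacent :: "(nat \<Rightarrow> bool) \<Rightarrow> nat \<Rightarrow> nat \<Rightarrow> nat \<Rightarrow> bool" where
  "adjacent T lo hi s \<longleftrightarrow> lo \<le> s \<and> s < hi \<and> T s \<and> T (Suc s)"

text \<open>The number of leading children of the tall root \<open>j\<close> that were handed to the
  group on its left; a lower left neighbour means that such a group exists.
  \<open>drop_right\<close> is the mirror image.\<close>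

definition drop_left :: "(nat \<Rightarrow> bool) \<Rightarrow> nat \<Rightarrow> nat \<Rightarrow> nat" where
  "drop_left T lo j = (if lo < j \<and> \<not> T (j - 1) then 1 else 0)"

definition drop_right :: "(nat \<Rightarrow> bool) \<Rightarrow> nat \<Rightarrow> nat \<Rightarrow> nat" where
  "drop_right T hi j = (if j < hi \<and> \<not> T (Suc j) then 1 else 0)"

lemma next_tall_props:
  assumes "j \<le> hi"
  shows "j \<le> next_tall T hi j" "next_tall T hi j \<le> hi" "T (next_tall T hi j) \<or> next_tall T hi j = hi"
    "\<And>i. j \<le> i \<Longrightarrow> i < next_tall T hi j \<Longrightarrow> \<not> T i"
proof -
  have ex: "j \<le> hi \<and> (T hi \<or> hi = hi)" using assms by simp
  show "j \<le> next_tall T hi j" "T (next_tall T hi j) \<or> next_tall T hi j = hi"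
    using LeastI[of "\<lambda>e. j \<le> e \<and> (T e \<or> e = hi)", OF ex] unfolding next_tall_def by auto
  show "next_tall T hi j \<le> hi"
    unfolding next_tall_def by (rule Least_le[of "\<lambda>e. j \<le> e \<and> (T e \<or> e = hi)", OF ex])
  show "\<not> T i" if "j \<le> i" "i < next_tall T hi j" for i
    using not_less_Least[of i "\<lambda>e. j \<le> e \<and> (T e \<or> e = hi)"] that unfolding next_tall_def by auto
qed

lemma next_tall_here: "T j \<or> j = hi \<Longrightarrow> next_tall T hi j = j"
  unfolding next_tall_def by (rule Least_equality) auto

lemma next_tall_Suc: "\<not> T j \<Longrightarrow> j < hi \<Longrightarrow> next_tall T hi j = next_tall T hi (Suc j)"
  unfolding next_tall_def by (rule arg_cong[where f = Least]) (auto simp: le_less Suc_le_eq)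

text \<open>The trees \<open>lo, \<dots>, hi\<close> with inorder traversals \<open>X\<close> and separators \<open>k\<close>. A tree is tall if \<open>T\<close>
  holds; \<open>cxs j\<close> and \<open>cks j\<close> are the traversals of the children and the keys of its root. A maximal
  run of trees that are not tall, extended by the adjacent children of its tall neighbours, is a
  group; \<open>gxs s\<close> and \<open>gks s\<close> are the trees and separators that result from joining the group whose
  first separator is \<open>s\<close>.\<close>

locale join_sequence =
  fixes B lo hi :: nat and T :: "nat \<Rightarrow> bool" and X :: "nat \<Rightarrow> 'k list" and k :: "nat \<Rightarrow> 'k"
    and cps :: "nat \<Rightarrow> nat list" and cxs :: "nat \<Rightarrow> 'k list list" and cks :: "nat \<Rightarrow> 'k list"
    and gps :: "nat \<Rightarrow> nat list" and gxs :: "nat \<Rightarrow> 'k list list" and gks :: "nat \<Rightarrow> 'k list"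
    and P :: "nat \<Rightarrow> 'k list \<Rightarrow> bool"
  assumes lohi: "lo < hi"
    and tall: "\<And>j. lo \<le> j \<Longrightarrow> j \<le> hi \<Longrightarrow> T j \<Longrightarrow> length (cps j) = Suc (length (cks j)) \<and> cks j \<noteq> [] \<and>
      length (cks j) \<le> B \<and> X j = weave (cxs j) (cks j) \<and> list_all2 P (cps j) (cxs j)"
    and group: "\<And>s. group_start T lo hi s \<Longrightarrow> length (gps s) = Suc (length (gks s)) \<and>
      length (gps s) \<le> Suc (next_tall T hi (Suc s) - s) \<and> list_all2 P (gps s) (gxs s) \<and>
      weave (gxs s) (gks s) = weave ((if T s then last (cxs s) else X s) # map X [Suc s..<next_tall T hi (Suc s)] @
         [if T (next_tall T hi (Suc s)) then hd (cxs (next_tall T hi (Suc s))) else X (next_tall T hi (Suc s))])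
        (map k [s..<next_tall T hi (Suc s)])"
begin

text \<open>The contribution of tree \<open>j\<close> and of the group starting at separator
  \<open>j\<close> to the long sequence; polymorphic, to serve for pointers and for traversals
  alike. A tall root has at least two children, so the two ends never claim the same child.\<close>

definition seg :: "(nat \<Rightarrow> 'b list) \<Rightarrow> (nat \<Rightarrow> 'b list) \<Rightarrow> nat \<Rightarrow> 'b list" where
  "seg c g j = (if T j then drop (drop_left T lo j) (take (length (c j) - drop_right T hi j) (c j)) else []) @
     (if group_start T lo hi j then g j else [])"

definition seg_keys :: "nat \<Rightarrow> 'k list" where
  "seg_keys j = (if T j then cks j else []) @
     (if group_start T lo hi j then gks j else if adjacent T lo hi j then [k j] else [])"

definition all_ptrs :: "nat \<Rightarrow> nat list" where
  "all_ptrs j = concat (map (seg cps gps) [lo..<j])"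

definition all_trees :: "nat \<Rightarrow> 'k list list" where
  "all_trees j = concat (map (seg cxs gxs) [lo..<j])"

definition all_keys :: "nat \<Rightarrow> 'k list" where
  "all_keys j = concat (map seg_keys [lo..<j])"

lemma cxs_length: "lo \<le> j \<Longrightarrow> j \<le> hi \<Longrightarrow> T j \<Longrightarrow> length (cxs j) = Suc (length (cks j))"
  using tall[of j] by (auto dest: list_all2_lengthD)

lemma gxs_length: "group_start T lo hi s \<Longrightarrow> length (gxs s) = Suc (length (gks s))"
  using group[of s] by (auto dest: list_all2_lengthD)

lemma seg_P:
  assumes "lo \<le> j" "j \<le> hi"
  shows "list_all2 P (seg cps gps j) (seg cxs gxs j)"
proof -
  have "list_all2 P (drop (drop_left T lo j) (take (length (cps j) - drop_right T hi j) (cps j)))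
     (drop (drop_left T lo j) (take (length (cxs j) - drop_right T hi j) (cxs j)))" if "T j"
    using tall[OF assms that] by (metis list_all2_dropI list_all2_takeI list_all2_lengthD)
  then show ?thesis unfolding seg_def using group[of j] by (auto intro!: list_all2_appendI)
qed

lemma all_P:
  assumes "j \<le> Suc hi"
  shows "list_all2 P (all_ptrs j) (all_trees j)"
  using assms
proof (induction j)
  case (Suc j)
  then show ?case
    unfolding all_ptrs_def all_trees_def using seg_P[of j]
    by (cases "lo \<le> j") (auto intro!: list_all2_appendI)
qed (simp add: all_ptrs_def all_trees_def)

abbreviation prefix :: "nat \<Rightarrow> 'k list" where
  "prefix j \<equiv> weave (map X [lo..<j]) (map k [lo..<j])"

abbreviation nt :: "nat \<Rightarrow> nat" where
  "nt j \<equiv> next_tall T hi j"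

abbreviation E :: "nat \<Rightarrow> 'k list" where
  "E e \<equiv> if T e then hd (cxs e) else X e"

definition at_sep :: "nat \<Rightarrow> bool" where
  "at_sep j \<longleftrightarrow> j = lo \<or> T j \<and> T (j - 1)"

text \<open>The state after the segments of \<open>lo, ..., j - 1\<close>. If
  \<open>at_sep j\<close>, the sequence is empty or ends with separator \<open>j - 1\<close>.
  Otherwise that separator lies inside a group whose result already reaches to tree
  \<open>nt j\<close>, or to its first child if it is tall, so the sequence is ahead and ends with a
  tree. In the length bound a processed tree counts \<open>B + 1\<close>, a tree joined ahead counts
  1.\<close>

definition inv :: "nat \<Rightarrow> bool" where
  "inv j \<longleftrightarrow> (if at_sep j then length (all_trees j) = length (all_keys j) \<and>
        weave (all_trees j) (all_keys j) = prefix j \<and> length (all_trees j) \<le> (j - lo) * Suc B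
      else length (all_trees j) = Suc (length (all_keys j)) \<and>
        weave (all_trees j) (all_keys j) = prefix (nt j) @ E (nt j) \<and>
        length (all_trees j) \<le> (j - lo) * Suc B + Suc (nt j - j))"

lemma prefix_add:
  assumes "lo \<le> s" "s \<le> e"
  shows "prefix e = prefix s @ weave (map X [s..<e]) (map k [s..<e])"
proof -
  have "[lo..<e] = [lo..<s] @ [s..<e]" using assms by (metis upt_add_eq_append le_add_diff_inverse)
  then show ?thesis by (simp add: weave_append)
qed

text \<open>A tall root adds all its keys and all children but the last. If a group on the left has
  taken the first child, the sequence already ends with it, namely with \<open>E (nt j)\<close>
  where \<open>nt j = j\<close>, and the root continues with its first key.\<close>

lemma inv_extend:
  assumes "inv j" "lo \<le> j" "j \<le> hi" "T j"
    "xs = drop (drop_left T lo j) cs" "length cs = length (cks j)"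
    "take (length (cks j)) (cxs j) = cs"
  shows "length (all_trees j @ xs) = length (all_keys j @ cks j) \<and>
    weave (all_trees j @ xs) (all_keys j @ cks j) = prefix j @ weave cs (cks j) \<and>
    length (all_trees j @ xs) \<le> (j - lo) * Suc B + length cs"
proof (cases "at_sep j")
  case True
  then have "drop_left T lo j = 0" unfolding at_sep_def drop_left_def by auto
  then show ?thesis using assms True unfolding inv_def by (auto simp: weave_append)
next
  case False
  then have d: "drop_left T lo j = 1" "nt j = j"
    using assms unfolding at_sep_def drop_left_def by (auto simp: next_tall_here)
  obtain c ck where ck: "cks j = c # ck" using tall[of j] assms by (cases "cks j") auto
  obtain x xs' where cs: "cs = x # xs'" using assms(6) ck by (cases cs) auto
  then have "x = hd (cxs j)" using assms(7) ck by (cases "cxs j") auto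
  then show ?thesis using assms False d ck cs unfolding inv_def
    by (auto simp: weave_append_Cons)
qed

lemma inv_step:
  assumes "inv j" "lo \<le> j" "j < hi"
  shows "inv (Suc j)"
proof -
  have at: "all_trees (Suc j) = all_trees j @ seg cxs gxs j" "all_keys (Suc j) = all_keys j @ seg_keys j"
    unfolding all_trees_def all_keys_def using assms by auto
  have sub: "Suc j - lo = Suc (j - lo)" using assms by simp
  \<comment> \<open>The last child of a tall root is followed by its own separator or opens a group.
    A low tree either opens the group at \<open>lo\<close> or lies inside a group that has already
    been accounted for.\<close>
  consider (adj) "T j" "T (Suc j)" | (grp) "T j" "\<not> T (Suc j)" | (first) "\<not> T j" "j = lo" | (inside) "\<not> T j" "lo < j"
    using assms(2) by fastforce
  then show ?thesis
  proof cases
    case adj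
    let ?n = "length (cks j)"
    have cl: "length (cxs j) = Suc ?n" using cxs_length[of j] adj assms by simp
    have g: "\<not> group_start T lo hi j" "adjacent T lo hi j" "drop_right T hi j = 0"
      using adj assms unfolding group_start_def adjacent_def drop_right_def by auto
    have os: "at_sep (Suc j)" unfolding at_sep_def using adj by simp
    define y where "y = last (cxs j)"
    have cx: "cxs j = take ?n (cxs j) @ [y]"
      using cl unfolding y_def by (metis append_butlast_last_id butlast_conv_take diff_Suc_1 length_0_conv nat.distinct(1))
    have dl: "drop_left T lo j \<le> ?n"
      using tall[of j] adj assms unfolding drop_left_def by (cases "cks j") auto
    have s: "seg cxs gxs j = drop (drop_left T lo j) (take ?n (cxs j)) @ [y]"
      unfolding seg_def using g adj dl cl by (subst cx) simp
    have sk: "seg_keys j = cks j @ [k j]" unfolding seg_keys_def using g adj by simp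
    have e: "length (all_trees j @ drop (drop_left T lo j) (take ?n (cxs j))) = length (all_keys j @ cks j)"
       "weave (all_trees j @ drop (drop_left T lo j) (take ?n (cxs j))) (all_keys j @ cks j) = prefix j @ weave (take ?n (cxs j)) (cks j)"
       "length (all_trees j @ drop (drop_left T lo j) (take ?n (cxs j))) \<le> (j - lo) * Suc B + ?n"
      using inv_extend[OF assms(1,2) _ adj(1) refl _ refl] assms cl by auto
    have xj: "X j = weave (take ?n (cxs j)) (cks j) @ y"
      using tall[of j] adj assms cl weave_append[of "take ?n (cxs j)" "cks j" "[y]" "[]"] cx by auto
    have "weave (all_trees (Suc j)) (all_keys (Suc j)) = prefix j @ weave (take ?n (cxs j)) (cks j) @ y @ [k j]"
      unfolding at s sk using weave_append[OF e(1), of "[y]" "[k j]"] e(2) by simp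
    also have "\<dots> = prefix (Suc j)" using prefix_add[of j "Suc j"] assms xj by simp
    finally have w: "weave (all_trees (Suc j)) (all_keys (Suc j)) = prefix (Suc j)" .
    have "length (all_trees (Suc j)) \<le> (j - lo) * Suc B + ?n + 1"
      using e(3) unfolding at s by (simp del: mult_Suc_right)
    also have "\<dots> \<le> (Suc j - lo) * Suc B"
      unfolding sub mult_Suc using tall[of j] adj assms by (simp del: mult_Suc_right)
    finally show ?thesis
      unfolding inv_def using os e(1) w unfolding at s sk by simp
  next
    case grp
    let ?n = "length (cks j)" and ?e = "nt (Suc j)"
    have cl: "length (cxs j) = Suc ?n" using cxs_length[of j] grp assms by simp
    have g: "group_start T lo hi j" "drop_right T hi j = 1"
      using grp assms unfolding group_start_def drop_right_def by auto
    have os: "\<not> at_sep (Suc j)" unfolding at_sep_def using grp assms by simp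
    have je: "Suc j \<le> ?e" using next_tall_props(1)[of "Suc j" hi T] assms by simp
    define y where "y = last (cxs j)"
    have cx: "cxs j = take ?n (cxs j) @ [y]"
      using cl unfolding y_def by (metis append_butlast_last_id butlast_conv_take diff_Suc_1 length_0_conv nat.distinct(1))
    have s: "seg cxs gxs j = drop (drop_left T lo j) (take ?n (cxs j)) @ gxs j"
      unfolding seg_def using g grp cl by simp
    have sk: "seg_keys j = cks j @ gks j" unfolding seg_keys_def using g grp by simp
    have e: "length (all_trees j @ drop (drop_left T lo j) (take ?n (cxs j))) = length (all_keys j @ cks j)"
       "weave (all_trees j @ drop (drop_left T lo j) (take ?n (cxs j))) (all_keys j @ cks j) = prefix j @ weave (take ?n (cxs j)) (cks j)"
       "length (all_trees j @ drop (drop_left T lo j) (take ?n (cxs j))) \<le> (j - lo) * Suc B + ?n"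
      using inv_extend[OF assms(1,2) _ grp(1) refl _ refl] assms cl by auto
    have xj: "X j = weave (take ?n (cxs j)) (cks j) @ y"
      using tall[of j] grp assms cl weave_append[of "take ?n (cxs j)" "cks j" "[y]" "[]"] cx by auto
    have up: "[j..<?e] = j # [Suc j..<?e]" using je by (simp add: upt_conv_Cons)
    have gw: "weave (gxs j) (gks j) = y @ k j # weave (map X [Suc j..<?e]) (map k [Suc j..<?e]) @ E ?e"
      using group[OF g(1)] grp weave_append[of "map X [Suc j..<?e]" "map k [Suc j..<?e]" "[E ?e]" "[]"]
      unfolding up y_def by simp
    have "weave (all_trees (Suc j)) (all_keys (Suc j)) =
       prefix j @ weave (take ?n (cxs j)) (cks j) @ y @ k j # weave (map X [Suc j..<?e]) (map k [Suc j..<?e]) @ E ?e"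
      unfolding at s sk using weave_append[OF e(1), of "gxs j" "gks j"] e(2) gw by simp
    also have "\<dots> = prefix ?e @ E ?e"
      using prefix_add[of j ?e] assms je xj unfolding up by simp
    finally have w: "weave (all_trees (Suc j)) (all_keys (Suc j)) = prefix ?e @ E ?e" .
    have "length (all_trees (Suc j)) \<le> (j - lo) * Suc B + ?n + Suc (?e - j)"
      using e(3) group[OF g(1)] gxs_length[OF g(1)] unfolding at s by (simp del: mult_Suc_right)
    also have "\<dots> \<le> (Suc j - lo) * Suc B + Suc (?e - Suc j)"
    proof -
      have "?n \<le> B" using tall[of j] grp assms by simp
      then show ?thesis unfolding sub mult_Suc using je by linarith
    qed
    finally show ?thesis
      unfolding inv_def using os w e(1) gxs_length[OF g(1)] unfolding at s sk by simp
  next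
    case first
    let ?e = "nt (Suc j)"
    have g: "group_start T lo hi j" using first assms unfolding group_start_def by auto
    have os: "\<not> at_sep (Suc j)" unfolding at_sep_def using first assms by simp
    have je: "Suc j \<le> ?e" using next_tall_props(1)[of "Suc j" hi T] assms by simp
    have up: "[j..<?e] = j # [Suc j..<?e]" using je by (simp add: upt_conv_Cons)
    have a: "all_trees (Suc j) = gxs j" "all_keys (Suc j) = gks j"
      using first g unfolding at by (auto simp: all_trees_def all_keys_def seg_def seg_keys_def)
    have "weave (gxs j) (gks j) = X j @ k j # weave (map X [Suc j..<?e]) (map k [Suc j..<?e]) @ E ?e"
      using group[OF g(1)] first weave_append[of "map X [Suc j..<?e]" "map k [Suc j..<?e]" "[E ?e]" "[]"]
      unfolding up by simp
    also have "\<dots> = prefix ?e @ E ?e" using first up by simp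
    finally have w: "weave (gxs j) (gks j) = prefix ?e @ E ?e" .
    have "length (gxs j) \<le> Suc (?e - j)" using group[OF g] gxs_length[OF g] by simp
    also have "\<dots> \<le> (Suc j - lo) * Suc B + Suc (?e - Suc j)"
      unfolding sub mult_Suc using je by linarith
    finally show ?thesis unfolding inv_def a using os gxs_length[OF g] w by simp
  next
    case inside
    have "\<not> group_start T lo hi j" "\<not> adjacent T lo hi j"
      using inside unfolding group_start_def adjacent_def by auto
    then have a: "all_trees (Suc j) = all_trees j" "all_keys (Suc j) = all_keys j"
      using inside unfolding at seg_def seg_keys_def by auto
    have "\<not> at_sep (Suc j)" "\<not> at_sep j" unfolding at_sep_def using inside assms by auto
    moreover have "nt j = nt (Suc j)" using next_tall_Suc[of T j hi] inside assms by simp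
    ultimately show ?thesis using assms(1) unfolding inv_def a sub by auto
  qed
qed

lemma inv_hi: "inv hi"
proof -
  have "inv j" if "lo \<le> j" "j \<le> hi" for j
    using that
  proof (induction j rule: dec_induct)
    case base
    show ?case unfolding inv_def at_sep_def all_trees_def all_keys_def by simp
  next
    case (step j) then show ?case using inv_step by simp
  qed
  then show ?thesis using lohi by simp
qed

text \<open>The bound of \<open>B + 1\<close> children per joined tree is what limits the number of
  nodes cut from the sequence to the number of trees.\<close>

theorem regroup:
  "length (all_trees (Suc hi)) = Suc (length (all_keys (Suc hi)))"
  "weave (all_trees (Suc hi)) (all_keys (Suc hi)) = weave (map X [lo..<Suc hi]) (map k [lo..<hi])"
  "length (all_trees (Suc hi)) \<le> (Suc hi - lo) * Suc B"
proof -
  have at: "all_trees (Suc hi) = all_trees hi @ seg cxs gxs hi" "all_keys (Suc hi) = all_keys hi @ seg_keys hi"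
    unfolding all_trees_def all_keys_def using lohi by auto
  have sub: "Suc hi - lo = Suc (hi - lo)" using lohi by simp
  have tot: "weave (map X [lo..<Suc hi]) (map k [lo..<hi]) = prefix hi @ X hi"
    using weave_append[of "map X [lo..<hi]" "map k [lo..<hi]" "[X hi]" "[]"] lohi by simp
  have g: "\<not> group_start T lo hi hi" "\<not> adjacent T lo hi hi" "drop_right T hi hi = 0"
    unfolding group_start_def adjacent_def drop_right_def by auto
  have "length (all_trees (Suc hi)) = Suc (length (all_keys (Suc hi))) \<and>
   weave (all_trees (Suc hi)) (all_keys (Suc hi)) = prefix hi @ X hi \<and>
  length (all_trees (Suc hi)) \<le> (Suc hi - lo) * Suc B"
  proof (cases "T hi")
    case True
    let ?n = "length (cks hi)"
    have cl: "length (cxs hi) = Suc ?n" using cxs_length[of hi] lohi True by simp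
    define y where "y = last (cxs hi)"
    have cx: "cxs hi = take ?n (cxs hi) @ [y]"
      using cl unfolding y_def by (metis append_butlast_last_id butlast_conv_take diff_Suc_1 length_0_conv nat.distinct(1))
    have dl: "drop_left T lo hi \<le> ?n"
      using tall[of hi] True lohi unfolding drop_left_def by (cases "cks hi") auto
    have s: "seg cxs gxs hi = drop (drop_left T lo hi) (take ?n (cxs hi)) @ [y]"
      unfolding seg_def using g True dl cl by (subst cx) simp
    have sk: "seg_keys hi = cks hi" unfolding seg_keys_def using g True by simp
    have e: "length (all_trees hi @ drop (drop_left T lo hi) (take ?n (cxs hi))) = length (all_keys hi @ cks hi)"
       "weave (all_trees hi @ drop (drop_left T lo hi) (take ?n (cxs hi))) (all_keys hi @ cks hi) = prefix hi @ weave (take ?n (cxs hi)) (cks hi)"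
       "length (all_trees hi @ drop (drop_left T lo hi) (take ?n (cxs hi))) \<le> (hi - lo) * Suc B + ?n"
      using inv_extend[OF inv_hi _ _ True refl _ refl] lohi cl by auto
    have xj: "X hi = weave (take ?n (cxs hi)) (cks hi) @ y"
      using tall[of hi] True lohi cl weave_append[of "take ?n (cxs hi)" "cks hi" "[y]" "[]"] cx by auto
    have "length (all_trees (Suc hi)) \<le> (hi - lo) * Suc B + ?n + 1"
      using e(3) unfolding at s by (simp del: mult_Suc_right)
    also have "\<dots> \<le> (Suc hi - lo) * Suc B"
      unfolding sub mult_Suc using tall[of hi] True lohi by (simp del: mult_Suc_right)
    finally show ?thesis
      using e(1) weave_append[OF e(1), of "[y]" "[]"] e(2) xj unfolding at s sk by simp
  next
    case False
    then have "\<not> at_sep hi" "nt hi = hi" using lohi unfolding at_sep_def by (auto simp: next_tall_here)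
    then show ?thesis using inv_hi False g lohi
      unfolding inv_def at seg_def seg_keys_def sub by auto
  qed
  then show "length (all_trees (Suc hi)) = Suc (length (all_keys (Suc hi)))"
    "weave (all_trees (Suc hi)) (all_keys (Suc hi)) = weave (map X [lo..<Suc hi]) (map k [lo..<hi])"
    "length (all_trees (Suc hi)) \<le> (Suc hi - lo) * Suc B" using tot by auto
qed

text \<open>The keys of a tall root all survive in one segment. This is the source of the lower
  bound when the whole sequence becomes a single node.\<close>

lemma length_all_keys:
  assumes "lo \<le> j" "j \<le> hi" "T j"
  shows "length (cks j) \<le> length (all_keys (Suc hi))"
proof -
  have "length (cks j) \<le> length (seg_keys j)" unfolding seg_keys_def using assms by simp
  also have "length (seg_keys j) \<le> sum_list (map (length \<circ> seg_keys) [lo..<Suc hi])"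
    using assms by (intro member_le_sum_list) (auto simp del: upt_Suc)
  finally show ?thesis unfolding all_keys_def by (simp add: length_concat comp_def)
qed

end

text \<open>Cutting \<open>n\<close> children evenly into \<open>r = \<lceil>n / (B + 1)\<rceil>\<close> nodes; node \<open>i\<close> gets the children from
  \<open>cut n r i\<close> on, and the key before the first child of each later node becomes a separator.\<close>

definition num_nodes :: "nat \<Rightarrow> nat \<Rightarrow> nat" where
  "num_nodes B n = (n + B) div Suc B"

definition cut :: "nat \<Rightarrow> nat \<Rightarrow> nat \<Rightarrow> nat" where
  "cut n r i = i * n div r"

lemma num_nodes_pos: "0 < n \<Longrightarrow> 0 < num_nodes B n"
  unfolding num_nodes_def by (simp add: div_greater_zero_iff)

lemma num_nodes_le: "n \<le> w * Suc B \<Longrightarrow> num_nodes B n \<le> w"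
proof -
  assume "n \<le> w * Suc B"
  then have "n + B < Suc w * Suc B" by simp
  then have "num_nodes B n < Suc w" unfolding num_nodes_def by (simp add: less_mult_imp_div_less del: mult_Suc mult_Suc_right)
  then show ?thesis by simp
qed

lemma num_nodes_bounds:
  shows "n \<le> num_nodes B n * Suc B" "0 < n \<Longrightarrow> (num_nodes B n - 1) * Suc B < n"
proof -
  have e: "n + B = num_nodes B n * Suc B + (n + B) mod Suc B" "(n + B) mod Suc B < Suc B"
    unfolding num_nodes_def by (metis div_mult_mod_eq, simp)
  then show "n \<le> num_nodes B n * Suc B" by linarith
  assume "0 < n"
  then obtain r where "num_nodes B n = Suc r" using num_nodes_pos[of n B] by (cases "num_nodes B n") auto
  then show "(num_nodes B n - 1) * Suc B < n" using e by simp
qed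

lemma cut_0 [simp]: "cut n r 0 = 0"
  unfolding cut_def by simp

lemma cut_r [simp]: "0 < r \<Longrightarrow> cut n r r = n"
  unfolding cut_def by simp

text \<open>From one cut to the next the numerator grows by \<open>n\<close>, thus by at least
  \<open>c * r\<close>, and a multiple of \<open>r\<close> passes through the rounding.\<close>

lemma cut_size_ge:
  assumes "c * r \<le> n" "0 < r"
  shows "cut n r i + c \<le> cut n r (Suc i)"
proof -
  have "cut n r i + c = (i * n + c * r) div r" unfolding cut_def using assms by simp
  also have "\<dots> \<le> cut n r (Suc i)" unfolding cut_def using assms by (intro div_le_mono) simp
  finally show ?thesis .
qed

lemma cut_size_le:
  assumes "n \<le> c * r" "0 < r"
  shows "cut n r (Suc i) \<le> cut n r i + c"
proof -
  have "cut n r (Suc i) \<le> (i * n + c * r) div r" unfolding cut_def using assms by (intro div_le_mono) simp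
  also have "\<dots> = cut n r i + c" unfolding cut_def using assms by simp
  finally show ?thesis .
qed

text \<open>With \<open>r = s + 2\<close> the assumption gives
  \<open>n \<ge> (B + 2) + s * (B + 1)\<close>: two nodes share
  \<open>B + 2 \<ge> 2 * (B div 2 + 1)\<close> children, and each further one has
  \<open>B + 1\<close>. For odd \<open>B\<close> the first inequality relies on rounding
  \<open>B / 2\<close> down.\<close>

lemma half_full:
  assumes "2 \<le> r" "(r - 1) * Suc B < n"
  shows "Suc (B div 2) * r \<le> n"
proof -
  obtain s where r: "r = Suc (Suc s)" using assms(1) by (intro that[of "r - 2"]) simp
  have "Suc (B div 2) * 2 \<le> Suc (Suc B)" by simp
  moreover have "Suc (B div 2) * s \<le> Suc B * s" by (intro mult_right_mono) auto
  moreover have "Suc s * Suc B = Suc B + Suc B * s" by simp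
  moreover have "Suc (B div 2) * r = Suc (B div 2) * 2 + Suc (B div 2) * s" unfolding r by simp
  moreover have "Suc B + Suc B * s < n" using assms(2) unfolding r by (simp add: algebra_simps)
  ultimately show ?thesis by linarith
qed

definition slice :: "nat \<Rightarrow> nat \<Rightarrow> 'b list \<Rightarrow> 'b list" where
  "slice a b xs = take (b - a) (drop a xs)"

lemma length_slice: "b \<le> length xs \<Longrightarrow> length (slice a b xs) = b - a"
  unfolding slice_def by auto

lemma nth_slice: "b \<le> length xs \<Longrightarrow> i < b - a \<Longrightarrow> slice a b xs ! i = xs ! (a + i)"
  unfolding slice_def by auto

lemma take_slice: "a \<le> b \<Longrightarrow> take b xs = take a xs @ slice a b xs"
  unfolding slice_def by (metis le_add_diff_inverse take_add)

text \<open>Key \<open>j\<close> stands between the trees \<open>j\<close> and \<open>Suc j\<close>,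
  so the node with the trees \<open>bd i, ..., bd (Suc i) - 1\<close> keeps one key fewer than it
  has trees and releases key \<open>bd (Suc i) - 1\<close>. The induction appends one node together
  with its released key; the last node releases none.\<close>

lemma weave_cut:
  assumes "length xs = Suc (length ks)" "length xs = bd r" "bd 0 = 0" "0 < r" "\<And>i. i < r \<Longrightarrow> bd i < bd (Suc i)"
  shows "weave (map (\<lambda>i. weave (slice (bd i) (bd (Suc i)) xs) (slice (bd i) (bd (Suc i) - 1) ks)) [0..<r])
     (map (\<lambda>i. ks ! (bd (Suc i) - 1)) [0..<r - 1]) = weave xs ks"
proof -
  let ?X = "\<lambda>i. weave (slice (bd i) (bd (Suc i)) xs) (slice (bd i) (bd (Suc i) - 1) ks)"
  let ?K = "\<lambda>i. ks ! (bd (Suc i) - 1)"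
  have mono: "bd i \<le> bd r" if "i \<le> r" for i
    using that
  proof (induction i rule: inc_induct)
    case (step i)
    then show ?case using assms(5)[of i] by linarith
  qed simp
  have full: "weave (map ?X [0..<i]) (map ?K [0..<i]) = weave (take (bd i) xs) (take (bd i) ks)" if "i < r" for i
    using that
  proof (induction i)
    case 0 then show ?case using assms(3) by simp
  next
    case (Suc i)
    have i: "bd i < bd (Suc i)" "bd (Suc i) < bd r" using assms(5)[of i] assms(5)[of "Suc i"] mono[of "Suc (Suc i)"] Suc.prems by auto
    define d where "d = bd (Suc i) - 1"
    have d: "bd (Suc i) = Suc d" "bd i \<le> d" "d < length ks" using i assms(1,2) unfolding d_def by auto
    have tk: "take (bd (Suc i)) ks = take (bd i) ks @ slice (bd i) d ks @ [ks ! d]"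
      using take_slice[of "bd i" d ks] d by (simp add: take_Suc_conv_app_nth)
    have "weave (take (bd (Suc i)) xs) (take (bd (Suc i)) ks) = weave (take (bd i) xs) (take (bd i) ks) @
       weave (slice (bd i) (bd (Suc i)) xs) (slice (bd i) d ks @ [ks ! d])"
      unfolding tk take_slice[OF less_imp_le[OF i(1)], of xs] using i assms(1,2) by (intro weave_append) simp
    also have "weave (slice (bd i) (bd (Suc i)) xs) (slice (bd i) d ks @ [ks ! d]) = ?X i @ [?K i]"
    proof -
      have "length (slice (bd i) (bd (Suc i)) xs) = Suc (length (slice (bd i) d ks))"
        using length_slice[of "bd (Suc i)" xs "bd i"] length_slice[of d ks "bd i"] d assms(1,2) i by simp
      from weave_append_Cons[OF this, of "[]" "ks ! d" "[]"] show ?thesis unfolding d_def[symmetric] by simp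
    qed
    finally show ?case using Suc by (simp add: weave_append)
  qed
  obtain s where r: "r = Suc s" using assms(4) by (cases r) auto
  have s: "bd s < bd r" using assms(5)[of s] r by simp
  have "weave (map ?X [0..<r]) (map ?K [0..<r - 1]) = weave (map ?X [0..<s]) (map ?K [0..<s]) @ ?X s"
    unfolding r using weave_append[of "map ?X [0..<s]" "map ?K [0..<s]" "[?X s]" "[]"] by simp
  also have "\<dots> = weave (take (bd s) xs @ slice (bd s) (bd r) xs) (take (bd s) ks @ slice (bd s) (bd r - 1) ks)"
    using full[of s] r s assms(1,2) by (subst weave_append) auto
  also have "take (bd s) xs @ slice (bd s) (bd r) xs = xs"
    using take_slice[of "bd s" "bd r" xs] s assms(2) by simp
  also have "take (bd s) ks @ slice (bd s) (bd r - 1) ks = ks"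
    using take_slice[of "bd s" "bd r - 1" ks] s assms(1,2) by simp
  finally show ?thesis .
qed

section \<open>The program\<close>

text \<open>Page \<open>p\<close> consists of the blocks \<open>4 * p, \<dots>, 4 * p + 3\<close>. The call of recursion depth \<open>d\<close> whose
  first separator is \<open>l\<close> owns the \<open>region_size B\<close> pages from \<open>region B f d l\<close> on: 2 pages with the
  height, number of keys, first and last child of each tree; 1 page for the numbers of keys of the
  results of the groups; \<open>B\<close> pages for these results; \<open>B + 2\<close> pages each for the concatenated
  pointers and keys; \<open>B + 1\<close> pages for new nodes.\<close>

definition region_size :: "nat \<Rightarrow> nat" where
  "region_size B = 4 * B + 8"

text \<open>The pair \<open>(d, l)\<close> is encoded injectively because \<open>l \<le> B\<close>.
  No call starts at separator \<open>B\<close>, as \<open>lo < hi \<le> B\<close>, so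
  \<open>region B f 0 B\<close> is left for the main thread. Page \<open>f\<close> begins at block
  \<open>4 * f\<close>, beyond the input.\<close>

definition region :: "nat \<Rightarrow> nat \<Rightarrow> nat \<Rightarrow> nat \<Rightarrow> nat" where
  "region B f d l = f + (d * Suc B + l) * region_size B"

definition page_depth :: "nat \<Rightarrow> nat \<Rightarrow> nat \<Rightarrow> nat" where
  "page_depth B f x = (x - f) div region_size B div Suc B"

definition page_sep :: "nat \<Rightarrow> nat \<Rightarrow> nat \<Rightarrow> nat" where
  "page_sep B f x = (x - f) div region_size B mod Suc B"

text \<open>The pages available to a call and all its descendants, which are deeper and work on
  subintervals of its separators. The cap \<open>f\<close> on the depth makes the set bounded
  (\<open>own_lt\<close>); it is respected because each level lowers the height by one.\<close>

definition own :: "nat \<Rightarrow> nat \<Rightarrow> nat \<Rightarrow> nat \<Rightarrow> nat \<Rightarrow> nat set" where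
  "own B f d lo hi = {x. f \<le> x \<and> d \<le> page_depth B f x \<and> page_depth B f x \<le> f \<and>
     lo \<le> page_sep B f x \<and> page_sep B f x < hi}"

definition page_limit :: "nat \<Rightarrow> nat \<Rightarrow> nat" where
  "page_limit B f = f + Suc f * Suc B * region_size B"

lemma region_page:
  assumes "i < region_size B" "l \<le> B"
  shows "f \<le> region B f d l + i" "page_depth B f (region B f d l + i) = d" "page_sep B f (region B f d l + i) = l"
proof -
  have e: "region B f d l + i - f = (d * Suc B + l) * region_size B + i" unfolding region_def by simp
  have l: "l < Suc B" using assms(2) by simp
  show "f \<le> region B f d l + i" unfolding region_def by simp
  show "page_depth B f (region B f d l + i) = d" "page_sep B f (region B f d l + i) = l"
    unfolding page_depth_def page_sep_def e div_mod_block(1)[OF assms(1)] by (rule div_mod_block[OF l])+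
qed

lemma region_own:
  assumes "i < region_size B" "lo \<le> l" "l < hi" "hi \<le> B" "d' \<le> d" "d \<le> f"
  shows "region B f d l + i \<in> own B f d' lo hi"
proof -
  have "l \<le> B" using assms by simp
  from region_page[OF assms(1) this] show ?thesis unfolding own_def using assms by simp
qed

lemma region_not_own:
  assumes "i < region_size B" "l \<le> B" "d < d' \<or> l < lo \<or> hi \<le> l"
  shows "region B f d l + i \<notin> own B f d' lo hi"
  unfolding own_def using region_page(2,3)[OF assms(1,2), of f d] assms(3) by auto

lemma own_lt:
  assumes "x \<in> own B f d lo hi"
  shows "x < page_limit B f"
proof -
  let ?c = "(x - f) div region_size B"
  have z: "0 < region_size B" unfolding region_size_def by simp
  have "?c div Suc B < Suc f" using assms unfolding own_def page_depth_def by simp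
  then have "?c < Suc f * Suc B" by (metis div_less_iff_less_mult zero_less_Suc)
  then have "x - f < Suc f * Suc B * region_size B" using z by (metis div_less_iff_less_mult)
  then show ?thesis unfolding page_limit_def by linarith
qed

lemma own_mono: "d \<le> d' \<Longrightarrow> lo \<le> lo' \<Longrightarrow> hi' \<le> hi \<Longrightarrow> own B f d' lo' hi' \<subseteq> own B f d lo hi"
  unfolding own_def by auto

lemma own_disjoint: "hi \<le> lo' \<Longrightarrow> own B f d lo hi \<inter> own B f d' lo' hi' = {}"
  unfolding own_def by auto

lemma own_ge: "x \<in> own B f d lo hi \<Longrightarrow> f \<le> x"
  unfolding own_def by simp

text \<open>A thread of a call has the arguments \<open>[B, q, f, d, lo, hi, pL, pR, ret, cnt]\<close>. It joins the
  trees \<open>lo, \<dots>, hi\<close> of the input, except that the first and the last of them are given by the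
  pointers \<open>pL\<close> and \<open>pR\<close>. Its result, a list of trees of the maximal height with separators, is
  written to page \<open>ret\<close> in the format of a node, and the number of separators to the word \<open>cnt\<close>.\<close>

definition call_region :: "'k word list \<Rightarrow> nat" where
  "call_region rest = region (arg rest 0) (arg rest 2) (arg rest 3) (arg rest 4)"

text \<open>The blocks \<open>q + 1\<close> and \<open>q + 2\<close> are read first and directly
  follow the 10 arguments, so pointer \<open>j\<close> of the input is word \<open>10 + j\<close>.
  The null pointer outside the range is a mere default.\<close>

definition call_ptr :: "'k word list \<Rightarrow> nat \<Rightarrow> nat" where
  "call_ptr rest j =
    (if j < arg rest 4 \<or> arg rest 5 < j then 0 else if j = arg rest 4 then arg rest 6
     else if j = arg rest 5 then arg rest 7 else arg rest (10 + j))"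

text \<open>Word \<open>i\<close> of the 4-word slot of tree \<open>j\<close>, in the copy of the
  slots that was read after \<open>n\<close> other blocks: \<open>n = 2\<close> for the first copy,
  \<open>n = 8\<close> for the second, which contains the last children as well. External trees
  leave their slot unwritten; 0 is their height and their number of keys.\<close>

definition call_info :: "nat \<Rightarrow> nat \<Rightarrow> 'k word list \<Rightarrow> nat \<Rightarrow> nat" where
  "call_info n i rest j =
    (if call_ptr rest j = 0 then 0 else arg rest (10 + n * arg rest 0 + 4 * (j - arg rest 4) + i))"

definition call_height :: "'k word list \<Rightarrow> nat" where
  "call_height rest = Max (call_info 8 0 rest ` {arg rest 4..arg rest 5})"

definition call_tall :: "'k word list \<Rightarrow> nat \<Rightarrow> bool" where
  "call_tall rest j \<longleftrightarrow> call_info 8 0 rest j = call_height rest"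

definition call_count :: "'k word list \<Rightarrow> nat \<Rightarrow> nat" where
  "call_count rest s = (if group_start (call_tall rest) (arg rest 4) (arg rest 5) s
     then arg rest (10 + 14 * arg rest 0 + (s - arg rest 4)) else 0)"

text \<open>The address of the last child depends on the number of keys, which this round only
  fetches; hence the second round \<open>jobs2\<close>.\<close>

definition jobs1 :: "nat \<Rightarrow> nat \<Rightarrow> nat \<Rightarrow> nat \<Rightarrow> (nat \<Rightarrow> nat) \<Rightarrow> job list" where
  "jobs1 B rg lo hi pt = concat (map (\<lambda>j. if pt j = 0 then [] else
     [Copy (4 * pt j * B) 2 (4 * rg * B + 4 * (j - lo)),
      Copy (4 * pt j * B + 2 * B) 1 (4 * rg * B + 4 * (j - lo) + 2)]) [lo..<Suc hi])"

definition jobs2 :: "nat \<Rightarrow> nat \<Rightarrow> nat \<Rightarrow> nat \<Rightarrow> (nat \<Rightarrow> nat) \<Rightarrow> (nat \<Rightarrow> nat) \<Rightarrow> job list" where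
  "jobs2 B rg lo hi pt nk = concat (map (\<lambda>j. if pt j = 0 then [] else
     [Copy (4 * pt j * B + 2 * B + nk j) 1 (4 * rg * B + 4 * (j - lo) + 3)]) [lo..<Suc hi])"

text \<open>One child per separator makes child \<open>i\<close> responsible for separator
  \<open>lo + i\<close>. A separator that starts no group gets code 3, which is empty and transfers
  nothing.\<close>

definition calls :: "nat \<Rightarrow> nat \<Rightarrow> nat \<Rightarrow> nat \<Rightarrow> nat \<Rightarrow> nat \<Rightarrow> nat \<Rightarrow> (nat \<Rightarrow> nat) \<Rightarrow> (nat \<Rightarrow> bool)
    \<Rightarrow> (nat \<Rightarrow> nat) \<Rightarrow> (nat \<Rightarrow> nat) \<Rightarrow> nat list list" where
  "calls B q f d rg lo hi pt T fc lc = map (\<lambda>s.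
     if group_start T lo hi s then
       let e = next_tall T hi (Suc s) in
         [2, 0, B, q, f, Suc d, s, e, if T s then lc s else pt s, if T e then fc e else pt e,
          rg + 3 + (s - lo), 4 * (rg + 2) * B + (s - lo)]
     else [3, 0, 0, 0, 0]) [lo..<hi]"

definition ptr_buf :: "nat \<Rightarrow> nat \<Rightarrow> nat" where
  "ptr_buf B rg = 4 * (rg + 3 + B) * B"

definition key_buf :: "nat \<Rightarrow> nat \<Rightarrow> nat" where
  "key_buf B rg = 4 * (rg + 5 + 2 * B) * B"

definition new_node :: "nat \<Rightarrow> nat \<Rightarrow> nat \<Rightarrow> nat" where
  "new_node B rg i = rg + 7 + 3 * B + i"

definition own_ptrs :: "nat \<Rightarrow> nat \<Rightarrow> (nat \<Rightarrow> bool) \<Rightarrow> (nat \<Rightarrow> nat) \<Rightarrow> nat \<Rightarrow> nat" where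
  "own_ptrs lo hi T nk j = (if T j then Suc (nk j) - drop_right T hi j - drop_left T lo j else 0)"

text \<open>The length of a segment, computed from numbers of keys alone. The prefix sums of these
  lengths are the target offsets, so all copies can run in parallel.\<close>

definition ptr_len :: "nat \<Rightarrow> nat \<Rightarrow> (nat \<Rightarrow> bool) \<Rightarrow> (nat \<Rightarrow> nat) \<Rightarrow> (nat \<Rightarrow> nat) \<Rightarrow> nat \<Rightarrow> nat" where
  "ptr_len lo hi T nk cn j = own_ptrs lo hi T nk j + (if group_start T lo hi j then Suc (cn j) else 0)"

definition key_len :: "nat \<Rightarrow> nat \<Rightarrow> (nat \<Rightarrow> bool) \<Rightarrow> (nat \<Rightarrow> nat) \<Rightarrow> (nat \<Rightarrow> nat) \<Rightarrow> nat \<Rightarrow> nat" where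
  "key_len lo hi T nk cn j = (if T j then nk j else 0) +
     (if group_start T lo hi j then cn j else if adjacent T lo hi j then 1 else 0)"

definition jobs3 :: "nat \<Rightarrow> nat \<Rightarrow> nat \<Rightarrow> nat \<Rightarrow> nat \<Rightarrow> nat \<Rightarrow> (nat \<Rightarrow> nat) \<Rightarrow> (nat \<Rightarrow> bool)
    \<Rightarrow> (nat \<Rightarrow> nat) \<Rightarrow> (nat \<Rightarrow> nat) \<Rightarrow> job list" where
  "jobs3 B q h rg lo hi pt T nk cn = (if h = 0 then [] else concat (map (\<lambda>j.
     let dp = ptr_buf B rg + sum (ptr_len lo hi T nk cn) {lo..<j};
         dk = key_buf B rg + sum (key_len lo hi T nk cn) {lo..<j};
         gp = rg + 3 + (j - lo) in
     (if T j then
       [Copy (4 * pt j * B + 2 * B + drop_left T lo j) (own_ptrs lo hi T nk j) dp,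
        Copy (4 * pt j * B + B) (nk j) dk] else []) @
     (if group_start T lo hi j then
       [Copy (4 * gp * B + 2 * B) (Suc (cn j)) (dp + own_ptrs lo hi T nk j),
        Copy (4 * gp * B + B) (cn j) (dk + (if T j then nk j else 0))]
      else if adjacent T lo hi j then [Copy (q * B + j) 1 (dk + nk j)] else [])) [lo..<Suc hi]))"

text \<open>At height 0 all trees are external and only the separators remain, above null pointers.
  In both cases the page \<open>ret\<close> gets the header of a node of height
  \<open>Suc h\<close>, so that the result of the outermost call can itself serve as the
  root.\<close>

definition jobs4 :: "nat \<Rightarrow> nat \<Rightarrow> nat \<Rightarrow> nat \<Rightarrow> nat \<Rightarrow> nat \<Rightarrow> nat \<Rightarrow> nat \<Rightarrow> nat \<Rightarrow> job list" where
  "jobs4 B q h rg lo hi n ret cnt = (if h = 0 then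
     [Copy (q * B + lo) (hi - lo) (4 * ret * B + B), Store 2 (4 * ret * B) 1 (hi - lo), Store 1 cnt (hi - lo) 0] @
     map (\<lambda>i. Store 1 (4 * ret * B + 2 * B + i) 0 0) [0..<Suc (hi - lo)]
   else let r = num_nodes B n in
     [Store 2 (4 * ret * B) (Suc h) (r - 1), Store 1 cnt (r - 1) 0] @
     concat (map (\<lambda>i. let x = new_node B rg i; c = cut n r i; c' = cut n r (Suc i) in
       [Copy (ptr_buf B rg + c) (c' - c) (4 * x * B + 2 * B),
        Copy (key_buf B rg + c) (c' - c - 1) (4 * x * B + B),
        Store 2 (4 * x * B) h (c' - c - 1),
        Store 1 (4 * ret * B + 2 * B + i) x 0] @
       (if Suc i < r then [Copy (key_buf B rg + (c' - 1)) 1 (4 * ret * B + B + i)] else [])) [0..<r]))"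

definition call_code2 :: "'k code" where
  "call_code2 =
     [\<lambda>rest. AFork (calls (arg rest 0) (arg rest 1) (arg rest 2) (arg rest 3) (call_region rest)
        (arg rest 4) (arg rest 5) (call_ptr rest) (call_tall rest) (call_info 8 2 rest) (call_info 8 3 rest))] @
     read_blocks 1 (\<lambda>rest. 4 * (call_region rest + 2)) @
     fan 9 (\<lambda>rest. jobs3 (arg rest 0) (arg rest 1) (call_height rest) (call_region rest) (arg rest 4) (arg rest 5)
        (call_ptr rest) (call_tall rest) (call_info 8 1 rest) (call_count rest)) @
     fan 9 (\<lambda>rest. jobs4 (arg rest 0) (arg rest 1) (call_height rest) (call_region rest) (arg rest 4) (arg rest 5)
        (sum (ptr_len (arg rest 4) (arg rest 5) (call_tall rest) (call_info 8 1 rest) (call_count rest))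
          {arg rest 4..<Suc (arg rest 5)}) (arg rest 8) (arg rest 9))"

text \<open>The 9 forks suffice for the longest list, the at most \<open>5 * (B + 1) + 2\<close>
  jobs of \<open>jobs4\<close>, which number at most \<open>9 * B\<close> for
  \<open>B \<ge> 2\<close>. Six blocks contain all slots because
  \<open>4 * (B + 1) \<le> 6 * B\<close>.\<close>

definition call_code :: "'k code" where
  "call_code =
     read_blocks 2 (\<lambda>rest. arg rest 1 + 1) @
     fan 9 (\<lambda>rest. jobs1 (arg rest 0) (call_region rest) (arg rest 4) (arg rest 5) (call_ptr rest)) @
     read_blocks 6 (\<lambda>rest. 4 * call_region rest) @
     fan 9 (\<lambda>rest. jobs2 (arg rest 0) (call_region rest) (arg rest 4) (arg rest 5) (call_ptr rest) (call_info 2 1 rest)) @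
     read_blocks 6 (\<lambda>rest. 4 * call_region rest) @ call_code2"

definition main_ret :: "'k word list \<Rightarrow> nat" where
  "main_ret rest = region (arg rest 0) (arg rest 3) 0 (arg rest 0)"

text \<open>A result without separators is a single tree, whose pointer is the answer; otherwise the
  result page is the root. The number of separators is the second word behind 4 arguments and 2
  blocks, the first pointer is the first word one block later.\<close>

definition main_code :: "'k code" where
  "main_code =
     read_blocks 2 (\<lambda>rest. arg rest 2 + 1) @
     [\<lambda>rest. AFork [[2, 0, arg rest 0, arg rest 2, arg rest 3, 0, 0, arg rest 1, arg rest 4, arg rest (4 + arg rest 1),
        main_ret rest, 4 * (main_ret rest + 1) * arg rest 0]]] @
     read_blocks 1 (\<lambda>rest. 4 * main_ret rest) @
     read_blocks 1 (\<lambda>rest. 4 * main_ret rest + 2) @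
     [\<lambda>rest. AStop (if arg rest (4 + 2 * arg rest 0 + 1) = 0 then arg rest (4 + 3 * arg rest 0) else main_ret rest)]"

definition codes :: "nat \<Rightarrow> 'k code" where
  "codes t = (if t = 0 then main_code else if t = 1 then job_code else if t = 2 then call_code else [])"

lemma length_codes: "length (codes t) \<le> 60"
  unfolding codes_def main_code_def job_code_def call_code_def call_code2_def fan_def read_blocks_def by simp

lemma length_concat_map_le:
  assumes "\<And>x. x \<in> set xs \<Longrightarrow> length (f x) \<le> c"
  shows "length (concat (map f xs)) \<le> c * length xs"
  using assms by (induction xs) fastforce+

lemma map_upt_nth: "i < n \<Longrightarrow> (xs @ map m [a..<a + n]) ! (length xs + i) = m (a + i)"
  by (simp add: nth_append)

lemma stored_concat:
  assumes "\<And>j. lo \<le> j \<Longrightarrow> j < n \<Longrightarrow> stored m (a + length (concat (map F [lo..<j]))) (F j)"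
  shows "stored m a (concat (map F [lo..<n]))"
  using assms
proof (induction n)
  case (Suc n)
  show ?case
  proof (cases "lo \<le> n")
    case True
    have *: "stored m a (concat (map F [lo..<n]))" using Suc by simp
    have **: "stored m (a + length (concat (map F [lo..<n]))) (F n)" using Suc.prems[of n] True by simp
    have "stored m a (concat (map F [lo..<n]) @ F n)"
      unfolding stored_def
    proof (intro allI impI)
      fix i assume i: "i < length (concat (map F [lo..<n]) @ F n)"
      show "m (a + i) = (concat (map F [lo..<n]) @ F n) ! i"
      proof (cases "i < length (concat (map F [lo..<n]))")
        case True then show ?thesis using * by (simp add: stored_def nth_append)
      next
        case False
        then show ?thesis using ** i unfolding stored_def
          by (auto simp: nth_append dest: spec[of _ "i - length (concat (map F [lo..<n]))"])
      qed
    qed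
    then show ?thesis using True by simp
  qed (simp add: stored_def)
qed (simp add: stored_def)

lemma job_reads_page:
  assumes "0 < B" "x \<in> job_reads B (Copy s n d)"
  shows "x div 4 = s div (4 * B) \<or> x div 4 = (s + B) div (4 * B)"
proof -
  have "Suc (s div B) = (s + B) div B" using assms(1) by simp
  then show ?thesis using assms(2) page_of_block[of s B] page_of_block[of "s + B" B] by auto
qed

lemma page_interval:
  fixes a :: nat
  assumes "0 < B" "4 * p * B \<le> a" "a < 4 * p * B + n * (4 * B)"
  shows "p \<le> a div (4 * B)" "a div (4 * B) < p + n"
proof -
  have "p * (4 * B) \<le> a" "a < (p + n) * (4 * B)" using assms(2,3) by (simp_all add: algebra_simps)
  then show "p \<le> a div (4 * B)" "a div (4 * B) < p + n"
    using assms(1) by (simp_all add: less_eq_div_iff_mult_less_eq div_less_iff_less_mult)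
qed

lemma page_less: "0 < B \<Longrightarrow> a div (4 * B) < p \<Longrightarrow> a < 4 * B * p" for a :: nat
  by (simp add: div_less_iff_less_mult mult.commute mult.left_commute)

section \<open>The contract of a recursive call\<close>

locale btree_join = fork_join M B W "codes :: nat \<Rightarrow> 'k code" for M :: machine and B W :: nat +
  fixes q f b :: nat and ks :: "'k list" and ops :: "nat list"
  assumes b: "1 \<le> b" "b \<le> B" "length ks = b" "length ops = Suc b" "q + 3 \<le> f"
    and W: "4 * B * Suc (page_limit B f) \<le> W"
begin

abbreviation "D0 \<equiv> {p. 4 * p + 4 \<le> f}"

abbreviation "pg a \<equiv> a div (4 * B)"

definition input_mem :: "'k mem \<Rightarrow> bool" where
  "input_mem m \<longleftrightarrow> mem_ok W m \<and> stored m (q * B) (map Key ks) \<and> stored m ((q + 1) * B) (map Num ops)"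

definition tree_ptr :: "nat \<Rightarrow> nat \<Rightarrow> nat \<Rightarrow> nat \<Rightarrow> nat \<Rightarrow> nat" where
  "tree_ptr lo hi pL pR j = (if j < lo \<or> hi < j then 0 else if j = lo then pL else if j = hi then pR else ops ! j)"

text \<open>\<open>g\<close> bounds all heights from below and determines the cost. \<open>L\<close>
  bounds the number of keys in the root of some tallest tree: 1 in the outermost call, whose roots
  may be underfull, and \<open>B div 2\<close> in all others. The sum \<open>d + h\<close> is the
  same on every level, so \<open>d + h \<le> f\<close> keeps depths in range. The pages of
  \<open>ret\<close> and \<open>cnt\<close> belong to the caller.\<close>

definition call_pre where
  "call_pre m d lo hi pL pR ret cnt h L g X H \<longleftrightarrow>
    input_mem m \<and> lo < hi \<and> hi \<le> b \<and> d + h \<le> f \<and>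
    (\<forall>j. lo \<le> j \<and> j \<le> hi \<longrightarrow> tree_at B m D0 (H j) 1 (tree_ptr lo hi pL pR j) (X j) \<and> g \<le> H j \<and> H j \<le> h) \<and>
    (\<forall>j. j < lo \<or> hi < j \<longrightarrow> H j = 0) \<and>
    (\<exists>j. lo \<le> j \<and> j \<le> hi \<and> H j = h \<and> tree_at B m D0 h L (tree_ptr lo hi pL pR j) (X j)) \<and>
    1 \<le> L \<and> L \<le> B div 2 \<and>
    f \<le> ret \<and> ret \<notin> own B f d lo hi \<and> ret < page_limit B f \<and>
    f \<le> pg cnt \<and> pg cnt \<notin> own B f d lo hi \<and> pg cnt < page_limit B f \<and> pg cnt \<noteq> ret"

text \<open>A root with fewer than \<open>B div 2\<close> keys is tolerated only if the result is a
  single tree; trees that come with a separator must be legal inner nodes.\<close>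

definition call_result :: "'k mem \<Rightarrow> nat set \<Rightarrow> nat \<Rightarrow> nat \<Rightarrow> nat \<Rightarrow> nat \<Rightarrow> (nat \<Rightarrow> 'k list) \<Rightarrow> nat \<Rightarrow> nat \<Rightarrow> bool" where
  "call_result m D h L lo hi X ret cnt \<longleftrightarrow> (\<exists>ks' ps xss. length ps = Suc (length ks') \<and>
     length ps \<le> Suc (hi - lo) \<and> node_at B m ret (Suc h) ks' ps \<and> m cnt = Num (length ks') \<and>
     list_all2 (tree_at B m D h (if ks' = [] then L else B div 2)) ps xss \<and>
     weave xss ks' = weave (map X [lo..<Suc hi]) (map ((!) ks) [lo..<hi]))"

definition call_reads :: "nat \<Rightarrow> nat \<Rightarrow> nat \<Rightarrow> nat set" where
  "call_reads d lo hi = {x. x div 4 < f \<or> x div 4 \<in> own B f d lo hi}"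

text \<open>Only one word of the page of \<open>cnt\<close> is claimed, because parallel calls keep
  their counters on the same page.\<close>

definition call_writes :: "nat \<Rightarrow> nat \<Rightarrow> nat \<Rightarrow> nat \<Rightarrow> nat \<Rightarrow> nat set" where
  "call_writes d lo hi ret cnt = {a. pg a \<in> own B f d lo hi \<or> pg a = ret} \<union> {cnt}"

definition call_spec :: "nat \<Rightarrow> bool" where
  "call_spec h \<longleftrightarrow> (\<forall>m d lo hi pL pR ret cnt L g X H. call_pre m d lo hi pL pR ret cnt h L g X H \<longrightarrow>
    runs M (interp codes) (map Num [2, 0, B, q, f, d, lo, hi, pL, pR, ret, cnt]) m
      (call_reads d lo hi) (call_writes d lo hi ret cnt)
      (160 * (hi - lo) * (Suc h - g)) (160 * (Suc h - g))
      (\<lambda>_ m'. call_result m' (D0 \<union> own B f d lo hi) h L lo hi X ret cnt))"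

text \<open>Race freedom becomes disjointness of two sets of pages, those read and those written.
  The span \<open>36 = 4 * 9\<close> is that of the 9 forks.\<close>

lemma thr_fan_pages:
  assumes r: "rest_ok rest" "t < 4" "mem_ok W m" "arg rest 0 = B" "js rest = js0"
    and len: "length js0 \<le> 9 * B"
    and ok: "\<And>j. j \<in> set js0 \<Longrightarrow> job_ok B W j" and dj: "jobs_disjoint js0"
    and rd: "\<And>x. x \<in> jobs_reads B js0 \<Longrightarrow> x div 4 \<in> PR" and wr: "\<And>a. a \<in> jobs_range js0 \<Longrightarrow> pg a \<in> PW"
    and dis: "PR \<inter> PW = {}"
    and sub: "\<And>x. x div 4 \<in> PR \<Longrightarrow> x \<in> R" "jobs_range js0 \<subseteq> Wr"
    and wk: "4 * length js0 + wk \<le> wk'" and sp: "36 + sp \<le> sp'"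
    and cont: "\<And>m'. mem_ok W m' \<Longrightarrow> jobs_done m js0 m' \<Longrightarrow> thr t is rest m' R Wr wk sp Q"
  shows "thr t (fan 9 js @ is) rest m R Wr wk' sp' Q"
proof -
  have "4 * B * 1 \<le> 4 * B * Suc (page_limit B f)" by (intro mult_left_mono) auto
  then have BW: "2 * B < W" using W B_ge by linarith
  have "thr t (fan 9 js @ is) rest m R Wr (4 * length js0 + wk) (4 * 9 + sp) Q"
  proof (rule thr_fan[where js = js and rest = rest, OF r(1-4)])
    show "(\<lambda>a. a div B) ` jobs_range js0 \<inter> jobs_reads B js0 = {}"
      using rd wr dis page_of_block[of _ B] by fastforce
    show "jobs_reads B js0 \<subseteq> R" using rd sub(1) by blast
  qed (use r len dj ok sub cont BW in auto)
  then show ?thesis by (rule thr_weaken) (use wk sp in auto)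
qed

end

section \<open>One recursive call: scouting the roots\<close>

lemma node_at_iff:
  "node_at B m p h ks ps \<longleftrightarrow> m (4 * p * B) = Num h \<and> m (4 * p * B + 1) = Num (length ks) \<and>
     (\<forall>i<length ks. m (4 * p * B + B + i) = Key (ks ! i)) \<and> (\<forall>i<length ps. m (4 * p * B + 2 * B + i) = Num (ps ! i))"
proof -
  have "(4 * p + 1) * B = 4 * p * B + B" "(4 * p + 2) * B = 4 * p * B + 2 * B" by (simp_all add: algebra_simps)
  then show ?thesis unfolding node_at_def stored_def
    by (simp only:) (auto simp: less_Suc_eq nth_Cons')
qed

lemma concat_upt:
  "jobs_range (concat (map F [a..<n])) = (\<Union>j\<in>{a..<n}. jobs_range (F j))"
  "jobs_reads B (concat (map F [a..<n])) = (\<Union>j\<in>{a..<n}. jobs_reads B (F j))"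
  "set (concat (map F [a..<n])) = (\<Union>j\<in>{a..<n}. set (F j))"
  by auto

locale join_call = btree_join +
  fixes m :: "'a mem" and d lo hi pL pR ret cnt h L g :: nat and X :: "nat \<Rightarrow> 'a list" and H :: "nat \<Rightarrow> nat"
  assumes pre: "call_pre m d lo hi pL pR ret cnt h L g X H"
begin

abbreviation "pt \<equiv> tree_ptr lo hi pL pR"

abbreviation "rg \<equiv> region B f d lo"

abbreviation "T \<equiv> (\<lambda>j. H j = h)"

abbreviation "R \<equiv> call_reads d lo hi"

abbreviation "Wr \<equiv> call_writes d lo hi ret cnt"

lemma pre_facts:
  shows "input_mem m" "mem_ok W m" "lo < hi" "hi \<le> b" "hi \<le> B" "d + h \<le> f" "d \<le> f"
    and trees: "\<And>j. lo \<le> j \<Longrightarrow> j \<le> hi \<Longrightarrow> tree_at B m D0 (H j) 1 (pt j) (X j) \<and> g \<le> H j \<and> H j \<le> h"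
    and H_out: "\<And>j. j < lo \<or> hi < j \<Longrightarrow> H j = 0"
    and tallest: "\<exists>j. lo \<le> j \<and> j \<le> hi \<and> H j = h \<and> tree_at B m D0 h L (pt j) (X j)"
    and L: "1 \<le> L" "L \<le> B div 2"
    and ret: "f \<le> ret" "ret \<notin> own B f d lo hi" "ret < page_limit B f"
    and cnt: "f \<le> pg cnt" "pg cnt \<notin> own B f d lo hi" "pg cnt < page_limit B f" "pg cnt \<noteq> ret"
  using pre b(2) unfolding call_pre_def input_mem_def by auto

lemma W_word: "pg a < page_limit B f \<Longrightarrow> a < W"
proof -
  assume "pg a < page_limit B f"
  then have "a < 4 * B * page_limit B f" by (intro page_less) auto
  also have "\<dots> \<le> 4 * B * Suc (page_limit B f)" by simp
  finally show "a < W" using W by linarith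
qed

lemma W_page: "p \<le> page_limit B f \<Longrightarrow> p < W"
proof -
  assume "p \<le> page_limit B f"
  moreover have "Suc (page_limit B f) * 1 \<le> Suc (page_limit B f) * (4 * B)" using B_ge by (intro mult_left_mono) auto
  ultimately show ?thesis using W by (simp add: mult.commute)
qed

lemma f_limit: "f < page_limit B f"
  unfolding page_limit_def region_size_def by simp

lemma B_limit: "2 * B \<le> page_limit B f"
proof -
  have "1 * 1 * (4 * B) \<le> Suc f * Suc B * region_size B" unfolding region_size_def by (intro mult_le_mono) auto
  then show ?thesis unfolding page_limit_def by linarith
qed

lemma W_old: "pg a \<le> f \<Longrightarrow> a < W"
  using f_limit by (intro W_word) simp

lemma rg_own: "i < region_size B \<Longrightarrow> rg + i \<in> own B f d lo hi"
  using pre_facts by (intro region_own) auto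

lemma rg_limit: "i < region_size B \<Longrightarrow> rg + i < page_limit B f"
  using rg_own own_lt by blast

lemma rg_ge: "f \<le> rg"
  unfolding region_def by simp

lemma rg_not_deeper: "i < region_size B \<Longrightarrow> rg + i \<notin> own B f (Suc d) lo' hi'"
  using pre_facts by (intro region_not_own) auto

text \<open>Basis for fixing one decomposition of every root of positive height, so that all phases
  refer to the same keys, pointers and traversals.\<close>

definition root_data :: "nat \<Rightarrow> 'a list \<times> nat list \<times> 'a list list \<Rightarrow> bool" where
  "root_data j t \<longleftrightarrow> (case t of (rk, rp, rx) \<Rightarrow> rk \<noteq> [] \<and> length rk \<le> B \<and> length rp = Suc (length rk) \<and>
     node_at B m (pt j) (H j) rk rp \<and> X j = weave rx rk \<and> list_all2 (tree_at B m D0 (H j - 1) (B div 2)) rp rx)"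

definition "rk j = fst (SOME t. root_data j t)"
definition "rp j = fst (snd (SOME t. root_data j t))"
definition "rx j = snd (snd (SOME t. root_data j t))"

lemma root:
  assumes "lo \<le> j" "j \<le> hi" "H j \<noteq> 0"
  shows "rk j \<noteq> []" "length (rk j) \<le> B" "length (rp j) = Suc (length (rk j))"
    "node_at B m (pt j) (H j) (rk j) (rp j)" "X j = weave (rx j) (rk j)"
    "list_all2 (tree_at B m D0 (H j - 1) (B div 2)) (rp j) (rx j)" "pt j \<noteq> 0" "pt j \<in> D0"
proof -
  obtain h' where h': "H j = Suc h'" using assms by (cases "H j") auto
  with trees[OF assms(1,2)] have t: "tree_at B m D0 (Suc h') 1 (pt j) (X j)" by simp
  then show "pt j \<noteq> 0" "pt j \<in> D0" by auto
  from t obtain ks ps xss where "1 \<le> length ks" "length ks \<le> B" "length ps = Suc (length ks)"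
     "length xss = length ps" "node_at B m (pt j) (Suc h') ks ps" "X j = weave xss ks"
      "\<And>i. i<length ps \<Longrightarrow> tree_at B m D0 h' (B div 2) (ps ! i) (xss ! i)" by auto
  then have "root_data j (ks, ps, xss)"
    unfolding root_data_def h' by (auto simp: list_all2_conv_all_nth)
  then have "root_data j (SOME t. root_data j t)" by (rule someI)
  then have "root_data j (rk j, rp j, rx j)" unfolding rk_def rp_def rx_def by simp
  then show "rk j \<noteq> []" "length (rk j) \<le> B" "length (rp j) = Suc (length (rk j))"
    "node_at B m (pt j) (H j) (rk j) (rp j)" "X j = weave (rx j) (rk j)"
    "list_all2 (tree_at B m D0 (H j - 1) (B div 2)) (rp j) (rx j)"
    unfolding root_data_def by simp_all
qed

lemma pt_0: "pt j = 0 \<longleftrightarrow> H j = 0"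
proof (cases "lo \<le> j \<and> j \<le> hi")
  case True
  then show ?thesis using trees[of j] root(7)[of j] by (cases "H j") auto
next
  case False then show ?thesis using H_out[of j] unfolding tree_ptr_def by auto
qed

lemma pt_le: "lo \<le> j \<Longrightarrow> j \<le> hi \<Longrightarrow> 4 * pt j \<le> f"
  using root(8)[of j] pt_0[of j] by (cases "H j = 0") auto

text \<open>The number of keys is recorded in the header and thus the same in every decomposition of
  the root, so the bound \<open>L\<close> transfers to the chosen \<open>rk\<close>.\<close>

lemma tallest_keys:
  assumes "h \<noteq> 0"
  shows "\<exists>j. lo \<le> j \<and> j \<le> hi \<and> H j = h \<and> L \<le> length (rk j)"
proof -
  obtain j where j: "lo \<le> j" "j \<le> hi" "H j = h" "tree_at B m D0 h L (pt j) (X j)" using tallest by blast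
  obtain h' where h': "h = Suc h'" using assms by (cases h) auto
  from j(4) obtain ks ps where "L \<le> length ks" "node_at B m (pt j) h ks ps" unfolding h' by auto
  moreover have "node_at B m (pt j) h (rk j) (rp j)" using root(4)[of j] j assms by simp
  ultimately have "L \<le> length (rk j)" unfolding node_at_iff by auto
  then show ?thesis using j by blast
qed

abbreviation "rest0 \<equiv> map Num [B, q, f, d, lo, hi, pL, pR, ret, cnt] :: 'a word list"

abbreviation "rest1 \<equiv> rest0 @ map m [(q + 1) * B..<(q + 1 + 2) * B]"

lemma rest0_ok: "rest_ok rest0"
proof (rule rest_ok_map_Num)
  have "4 * pt lo \<le> f" "4 * pt hi \<le> f" using pt_le pre_facts by auto
  then have "pL \<le> f" "pR \<le> f" using pre_facts(3) by (auto simp: tree_ptr_def)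
  then show "\<forall>a\<in>set [B, q, f, d, lo, hi, pL, pR, ret, cnt]. a < W"
    using pre_facts ret(3) cnt(3) f_limit B_limit b(5) W_word[of cnt] by (auto intro!: W_page)
qed (use B_ge in auto)

lemma args_rest1:
  "arg (rest1 @ ys) 0 = B" "arg (rest1 @ ys) 1 = q" "arg (rest1 @ ys) 2 = f" "arg (rest1 @ ys) 3 = d"
  "arg (rest1 @ ys) 4 = lo" "arg (rest1 @ ys) 5 = hi" "arg (rest1 @ ys) 6 = pL" "arg (rest1 @ ys) 7 = pR"
  "arg (rest1 @ ys) 8 = ret" "arg (rest1 @ ys) 9 = cnt"
  by (simp_all add: nth_Cons')

lemma region_rest1: "call_region (rest1 @ ys) = rg"
  unfolding call_region_def args_rest1 by simp

lemma ptr_rest1: "call_ptr (rest1 @ ys) = pt"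
proof
  fix j
  have "arg (rest1 @ ys) (10 + j) = ops ! j" if "lo < j" "j < hi"
  proof -
    have j: "j < 2 * B" "j < length ops" using that pre_facts b by auto
    have e: "(q + 1 + 2) * B = (q + 1) * B + 2 * B" by (simp add: algebra_simps)
    have l: "length rest0 = 10" by simp
    have "rest1 ! (10 + j) = m ((q + 1) * B + j)"
      using map_upt_nth[OF j(1), of rest0 m "(q + 1) * B"] unfolding e l .
    also have "\<dots> = Num (ops ! j)" using pre_facts(1) j(2) unfolding input_mem_def stored_def by simp
    finally show ?thesis using j by (simp add: nth_append)
  qed
  then show "call_ptr (rest1 @ ys) j = pt j"
    unfolding call_ptr_def tree_ptr_def args_rest1 by auto
qed

abbreviation "slot j \<equiv> 4 * rg * B + 4 * (j - lo)"

lemma slot_page: "lo \<le> j \<Longrightarrow> j \<le> hi \<Longrightarrow> i < 4 \<Longrightarrow> pg (slot j + i) \<in> {rg, rg + 1}"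
  using page_interval[of B rg "slot j + i" 2] pre_facts B_ge by fastforce

lemma slot_disjoint: "lo \<le> i \<Longrightarrow> i < j \<Longrightarrow> slot i + 4 \<le> slot j"
  by simp

lemma info_rest:
  assumes "length xs = 10 + n * B" "xs = rest1 @ zs" "i < 4"
    "\<And>j. lo \<le> j \<Longrightarrow> j \<le> hi \<Longrightarrow> H j \<noteq> 0 \<Longrightarrow> m' (slot j + i) = Num (v j)"
  shows "call_info n i ((xs @ map m' [4 * rg * B..<(4 * rg + 6) * B]) @ ys) = (\<lambda>j. if H j = 0 then 0 else v j)"
proof
  fix j
  have e: "(xs @ map m' [4 * rg * B..<(4 * rg + 6) * B]) @ ys = rest1 @ (zs @ map m' [4 * rg * B..<(4 * rg + 6) * B]) @ ys"
    using assms(2) by simp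
  have "arg ((xs @ map m' [4 * rg * B..<(4 * rg + 6) * B]) @ ys) (10 + n * B + 4 * (j - lo) + i) = v j"
    if j: "H j \<noteq> 0"
  proof -
    have j': "lo \<le> j" "j \<le> hi" using j H_out[of j] by (auto simp: not_less[symmetric])
    then have l: "4 * (j - lo) + i < 6 * B" using assms(3) pre_facts B_ge by linarith
    have e: "(4 * rg + 6) * B = 4 * rg * B + 6 * B" by (simp add: algebra_simps)
    have k: "10 + n * B + 4 * (j - lo) + i = length xs + (4 * (j - lo) + i)" using assms(1) by simp
    have "(xs @ map m' [4 * rg * B..<(4 * rg + 6) * B]) ! (length xs + (4 * (j - lo) + i)) = m' (slot j + i)"
      using map_upt_nth[OF l, of xs m' "4 * rg * B"] unfolding e by (simp only: add.assoc)
    moreover have "length xs + (4 * (j - lo) + i) < length (xs @ map m' [4 * rg * B..<(4 * rg + 6) * B])"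
      using l unfolding e by simp
    ultimately show ?thesis unfolding k using assms(4)[OF j' j] by (simp only: nth_append if_True num_of.simps)
  qed
  then show "call_info n i ((xs @ map m' [4 * rg * B..<(4 * rg + 6) * B]) @ ys) j = (if H j = 0 then 0 else v j)"
    unfolding call_info_def unfolding e args_rest1 ptr_rest1 pt_0 by simp
qed

text \<open>A copy reads two blocks and may run into page \<open>p + 1\<close>. That page is still
  below \<open>f\<close>, because \<open>4 * p \<le> f\<close> and \<open>3 \<le> f\<close>.\<close>

lemma old_read:
  assumes "4 * p \<le> f" "x \<in> job_reads B (Copy s n t)" "s = 4 * p * B + y" "y < 4 * B"
  shows "x div 4 < f"
proof -
  have "p \<le> pg s" "pg s < p + 1" using page_interval[of B p s 1] assms by auto
  moreover have "p \<le> pg (s + B)" "pg (s + B) < p + 2" using page_interval[of B p "s + B" 2] assms B_ge by auto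
  moreover have "x div 4 = pg s \<or> x div 4 = pg (s + B)" using job_reads_page[of B x s n t] assms by auto
  moreover have "p + 1 < f" using assms(1) b(5) by linarith
  ultimately show ?thesis by linarith
qed

abbreviation "rest2 m1 \<equiv> rest1 @ map m1 [4 * rg * B..<(4 * rg + 6) * B]"

abbreviation "rest3 m1 m2 \<equiv> rest2 m1 @ map m2 [4 * rg * B..<(4 * rg + 6) * B]"

lemma scratch_subset: "{rg, rg + 1} \<subseteq> own B f d lo hi"
  using rg_own[of 0] rg_own[of 1] unfolding region_size_def by auto

lemma in_R: "x div 4 < f \<Longrightarrow> x \<in> R" "x div 4 \<in> own B f d lo hi \<Longrightarrow> x \<in> R"
  unfolding call_reads_def by auto

lemma in_Wr: "pg a \<in> own B f d lo hi \<Longrightarrow> a \<in> Wr"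
  unfolding call_writes_def by auto

lemma node_reads:
  assumes "4 * p + 4 \<le> f" "x \<in> job_reads B (Copy (4 * p * B + y) n t)" "y < 4 * B"
  shows "x div 4 < f"
  using old_read[of p x "4 * p * B + y" n t y] assms by simp

lemma phase1:
  assumes "rest_ok rest1"
    and cont: "\<And>m1. \<lbrakk>mem_ok W m1; \<And>a. pg a \<notin> {rg, rg + 1} \<Longrightarrow> m1 a = m a;
       \<And>j. \<lbrakk>lo \<le> j; j \<le> hi; H j \<noteq> 0\<rbrakk> \<Longrightarrow> m1 (slot j) = Num (H j) \<and> m1 (slot j + 1) = Num (length (rk j)) \<and>
          m1 (slot j + 2) = Num (hd (rp j))\<rbrakk> \<Longrightarrow> thr 2 is rest1 m1 R Wr wk sp Q"
  shows "thr 2 (fan 9 (\<lambda>rest. jobs1 (arg rest 0) (call_region rest) (arg rest 4) (arg rest 5) (call_ptr rest)) @ is)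
     rest1 m R Wr (8 * Suc (hi - lo) + wk) (36 + sp) Q"
proof -
  let ?js = "jobs1 B rg lo hi pt"
  define F where "F = (\<lambda>j. if pt j = 0 then [] else
     [Copy (4 * pt j * B) 2 (slot j), Copy (4 * pt j * B + 2 * B) 1 (slot j + 2)])"
  have js: "?js = concat (map F [lo..<Suc hi])" unfolding jobs1_def F_def by simp
  have len: "length ?js \<le> 2 * Suc (hi - lo)"
    using length_concat_map_le[of "[lo..<Suc hi]" F 2] pre_facts(3) unfolding js F_def by (simp add: Suc_diff_le)
  have lo_hi: "lo \<le> hi" using pre_facts(3) by simp
  have Frng: "jobs_range (F j) \<subseteq> {slot j..<slot j + 4}" for j
    unfolding F_def by auto
  have rng: "pg a \<in> {rg, rg + 1}" if a: "a \<in> jobs_range ?js" for a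
  proof -
    obtain j where j: "j \<in> {lo..<Suc hi}" "a \<in> jobs_range (F j)" using a unfolding js concat_upt by auto
    then have "slot j \<le> a" "a < slot j + 4" using subsetD[OF Frng j(2)] by simp_all
    then have "a - slot j < 4" "slot j + (a - slot j) = a" by auto
    then show ?thesis using slot_page[of j "a - slot j"] j by auto
  qed
  show ?thesis
  proof (rule thr_fan_pages[where ?js0.0 = ?js and PR = "{..<f}" and PW = "{rg, rg + 1}" and wk = wk and sp = sp])
    show "arg rest1 0 = B" using args_rest1(1)[of "[]"] by simp
    show "jobs1 (arg rest1 0) (call_region rest1) (arg rest1 4) (arg rest1 5) (call_ptr rest1) = ?js"
      using args_rest1[of "[]"] region_rest1[of "[]"] ptr_rest1[of "[]"] by simp
    show "length ?js \<le> 9 * B" using len pre_facts(3,5) B_ge by simp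
    show "job_ok B W j'" if j': "j' \<in> set ?js" for j'
    proof -
      obtain j where j: "j \<in> {lo..<Suc hi}" "j' \<in> set (F j)" using j' unfolding js concat_upt by auto
      then have pj: "pt j \<noteq> 0" unfolding F_def by (auto split: if_splits)
      then have p: "4 * pt j + 4 \<le> f" using root(8)[of j] pt_0[of j] j by auto
      have s: "slot j + i < W" if "i < 4" for i
        using slot_page[of j i] that rg_limit[of 0] rg_limit[of 1] j by (intro W_word) (auto simp: region_size_def)
      have o: "4 * pt j * B + x < W" if "x < 4 * B" for x
      proof (rule W_old)
        have "pg (4 * pt j * B + x) < pt j + 1" using that by (intro page_interval(2)) auto
        then show "pg (4 * pt j * B + x) \<le> f" using p by linarith
      qed
      show ?thesis using j(2) pj B_ge o[of 0] o[of "2 * B"] s[of 0] s[of 2] unfolding F_def by auto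
    qed
    show "jobs_disjoint ?js" unfolding js
    proof (rule jobs_disjoint_concat)
      show "jobs_disjoint (F i)" for i unfolding F_def by auto
      show "jobs_range (F i) \<inter> jobs_range (F j) = {}" if "lo \<le> i" "i < j" "j < Suc hi" for i j
        using Frng[of i] Frng[of j] slot_disjoint[OF that(1,2)] by fastforce
    qed
    show "x div 4 \<in> {..<f}" if x: "x \<in> jobs_reads B ?js" for x
    proof -
      obtain j where j: "j \<in> {lo..<Suc hi}" "x \<in> jobs_reads B (F j)" using x unfolding js concat_upt by auto
      then have pj: "pt j \<noteq> 0" unfolding F_def by (auto split: if_splits)
      then have p: "4 * pt j + 4 \<le> f" using root(8)[of j] pt_0[of j] j by auto
      show ?thesis
        using j(2) pj node_reads[OF p, of x 0 2 "slot j"] node_reads[OF p, of x "2 * B" 1 "slot j + 2"]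
        unfolding F_def jobs_reads_def by auto
    qed
    show "{..<f} \<inter> {rg, rg + 1} = {}" using rg_ge by auto
    show "jobs_range ?js \<subseteq> Wr" using rng scratch_subset in_Wr by blast
    show "4 * length ?js + wk \<le> 8 * Suc (hi - lo) + wk" using len by simp
    fix m1 assume m1: "mem_ok W m1" "jobs_done m ?js m1"
    show "thr 2 is rest1 m1 R Wr wk sp Q"
    proof (rule cont[OF m1(1)])
      show "m1 a = m a" if "pg a \<notin> {rg, rg + 1}" for a
        using m1(2) rng that unfolding jobs_done_def by blast
      fix j assume j: "lo \<le> j" "j \<le> hi" "H j \<noteq> 0"
      then have p: "pt j \<noteq> 0" using pt_0 by simp
      have d1: "job_done m (Copy (4 * pt j * B) 2 (slot j)) m1"
        by (rule jobs_done_concat[OF m1(2)[unfolded js], of j]) (use j p in \<open>auto simp: F_def\<close>)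
      have d2: "job_done m (Copy (4 * pt j * B + 2 * B) 1 (slot j + 2)) m1"
        by (rule jobs_done_concat[OF m1(2)[unfolded js], of j]) (use j p in \<open>auto simp: F_def\<close>)
      have e: "\<And>i. i < 2 \<Longrightarrow> m1 (slot j + i) = m (4 * pt j * B + i)" "m1 (slot j + 2) = m (4 * pt j * B + 2 * B)"
        using d1 d2 by simp_all
      have "rp j \<noteq> []" using root(3)[OF j] by auto
      then show "m1 (slot j) = Num (H j) \<and> m1 (slot j + 1) = Num (length (rk j)) \<and> m1 (slot j + 2) = Num (hd (rp j))"
        using e(1)[of 0] e(1)[of 1] e(2) root(4)[OF j] unfolding node_at_iff by (auto simp: hd_conv_nth)
    qed
  qed (use assms(1) pre_facts(2) rng in_R(1) in simp_all)
qed

lemma phase2: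
  assumes m1: "mem_ok W m1" "\<And>a. pg a \<notin> {rg, rg + 1} \<Longrightarrow> m1 a = m a"
       "\<And>j. \<lbrakk>lo \<le> j; j \<le> hi; H j \<noteq> 0\<rbrakk> \<Longrightarrow> m1 (slot j) = Num (H j) \<and> m1 (slot j + 1) = Num (length (rk j)) \<and>
          m1 (slot j + 2) = Num (hd (rp j))"
    and "rest_ok (rest2 m1)"
    and cont: "\<And>m2. \<lbrakk>mem_ok W m2; \<And>a. pg a \<notin> {rg, rg + 1} \<Longrightarrow> m2 a = m a;
       \<And>j. \<lbrakk>lo \<le> j; j \<le> hi; H j \<noteq> 0\<rbrakk> \<Longrightarrow> m2 (slot j) = Num (H j) \<and> m2 (slot j + 1) = Num (length (rk j)) \<and>
          m2 (slot j + 2) = Num (hd (rp j)) \<and> m2 (slot j + 3) = Num (last (rp j))\<rbrakk> \<Longrightarrow> thr 2 is (rest2 m1) m2 R Wr wk sp Q"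
  shows "thr 2 (fan 9 (\<lambda>rest. jobs2 (arg rest 0) (call_region rest) (arg rest 4) (arg rest 5) (call_ptr rest) (call_info 2 1 rest)) @ is)
     (rest2 m1) m1 R Wr (4 * Suc (hi - lo) + wk) (36 + sp) Q"
proof -
  define nk where "nk = (\<lambda>j. if H j = 0 then 0 else length (rk j))"
  let ?js = "jobs2 B rg lo hi pt nk"
  define F where "F = (\<lambda>j. if pt j = 0 then [] else
     [Copy (4 * pt j * B + 2 * B + nk j) 1 (slot j + 3)])"
  have js: "?js = concat (map F [lo..<Suc hi])" unfolding jobs2_def F_def by simp
  have len: "length ?js \<le> 1 * Suc (hi - lo)"
    using length_concat_map_le[of "[lo..<Suc hi]" F 1] pre_facts(3) unfolding js F_def by (simp add: Suc_diff_le)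
  have Frng: "jobs_range (F j) \<subseteq> {slot j + 3}" for j
    unfolding F_def by auto
  have rng: "pg a \<in> {rg, rg + 1}" if a: "a \<in> jobs_range ?js" for a
  proof -
    obtain j where j: "j \<in> {lo..<Suc hi}" "a \<in> jobs_range (F j)" using a unfolding js concat_upt by auto
    then have "a = slot j + 3" using subsetD[OF Frng] by blast
    then show ?thesis using slot_page[of j 3] j by auto
  qed
  have nk: "call_info 2 1 (rest2 m1) = nk"
    using info_rest[of rest1 2 "[]" 1 m1 "\<lambda>j. length (rk j)" "[]"] m1(3) unfolding nk_def by (simp add: algebra_simps)
  have nkB: "nk j \<le> B" if "lo \<le> j" "j \<le> hi" for j using root(2)[of j] that unfolding nk_def by auto
  show ?thesis
  proof (rule thr_fan_pages[where ?js0.0 = ?js and PR = "{..<f}" and PW = "{rg, rg + 1}" and wk = wk and sp = sp])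
    show "arg (rest2 m1) 0 = B" using args_rest1(1) by simp
    show "jobs2 (arg (rest2 m1) 0) (call_region (rest2 m1)) (arg (rest2 m1) 4) (arg (rest2 m1) 5) (call_ptr (rest2 m1)) (call_info 2 1 (rest2 m1)) = ?js"
      using args_rest1 region_rest1 ptr_rest1 nk by simp
    show "length ?js \<le> 9 * B" using len pre_facts(3,5) B_ge by simp
    show "job_ok B W j'" if j': "j' \<in> set ?js" for j'
    proof -
      obtain j where j: "j \<in> {lo..<Suc hi}" "j' \<in> set (F j)" using j' unfolding js concat_upt by auto
      then have pj: "pt j \<noteq> 0" unfolding F_def by (auto split: if_splits)
      then have p: "4 * pt j + 4 \<le> f" using root(8)[of j] pt_0[of j] j by auto
      have s: "slot j + 3 < W"
        using slot_page[of j 3] rg_limit[of 0] rg_limit[of 1] j by (intro W_word) (auto simp: region_size_def)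
      have o: "4 * pt j * B + (2 * B + nk j) < W"
      proof (rule W_old)
        have "pg (4 * pt j * B + (2 * B + nk j)) < pt j + 1" using nkB[of j] j B_ge by (intro page_interval(2)) auto
        then show "pg (4 * pt j * B + (2 * B + nk j)) \<le> f" using p by linarith
      qed
      show ?thesis using j(2) pj B_ge o s unfolding F_def by (auto simp: add.assoc)
    qed
    show "jobs_disjoint ?js" unfolding js
    proof (rule jobs_disjoint_concat)
      show "jobs_disjoint (F i)" for i unfolding F_def by auto
      show "jobs_range (F i) \<inter> jobs_range (F j) = {}" if "lo \<le> i" "i < j" "j < Suc hi" for i j
        using Frng[of i] Frng[of j] slot_disjoint[OF that(1,2)] by fastforce
    qed
    show "x div 4 \<in> {..<f}" if x: "x \<in> jobs_reads B ?js" for x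
    proof -
      obtain j where j: "j \<in> {lo..<Suc hi}" "x \<in> jobs_reads B (F j)" using x unfolding js concat_upt by auto
      then have pj: "pt j \<noteq> 0" unfolding F_def by (auto split: if_splits)
      then have p: "4 * pt j + 4 \<le> f" using root(8)[of j] pt_0[of j] j by auto
      have "x \<in> job_reads B (Copy (4 * pt j * B + (2 * B + nk j)) 1 (slot j + 3))"
        using j(2) pj unfolding F_def jobs_reads_def by (auto simp: add.assoc)
      from node_reads[OF p this] show ?thesis using nkB[of j] j B_ge by simp
    qed
    show "{..<f} \<inter> {rg, rg + 1} = {}" using rg_ge by auto
    show "jobs_range ?js \<subseteq> Wr" using rng scratch_subset in_Wr by blast
    show "4 * length ?js + wk \<le> 4 * Suc (hi - lo) + wk" using len by simp
    fix m2 assume m2: "mem_ok W m2" "jobs_done m1 ?js m2"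
    show "thr 2 is (rest2 m1) m2 R Wr wk sp Q"
    proof (rule cont[OF m2(1)])
      show "m2 a = m a" if "pg a \<notin> {rg, rg + 1}" for a
        using m2(2) m1(2) rng that unfolding jobs_done_def by metis
      fix j assume j: "lo \<le> j" "j \<le> hi" "H j \<noteq> 0"
      then have p: "pt j \<noteq> 0" using pt_0 by simp
      \<comment> \<open>This round writes only word 3 of each slot, and the slots are 4 words
        apart.\<close>
      have same: "m2 (slot j + i) = m1 (slot j + i)" if i: "i < 3" for i
      proof -
        have "slot j + i \<notin> jobs_range ?js"
        proof
          assume "slot j + i \<in> jobs_range ?js"
          then obtain j' where j': "j' \<in> {lo..<Suc hi}" "slot j + i \<in> jobs_range (F j')" unfolding js concat_upt by auto
          then have "slot j + i = slot j' + 3" using subsetD[OF Frng] by blast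
          then show False using slot_disjoint[of j j'] slot_disjoint[of j' j] j j' i
            by (cases j j' rule: linorder_cases) auto
        qed
        then show ?thesis using m2(2) unfolding jobs_done_def by blast
      qed
      have "job_done m1 (Copy (4 * pt j * B + 2 * B + nk j) 1 (slot j + 3)) m2"
        by (rule jobs_done_concat[OF m2(2)[unfolded js], of j], use j p in \<open>auto simp: F_def\<close>)
      then have e: "m2 (slot j + 3) = m1 (4 * pt j * B + 2 * B + nk j)" by auto
      have "pg (4 * pt j * B + (2 * B + nk j)) < pt j + 1" using nkB[of j] j B_ge by (intro page_interval(2)) auto
      then have "pg (4 * pt j * B + 2 * B + nk j) \<notin> {rg, rg + 1}" using root(8)[OF j] rg_ge by (auto simp: add.assoc)
      then have "m2 (slot j + 3) = m (4 * pt j * B + 2 * B + nk j)" using m1(2) e by simp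
      also have "\<dots> = Num (rp j ! nk j)" using root(3,4)[OF j] j unfolding node_at_iff nk_def by simp
      also have "rp j ! nk j = last (rp j)" using root(3)[OF j] j(3) unfolding nk_def
          by (cases "rp j" rule: rev_cases) (auto simp: nth_append)
      finally show "m2 (slot j) = Num (H j) \<and> m2 (slot j + 1) = Num (length (rk j)) \<and>
          m2 (slot j + 2) = Num (hd (rp j)) \<and> m2 (slot j + 3) = Num (last (rp j))"
        using same[of 0] same[of 1] same[of 2] m1(3)[OF j] by simp
    qed
  qed (use assms(4) m1(1) rng in_R(1) in simp_all)
qed

definition "nkeys j = (if H j = 0 then 0 else length (rk j))"
definition "first_child j = (if H j = 0 then 0 else hd (rp j))"
definition "last_child j = (if H j = 0 then 0 else last (rp j))"

lemma Max_H: "Max (H ` {lo..hi}) = h"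
proof -
  obtain j where "lo \<le> j" "j \<le> hi" "H j = h" using tallest by blast
  then show ?thesis using trees by (intro Max_eqI) auto
qed

text \<open>The decoded values are stated for every \<open>rest @ ys\<close> because another block
  is appended before they are used again. There are \<open>14 = 2 + 6 + 6\<close> reads by the
  coordinator itself, \<open>12 = 8 + 4\<close> units of work per tree for the two rounds of copies,
  and \<open>86 = 14 + 2 * 36\<close> of span.\<close>

lemma scouting:
  assumes cont: "\<And>rest m2. \<lbrakk>mem_ok W m2; \<And>a. pg a \<notin> {rg, rg + 1} \<Longrightarrow> m2 a = m a;
      rest_ok rest; length rest = 10 + 14 * B; \<And>ys. \<exists>zs. rest @ ys = rest1 @ zs;
      \<And>ys. call_height (rest @ ys) = h; \<And>ys. call_tall (rest @ ys) = T;
      \<And>ys. call_info 8 1 (rest @ ys) = nkeys; \<And>ys. call_info 8 2 (rest @ ys) = first_child;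
      \<And>ys. call_info 8 3 (rest @ ys) = last_child\<rbrakk> \<Longrightarrow> thr 2 call_code2 rest m2 R Wr wk sp Q"
  shows "thr 2 call_code rest0 m R Wr (14 + 12 * Suc (hi - lo) + wk) (86 + sp) Q"
proof -
  have sub: "{q + 1..<q + 1 + 2} \<subseteq> R"
  proof
    fix x assume "x \<in> {q + 1..<q + 1 + 2}"
    then have "x < f" using b(5) by auto
    then have "x div 4 < f" by (metis div_le_dividend le_less_trans)
    then show "x \<in> R" by (rule in_R)
  qed
  have sub2: "{4 * rg..<4 * rg + 6} \<subseteq> R"
  proof
    fix x assume "x \<in> {4 * rg..<4 * rg + 6}"
    then have "x div 4 = rg \<or> x div 4 = rg + 1" by auto
    then show "x \<in> R" using scratch_subset by (intro in_R(2)) auto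
  qed
  let ?is4 = "read_blocks 6 (\<lambda>rest. 4 * call_region rest) @ call_code2"
  let ?is3 = "fan 9 (\<lambda>rest. jobs2 (arg rest 0) (call_region rest) (arg rest 4) (arg rest 5) (call_ptr rest) (call_info 2 1 rest)) @ ?is4"
  let ?is2 = "read_blocks 6 (\<lambda>rest. 4 * call_region rest) @ ?is3"
  let ?is1 = "fan 9 (\<lambda>rest. jobs1 (arg rest 0) (call_region rest) (arg rest 4) (arg rest 5) (call_ptr rest)) @ ?is2"
  have "thr 2 (read_blocks 2 (\<lambda>rest. arg rest 1 + 1) @ ?is1) rest0 m R Wr
     (2 + (8 * Suc (hi - lo) + (6 + (4 * Suc (hi - lo) + (6 + wk))))) (2 + (36 + (6 + (36 + (6 + sp))))) Q"
  proof (rule thr_read_blocks[where j = "q + 1"])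
    assume r1: "rest_ok (rest0 @ map m [(q + 1) * B..<(q + 1 + 2) * B])"
    show "thr 2 ?is1 (rest0 @ map m [(q + 1) * B..<(q + 1 + 2) * B]) m R Wr
      (8 * Suc (hi - lo) + (6 + (4 * Suc (hi - lo) + (6 + wk)))) (36 + (6 + (36 + (6 + sp)))) Q"
    proof (rule phase1[OF r1])
      fix m1 assume m1: "mem_ok W m1" "\<And>a. pg a \<notin> {rg, rg + 1} \<Longrightarrow> m1 a = m a"
        "\<And>j. \<lbrakk>lo \<le> j; j \<le> hi; H j \<noteq> 0\<rbrakk> \<Longrightarrow> m1 (slot j) = Num (H j) \<and> m1 (slot j + 1) = Num (length (rk j)) \<and>
          m1 (slot j + 2) = Num (hd (rp j))"
      show "thr 2 ?is2 rest1 m1 R Wr (6 + (4 * Suc (hi - lo) + (6 + wk))) (6 + (36 + (6 + sp))) Q"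
      proof (rule thr_read_blocks[where j = "4 * rg"])
        assume r2: "rest_ok (rest2 m1)"
        show "thr 2 ?is3 (rest2 m1) m1 R Wr (4 * Suc (hi - lo) + (6 + wk)) (36 + (6 + sp)) Q"
        proof (rule phase2[OF m1 r2])
          fix m2 assume m2: "mem_ok W m2" "\<And>a. pg a \<notin> {rg, rg + 1} \<Longrightarrow> m2 a = m a"
             "\<And>j. \<lbrakk>lo \<le> j; j \<le> hi; H j \<noteq> 0\<rbrakk> \<Longrightarrow> m2 (slot j) = Num (H j) \<and> m2 (slot j + 1) = Num (length (rk j)) \<and>
                m2 (slot j + 2) = Num (hd (rp j)) \<and> m2 (slot j + 3) = Num (last (rp j))"
          show "thr 2 ?is4 (rest2 m1) m2 R Wr (6 + wk) (6 + sp) Q"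
          proof (rule thr_read_blocks[where j = "4 * rg"])
            assume r3: "rest_ok (rest3 m1 m2)"
            have l: "length (rest2 m1) = 10 + 8 * B" by (simp add: algebra_simps)
            have e: "(rest3 m1 m2) @ ys = rest1 @ (map m1 [4 * rg * B..<(4 * rg + 6) * B] @ map m2 [4 * rg * B..<(4 * rg + 6) * B] @ ys)" for ys
              by simp
            have i0: "call_info 8 0 ((rest3 m1 m2) @ ys) = H" for ys
              using info_rest[of "rest2 m1" 8 "map m1 [4 * rg * B..<(4 * rg + 6) * B]" 0 m2 H ys] m2(3) l by auto
            have ch: "call_height ((rest3 m1 m2) @ ys) = h" for ys
              unfolding call_height_def i0 unfolding e args_rest1 by (rule Max_H)
            show "thr 2 call_code2 (rest3 m1 m2) m2 R Wr wk sp Q"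
            proof (rule cont[OF m2(1,2) r3])
              show "length (rest3 m1 m2) = 10 + 14 * B" by (simp add: algebra_simps)
              show "call_height ((rest3 m1 m2) @ ys) = h" for ys by (rule ch)
              show "call_tall ((rest3 m1 m2) @ ys) = T" for ys unfolding call_tall_def ch i0 by simp
              show "call_info 8 1 ((rest3 m1 m2) @ ys) = nkeys" for ys
                unfolding nkeys_def
                by (rule info_rest[of "rest2 m1" 8 "map m1 [4 * rg * B..<(4 * rg + 6) * B]"]) (use m2(3) l in auto)
              show "call_info 8 2 ((rest3 m1 m2) @ ys) = first_child" for ys
                unfolding first_child_def
                by (rule info_rest[of "rest2 m1" 8 "map m1 [4 * rg * B..<(4 * rg + 6) * B]"]) (use m2(3) l in auto)
              show "call_info 8 3 ((rest3 m1 m2) @ ys) = last_child" for ys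
                unfolding last_child_def
                by (rule info_rest[of "rest2 m1" 8 "map m1 [4 * rg * B..<(4 * rg + 6) * B]"]) (use m2(3) l in auto)
              show "\<exists>zs. (rest3 m1 m2) @ ys = rest1 @ zs" for ys unfolding e by blast
            qed simp
          next
            show "4 * call_region (rest2 m1 @ ys) = 4 * rg" for ys using region_rest1 by simp
            show "length (rest2 m1) + 6 * B \<le> 62 * B" using B_ge by (simp add: algebra_simps)
          qed (use r2 m2 sub2 in auto)
        qed simp_all
      next
        show "4 * call_region (rest1 @ ys) = 4 * rg" for ys using region_rest1 by simp
        show "length rest1 + 6 * B \<le> 62 * B" using B_ge by (simp add: algebra_simps)
      qed (use r1 m1 sub2 in auto)
    qed
  next
    show "arg (rest0 @ ys) 1 + 1 = q + 1" for ys by simp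
    show "length rest0 + 2 * B \<le> 62 * B" using B_ge by simp
  qed (use rest0_ok pre_facts sub in auto)
  then show ?thesis unfolding call_code_def by (rule thr_weaken) simp_all
qed

end

section \<open>One recursive call: the groups\<close>

lemma group_end:
  assumes "group_start T lo hi s"
  shows "lo \<le> s" "s < hi" "s < next_tall T hi (Suc s)" "next_tall T hi (Suc s) \<le> hi"
    "T (next_tall T hi (Suc s)) \<or> next_tall T hi (Suc s) = hi"
    "\<And>j. s < j \<Longrightarrow> j < next_tall T hi (Suc s) \<Longrightarrow> \<not> T j"
proof -
  show s: "lo \<le> s" "s < hi" using assms unfolding group_start_def by auto
  note n = next_tall_props[where j = "Suc s" and hi = hi and T = T]
  show "s < next_tall T hi (Suc s)" "next_tall T hi (Suc s) \<le> hi"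
    "T (next_tall T hi (Suc s)) \<or> next_tall T hi (Suc s) = hi"
    "\<And>j. s < j \<Longrightarrow> j < next_tall T hi (Suc s) \<Longrightarrow> \<not> T j"
    using n s by (auto simp: Suc_le_eq)
qed

text \<open>Here \<open>x\<close> is the page of the word \<open>a\<close>. The area of a call
  consists of its own pages \<open>O1\<close>, a result page \<open>r1\<close> and one word
  \<open>c1\<close> on page \<open>x1\<close>. Counters of parallel calls may share a page, so they
  are told apart as words, by \<open>c1 \<noteq> c2\<close>.\<close>

lemma areas_disjoint:
  assumes "x \<in> O1 \<or> x = r1 \<or> a = c1" "x \<in> O2 \<or> x = r2 \<or> a = c2" "O1 \<inter> O2 = {}"
    "r1 \<notin> O2" "r2 \<notin> O1" "x1 \<notin> O2" "x2 \<notin> O1" "r1 \<noteq> r2" "c1 \<noteq> c2" "r1 \<noteq> x2" "r2 \<noteq> x1"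
    "a = c1 \<Longrightarrow> x = x1" "a = c2 \<Longrightarrow> x = x2"
  shows False
  using assms by blast

text \<open>Strictly inside a group no tree is tall, and a group other than the one at
  \<open>lo\<close> starts at a tall tree.\<close>

lemma groups_apart:
  assumes "group_start T lo hi s" "group_start T lo hi s'" "s < s'"
  shows "next_tall T hi (Suc s) \<le> s'"
proof (rule ccontr)
  assume "\<not> next_tall T hi (Suc s) \<le> s'"
  then have "\<not> T s'" using group_end(6)[OF assms(1)] assms(3) by simp
  moreover have "s' \<noteq> lo" using group_end(1)[OF assms(1)] assms(3) by simp
  ultimately show False using assms(2) unfolding group_start_def by simp
qed

text \<open>The groups occupy disjoint intervals of separators. This keeps the work of each level
  linear in the number of separators although the calls branch.\<close>

lemma sum_groups_le:
  "(\<Sum>s\<in>{lo..<hi}. if group_start T lo hi s then next_tall T hi (Suc s) - s else 0) \<le> hi - lo"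
proof -
  let ?G = "{s \<in> {lo..<hi}. group_start T lo hi s}"
  let ?I = "\<lambda>s. {s..<next_tall T hi (Suc s)}"
  have "(\<Sum>s\<in>{lo..<hi}. if group_start T lo hi s then next_tall T hi (Suc s) - s else 0) = (\<Sum>s\<in>?G. card (?I s))"
    unfolding card_atLeastLessThan by (rule sum.inter_filter[symmetric]) simp
  also have "\<dots> = card (\<Union>s\<in>?G. ?I s)"
  proof (rule card_UN_disjoint[symmetric])
    show "\<forall>i\<in>?G. \<forall>j\<in>?G. i \<noteq> j \<longrightarrow> ?I i \<inter> ?I j = {}"
    proof (intro ballI impI)
      fix i j assume ij: "i \<in> ?G" "j \<in> ?G" "i \<noteq> j"
      then have g: "group_start T lo hi i" "group_start T lo hi j" by auto
      show "?I i \<inter> ?I j = {}"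
      proof (cases "i < j")
        case True then show ?thesis using groups_apart[OF g True] by auto
      next
        case False
        then have "j < i" using ij by simp
        from groups_apart[OF g(2,1) this] show ?thesis by auto
      qed
    qed
  qed auto
  also have "\<dots> \<le> card {lo..<hi}"
  proof (rule card_mono)
    show "(\<Union>s\<in>?G. ?I s) \<subseteq> {lo..<hi}"
    proof
      fix x assume "x \<in> (\<Union>s\<in>?G. ?I s)"
      then obtain s where s: "group_start T lo hi s" "s \<le> x" "x < next_tall T hi (Suc s)" by auto
      show "x \<in> {lo..<hi}" using group_end(1,4)[OF s(1)] s(2,3) by simp
    qed
  qed simp
  finally show ?thesis by simp
qed

context btree_join begin

lemma nop_runs:
  fixes m :: "'k mem"
  assumes "mem_ok W m" "\<And>l. Q l m"
  shows "runs M (interp codes) (map Num [3, 0, 0, 0, 0]) m R Wr wk sp Q"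
proof -
  have c: "codes 3 = []" unfolding codes_def by simp
  have "thr 3 (codes 3) (map Num [0, 0, 0]) m R Wr wk sp Q"
    unfolding c using assms W_ge B_ge by (intro thr_nil rest_ok_map_Num) auto
  from thr_start[OF this] show ?thesis by simp
qed

lemma sep_page:
  assumes "i < 3 * B"
  shows "pg (q * B + i) < f"
proof -
  have "q * B + i < (q + 3) * B" using assms by (simp add: algebra_simps)
  also have "\<dots> \<le> f * B" using b(5) by (intro mult_right_mono) auto
  also have "\<dots> \<le> f * (4 * B)" by simp
  finally show ?thesis by (simp add: div_less_iff_less_mult)
qed

lemma input_mem_cong:
  assumes "input_mem m" "mem_ok W m'" "\<And>a. pg a < f \<Longrightarrow> m' a = m a"
  shows "input_mem m'"
proof -
  have e: "m' (q * B + i) = m (q * B + i)" if "i < 3 * B" for i using sep_page[OF that] assms(3) by blast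
  have "stored m' (q * B) (map Key ks)"
    by (rule stored_cong[of m]) (use assms(1) b e in \<open>auto simp: input_mem_def\<close>)
  moreover have "stored m' ((q + 1) * B) (map Num ops)"
  proof (rule stored_cong[of m])
    fix i assume "i < length (map Num ops)"
    then have "B + i < 3 * B" using b B_ge by simp
    from e[OF this] show "m' ((q + 1) * B + i) = m ((q + 1) * B + i)" by (simp add: algebra_simps)
  qed (use assms(1) in \<open>auto simp: input_mem_def\<close>)
  ultimately show ?thesis using assms(2) unfolding input_mem_def by blast
qed

end

context join_call begin

abbreviation "nt j \<equiv> next_tall T hi j"

abbreviation "grp s \<equiv> group_start T lo hi s"

definition "left_ptr s = (if T s then last_child s else pt s)"
definition "right_ptr e = (if T e then first_child e else pt e)"
definition "left_tree s = (if T s then last (rx s) else X s)"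
definition "right_tree e = (if T e then hd (rx e) else X e)"

abbreviation "group_X s j \<equiv> if j = s then left_tree s else if j = nt (Suc s) then right_tree j else X j"

abbreviation "group_H s j \<equiv> if j < s \<or> nt (Suc s) < j then 0 else if T j then h - 1 else H j"

abbreviation "group_ret s \<equiv> rg + 3 + (s - lo)"

abbreviation "group_cnt s \<equiv> 4 * (rg + 2) * B + (s - lo)"

abbreviation "D1 \<equiv> D0 \<union> own B f (Suc d) lo hi"

text \<open>A group contains a tree that is not tall, and its height lies between \<open>g\<close>
  and \<open>h - 1\<close>. This ends the recursion: for \<open>h = g\<close> there is no group and
  hence no call.\<close>

lemma group_pos:
  assumes "grp s"
  shows "h \<noteq> 0" "g \<le> h - 1"
proof -
  have "H s \<noteq> h \<or> H (Suc s) \<noteq> h" using assms unfolding group_start_def by auto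
  then obtain j where j: "lo \<le> j" "j \<le> hi" "H j \<noteq> h"
    using group_end(1,2)[OF assms] that[of s] that[of "Suc s"] by auto
  then have "g \<le> H j" "H j < h" using trees[OF j(1,2)] by auto
  then show "h \<noteq> 0" "g \<le> h - 1" by auto
qed

lemma group_page: "grp s \<Longrightarrow> group_ret s = rg + (3 + (s - lo))" "grp s \<Longrightarrow> 3 + (s - lo) < region_size B"
  "grp s \<Longrightarrow> pg (group_cnt s) = rg + 2"
proof -
  assume s: "grp s"
  show "group_ret s = rg + (3 + (s - lo))" by simp
  have l: "s - lo < B" using group_end(1,2)[OF s] pre_facts(5) by linarith
  show "3 + (s - lo) < region_size B" unfolding region_size_def using l by simp
  show "pg (group_cnt s) = rg + 2" using l by (intro page_div) simp
qed

text \<open>The subproblem contains a child of a tall root, of height \<open>h - 1\<close> and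
  subject to the bound for inner nodes; this is the witness for the new value \<open>B div 2\<close>
  of \<open>L\<close>. Low trees of height \<open>h - 1\<close> may still have underfull
  roots.\<close>

lemma group_pre:
  assumes s: "grp s" and m2: "mem_ok W m2" "\<And>a. pg a < f \<Longrightarrow> m2 a = m a"
  shows "call_pre m2 (Suc d) s (nt (Suc s)) (left_ptr s) (right_ptr (nt (Suc s))) (group_ret s) (group_cnt s)
    (h - 1) (B div 2) g (group_X s) (group_H s)"
proof -
  let ?e = "nt (Suc s)"
  note ge = group_end[OF s]
  note gp = group_pos[OF s]
  have half: "1 \<le> B div 2" using B_ge by simp
  have D0f: "p < f" if "p \<in> D0" for p using that by simp
  have cong: "tree_at B m2 D0 hh l p x" if "tree_at B m D0 hh l p x" for hh l p x
    by (rule tree_at_cong[OF that]) (use m2(2) D0f B_ge in auto)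
  let ?p = "tree_ptr s ?e (left_ptr s) (right_ptr ?e)"
  have rx: "list_all2 (tree_at B m D0 (h - 1) (B div 2)) (rp j) (rx j)" "rp j \<noteq> []" "rx j \<noteq> []"
    if "T j" "lo \<le> j" "j \<le> hi" for j
    using root(3,6)[of j] that gp(1) by (auto dest: list_all2_lengthD)
  have tall_left: "tree_at B m2 D0 (h - 1) (B div 2) (left_ptr s) (left_tree s)" if "T s"
  proof -
    have lh: "lo \<le> s" "s \<le> hi" using ge by auto
    have "tree_at B m D0 (h - 1) (B div 2) (last (rp s)) (last (rx s))"
      using rx[OF that lh] by (auto simp: list_all2_conv_all_nth last_conv_nth)
    then show ?thesis using cong that gp(1) unfolding left_ptr_def left_tree_def last_child_def by auto
  qed
  have tall_right: "tree_at B m2 D0 (h - 1) (B div 2) (right_ptr ?e) (right_tree ?e)" if "T ?e"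
  proof -
    have lh: "lo \<le> ?e" "?e \<le> hi" using ge by auto
    have "tree_at B m D0 (h - 1) (B div 2) (hd (rp ?e)) (hd (rx ?e))"
      using rx[OF that lh] by (auto simp: list_all2_conv_all_nth hd_conv_nth)
    then show ?thesis using cong that gp(1) unfolding right_ptr_def right_tree_def first_child_def by auto
  qed
  have p_mid: "?p j = pt j" if "s < j" "j < ?e" for j
    using that ge unfolding tree_ptr_def by auto
  have ht: "tree_at B m2 D0 (group_H s j) 1 (?p j) (group_X s j) \<and> g \<le> group_H s j \<and> group_H s j \<le> h - 1"
    if j: "s \<le> j" "j \<le> ?e" for j
  proof -
    have lh: "lo \<le> j" "j \<le> hi" using j ge by auto
    have hj: "g \<le> group_H s j" "group_H s j \<le> h - 1" using trees[OF lh] gp j by (auto split: if_splits)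
    consider "j = s" | "j = ?e" "j \<noteq> s" | "s < j" "j < ?e" using j by linarith
    then have "tree_at B m2 D0 (group_H s j) 1 (?p j) (group_X s j)"
    proof cases
      case 1
      then have pj: "?p j = left_ptr s" using ge unfolding tree_ptr_def by auto
      show ?thesis
      proof (cases "T s")
        case True then show ?thesis using tree_at_mono_lo[OF tall_left[OF True] half] 1 ge pj by auto
      next
        case False then show ?thesis using cong trees[of s] 1 ge pj unfolding left_ptr_def left_tree_def by auto
      qed
    next
      case 2
      then have pj: "?p j = right_ptr ?e" using ge unfolding tree_ptr_def by auto
      show ?thesis
      proof (cases "T ?e")
        case True then show ?thesis using tree_at_mono_lo[OF tall_right[OF True] half] 2 ge pj by auto
      next
        case False then show ?thesis using cong trees[of ?e] 2 ge pj unfolding right_ptr_def right_tree_def by auto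
      qed
    next
      case 3
      then show ?thesis using cong trees[OF lh] p_mid ge(6) by auto
    qed
    then show ?thesis using hj by blast
  qed
  have tl: "\<exists>j. s \<le> j \<and> j \<le> ?e \<and> group_H s j = h - 1 \<and> tree_at B m2 D0 (h - 1) (B div 2) (?p j) (group_X s j)"
  proof (cases "T s")
    case True
    then show ?thesis using tall_left ge by (intro exI[of _ s]) (auto simp: tree_ptr_def)
  next
    case False
    \<comment> \<open>Without a tall tree on its left the group starts at \<open>lo\<close>. If
      there were none on its right either, it would comprise all trees, but one of them has height
      \<open>h\<close>.\<close>
    have "T ?e"
    proof (rule ccontr)
      assume ne: "\<not> T ?e"
      have "s = lo" using s False unfolding group_start_def by simp
      obtain j where "lo \<le> j" "j \<le> hi" "T j" using tallest by blast
      moreover have "?e = hi" using ge(5) ne by blast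
      ultimately show False using ge(6)[of j] False ne \<open>s = lo\<close> by (metis le_neq_implies_less)
    qed
    then show ?thesis using tall_right ge by (intro exI[of _ ?e]) (auto simp: tree_ptr_def)
  qed
  have im: "input_mem m2" using input_mem_cong[OF pre_facts(1) m2] .
  have r1: "f \<le> group_ret s" "group_ret s \<notin> own B f (Suc d) s ?e" "group_ret s < page_limit B f"
    using rg_ge rg_not_deeper[OF group_page(2)[OF s]] rg_limit[OF group_page(2)[OF s]] by (simp_all add: add.assoc)
  have two: "2 < region_size B" unfolding region_size_def by simp
  have r2: "f \<le> pg (group_cnt s)" "pg (group_cnt s) \<notin> own B f (Suc d) s ?e" "pg (group_cnt s) < page_limit B f"
    "pg (group_cnt s) \<noteq> group_ret s"
    unfolding group_page(3)[OF s] using rg_ge rg_not_deeper[OF two] rg_limit[OF two] by simp_all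
  show ?thesis
    unfolding call_pre_def
  proof (intro conjI allI impI)
    show "?e \<le> b" using ge(4) pre_facts(4) by simp
    show "Suc d + (h - 1) \<le> f" using gp(1) pre_facts(6) by simp
    show "group_H s j = 0" if "j < s \<or> ?e < j" for j using that by simp
  qed (use im ge(3) ht tl r1 r2 half in blast)+
qed

definition group_done :: "'a mem \<Rightarrow> nat \<Rightarrow> 'a list \<Rightarrow> nat list \<Rightarrow> 'a list list \<Rightarrow> bool" where
  "group_done m3 s gk gp gx \<longleftrightarrow> length gp = Suc (length gk) \<and> length gp \<le> Suc (nt (Suc s) - s) \<and>
    node_at B m3 (group_ret s) h gk gp \<and> m3 (group_cnt s) = Num (length gk) \<and>
    list_all2 (tree_at B m3 D1 (h - 1) (B div 2)) gp gx \<and>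
    weave gx gk = weave (left_tree s # map X [Suc s..<nt (Suc s)] @ [right_tree (nt (Suc s))]) (map ((!) ks) [s..<nt (Suc s)])"

text \<open>All calls have maximal height \<open>h - 1\<close> and the same lower bound
  \<open>g\<close>, so each has span at most \<open>160 * (h - g)\<close>, and by
  \<open>sum_groups_le\<close> their work adds up to at most
  \<open>160 * (hi - lo) * (h - g)\<close>.\<close>

lemma phase_groups:
  assumes IH: "\<And>h'. h = Suc h' \<Longrightarrow> call_spec h'"
    and m2: "mem_ok W m2" "\<And>a. pg a \<notin> {rg, rg + 1} \<Longrightarrow> m2 a = m a"
    and rest: "rest_ok rest" "i rest = AFork (calls B q f d rg lo hi pt T first_child last_child)"
    and cont: "\<And>m3 gk gp gx. \<lbrakk>mem_ok W m3;
      \<And>a. pg a \<notin> own B f (Suc d) lo hi \<Longrightarrow> pg a \<notin> {rg..rg + 2 + B} \<Longrightarrow> m3 a = m a;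
      \<And>s. grp s \<Longrightarrow> group_done m3 s (gk s) (gp s) (gx s)\<rbrakk> \<Longrightarrow> thr 2 is rest m3 R Wr wk sp Q"
  shows "thr 2 (i # is) rest m2 R Wr (160 * (hi - lo) * (h - g) + wk) (160 * (h - g) + sp) Q"
proof -
  define Rs where "Rs = (\<lambda>i. if grp (lo + i) then call_reads (Suc d) (lo + i) (nt (Suc (lo + i))) else {})"
  define Ws where "Ws = (\<lambda>i. if grp (lo + i) then call_writes (Suc d) (lo + i) (nt (Suc (lo + i)))
     (group_ret (lo + i)) (group_cnt (lo + i)) else {})"
  define wks where "wks = (\<lambda>i. if grp (lo + i) then 160 * (nt (Suc (lo + i)) - (lo + i)) * (h - g) else 0)"
  define Qs where "Qs = (\<lambda>i m'. grp (lo + i) \<longrightarrow> call_result m' (D0 \<union> own B f (Suc d) (lo + i) (nt (Suc (lo + i)))) (h - 1) (B div 2)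
     (lo + i) (nt (Suc (lo + i))) (group_X (lo + i)) (group_ret (lo + i)) (group_cnt (lo + i)))"
  let ?ls = "calls B q f d rg lo hi pt T first_child last_child"
  have len: "length ?ls = hi - lo" unfolding calls_def by simp
  have nth: "?ls ! i = (if grp (lo + i) then
       [2, 0, B, q, f, Suc d, lo + i, nt (Suc (lo + i)), left_ptr (lo + i), right_ptr (nt (Suc (lo + i))),
         group_ret (lo + i), group_cnt (lo + i)] else [3, 0, 0, 0, 0])" if "i < hi - lo" for i
    using that unfolding calls_def left_ptr_def right_ptr_def by (simp add: Let_def)
  have m2f: "m2 a = m a" if "pg a < f" for a using m2(2)[of a] that rg_ge by auto
  have in_Ws: "pg a \<in> own B f (Suc d) (lo + i) (nt (Suc (lo + i))) \<or> pg a = group_ret (lo + i) \<or> a = group_cnt (lo + i)"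
    "grp (lo + i)" if "a \<in> Ws i" for a i
    using that unfolding Ws_def call_writes_def by (auto split: if_splits)
  have not_own: "group_ret s \<notin> own B f (Suc d) lo' hi'" "pg (group_cnt s) \<notin> own B f (Suc d) lo' hi'"
    if "grp s" for s lo' hi'
    using that rg_not_deeper[OF group_page(2)[OF that]] rg_not_deeper[of 2] unfolding group_page(3)[OF that]
    by (simp_all add: add.assoc region_size_def)
  have own_dis: "own B f (Suc d) s (nt (Suc s)) \<inter> own B f (Suc d) s' (nt (Suc s')) = {}" if "grp s" "grp s'" "s \<noteq> s'" for s s'
    using groups_apart[OF that(1,2)] groups_apart[OF that(2,1)] that(3) own_disjoint
    by (cases s s' rule: linorder_cases) (auto, blast+)
  have own_sub: "own B f (Suc d) s (nt (Suc s)) \<subseteq> own B f (Suc d) lo hi" if "grp s" for s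
    using group_end[OF that] by (intro own_mono) auto
  have ret_own: "group_ret s \<in> own B f d lo hi" "pg (group_cnt s) \<in> own B f d lo hi" if "grp s" for s
    using rg_own[OF group_page(2)[OF that]] rg_own[of 2] unfolding group_page(3)[OF that] by (simp_all add: add.assoc region_size_def)
  have ret_range: "group_ret s \<in> {rg..rg + 2 + B}" "pg (group_cnt s) \<in> {rg..rg + 2 + B}" if "grp s" for s
    using group_end(1,2)[OF that] pre_facts(5) unfolding group_page(3)[OF that] by auto
  have page_Ws: "pg a \<in> own B f (Suc d) lo hi \<or> pg a \<in> {rg..rg + 2 + B}" if a: "a \<in> Ws i" for a i
    using in_Ws(1)[OF a] subsetD[OF own_sub[OF in_Ws(2)[OF a]]] ret_range[OF in_Ws(2)[OF a]] by metis
  show ?thesis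
  proof (rule thr_fork[where ls = ?ls and Rs = Rs and Ws = Ws and wks = wks and ?sp1.0 = "160 * (h - g)" and Qs = Qs
        and wk = wk and sp = sp])
    show "length ?ls \<le> B" unfolding len using pre_facts(5) by simp
    show "length as \<le> 64" if "as \<in> set ?ls" for as
      using that unfolding calls_def by (auto simp: Let_def split: if_splits)
    fix i assume "i < length ?ls"
    then have i: "i < hi - lo" unfolding len .
    show "runs M (interp codes) (map Num (?ls ! i)) m2 (Rs i) (Ws i) (wks i) (160 * (h - g)) (\<lambda>_. Qs i)"
    proof (cases "grp (lo + i)")
      case True
      obtain h' where h': "h = Suc h'" using group_pos(1)[OF True] by (cases h) auto
      have s: "Suc (h - 1) = h" using h' by simp
      have "call_pre m2 (Suc d) (lo + i) (nt (Suc (lo + i))) (left_ptr (lo + i)) (right_ptr (nt (Suc (lo + i)))) (group_ret (lo + i)) (group_cnt (lo + i))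
          (h - 1) (B div 2) g (group_X (lo + i)) (group_H (lo + i))" by (rule group_pre[OF True m2(1) m2f])
      moreover have "call_spec (h - 1)" using IH h' by simp
      ultimately show ?thesis
        unfolding nth[OF i] Rs_def Ws_def wks_def Qs_def using True unfolding call_spec_def s
        by (simp only: if_True simp_thms)
    next
      case False
      then show ?thesis unfolding nth[OF i] using nop_runs[OF m2(1), of "\<lambda>_. Qs i"] by (simp add: Qs_def)
    qed
    have own_d: "own B f (Suc d) lo hi \<subseteq> own B f d lo hi" by (intro own_mono) auto
    show "Rs i \<subseteq> R"
      using own_sub[of "lo + i"] own_d unfolding Rs_def call_reads_def by (auto split: if_splits)
    show "Ws i \<subseteq> Wr"
    proof
      fix a assume a: "a \<in> Ws i"
      have "pg a \<in> own B f d lo hi"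
        using in_Ws(1)[OF a] subsetD[OF own_sub[OF in_Ws(2)[OF a]]] subsetD[OF own_d] ret_own[OF in_Ws(2)[OF a]] by metis
      then show "a \<in> Wr" by (rule in_Wr)
    qed
  next
    fix i j assume "i < length ?ls" "j < length ?ls" and ij: "i \<noteq> j"
    show "Ws i \<inter> Ws j = {}"
    proof (rule ccontr)
      assume "Ws i \<inter> Ws j \<noteq> {}"
      then obtain a where a: "a \<in> Ws i" "a \<in> Ws j" by blast
      note gi = in_Ws(2)[OF a(1)] and gj = in_Ws(2)[OF a(2)]
      have ne: "lo + i \<noteq> lo + j" using ij by simp
      have r: "group_ret (lo + i) \<noteq> pg (group_cnt (lo + j))" "group_ret (lo + j) \<noteq> pg (group_cnt (lo + i))"
        "group_ret (lo + i) \<noteq> group_ret (lo + j)" "group_cnt (lo + i) \<noteq> group_cnt (lo + j)"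
        using ij unfolding group_page(3)[OF gi] group_page(3)[OF gj] by auto
      show False
        by (rule areas_disjoint[OF in_Ws(1)[OF a(1)] in_Ws(1)[OF a(2)] own_dis[OF gi gj ne] not_own(1)[OF gi]
            not_own(1)[OF gj] not_own(2)[OF gi] not_own(2)[OF gj] r(3,4,1,2)]) simp_all
    qed
    show "(\<lambda>a. a div B) ` Ws i \<inter> Rs j = {}"
    proof (rule ccontr)
      assume "(\<lambda>a. a div B) ` Ws i \<inter> Rs j \<noteq> {}"
      then obtain a where a: "a \<in> Ws i" "a div B \<in> Rs j" by blast
      then have gj: "grp (lo + j)" and "a div B \<in> call_reads (Suc d) (lo + j) (nt (Suc (lo + j)))"
        unfolding Rs_def by (auto split: if_splits)
      then have aj: "pg a < f \<or> pg a \<in> own B f (Suc d) (lo + j) (nt (Suc (lo + j)))"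
        unfolding call_reads_def using page_of_block by simp
      note gi = in_Ws(2)[OF a(1)]
      have ne: "lo + i \<noteq> lo + j" using ij by simp
      have "f \<le> group_ret (lo + i)" "f \<le> pg (group_cnt (lo + i))"
        using rg_ge unfolding group_page(3)[OF gi] by simp_all
      then have "f \<le> pg a" using in_Ws(1)[OF a(1)] own_ge by metis
      then have "pg a \<in> own B f (Suc d) (lo + j) (nt (Suc (lo + j)))" using aj by simp
      then show False
        using in_Ws(1)[OF a(1)] not_own[OF gi, of "lo + j" "nt (Suc (lo + j))"] own_dis[OF gi gj ne]
        by (metis disjoint_iff)
    qed
  next
    fix m3 assume m3: "mem_ok W m3" "\<And>i. i < length ?ls \<Longrightarrow> \<exists>mi. Qs i mi \<and> (\<forall>a. (\<forall>j<length ?ls. j \<noteq> i \<longrightarrow> a \<notin> Ws j) \<longrightarrow> m3 a = mi a)"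
      "\<And>a. \<forall>j<length ?ls. a \<notin> Ws j \<Longrightarrow> m3 a = m2 a"
    have frame: "m3 a = m a" if "pg a \<notin> own B f (Suc d) lo hi" "pg a \<notin> {rg..rg + 2 + B}" for a
    proof -
      have "m3 a = m2 a" using m3(3) page_Ws that by blast
      also have "m2 a = m a" using that(2) by (intro m2(2)) auto
      finally show ?thesis .
    qed
    have "\<exists>gk gp gx. group_done m3 s gk gp gx" if s: "grp s" for s
    proof -
      obtain i where i: "s = lo + i" "i < length ?ls"
        using group_end(1,2)[OF s] unfolding len by (metis add_diff_inverse_nat diff_less_mono not_less)
      obtain mi where mi: "Qs i mi" "\<And>a. (\<forall>j<length ?ls. j \<noteq> i \<longrightarrow> a \<notin> Ws j) \<Longrightarrow> m3 a = mi a"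
        using m3(2)[OF i(2)] by blast
      let ?D = "D0 \<union> own B f (Suc d) s (nt (Suc s))"
      from mi(1) s i have "call_result mi ?D (h - 1) (B div 2) s (nt (Suc s)) (group_X s) (group_ret s) (group_cnt s)"
        unfolding Qs_def i(1)[symmetric] by blast
      then obtain gk gp gx where r: "length gp = Suc (length gk)" "length gp \<le> Suc (nt (Suc s) - s)"
        "node_at B mi (group_ret s) (Suc (h - 1)) gk gp" "mi (group_cnt s) = Num (length gk)"
        "list_all2 (tree_at B mi ?D (h - 1) (B div 2)) gp gx"
        "weave gx gk = weave (map (group_X s) [s..<Suc (nt (Suc s))]) (map ((!) ks) [s..<nt (Suc s)])"
        unfolding call_result_def by auto
      \<comment> \<open>No parallel call writes into the area of \<open>s\<close>: pages below
        \<open>f\<close> are never written, and the areas of different groups are disjoint. So what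
        \<open>s\<close> has established survives the merge.\<close>
      have own_s: "m3 a = mi a" if a: "pg a \<in> ?D \<or> pg a = group_ret s \<or> a = group_cnt s" for a
      proof (rule mi(2), intro allI impI notI)
        fix j assume j: "j < length ?ls" "j \<noteq> i" "a \<in> Ws j"
        note gj = in_Ws(2)[OF j(3)]
        have ne: "s \<noteq> lo + j" using i j by simp
        have "f \<le> group_ret (lo + j)" "f \<le> pg (group_cnt (lo + j))"
          using rg_ge unfolding group_page(3)[OF gj] by simp_all
        then have "f \<le> pg a" using in_Ws(1)[OF j(3)] own_ge by metis
        then have a': "pg a \<in> own B f (Suc d) s (nt (Suc s)) \<or> pg a = group_ret s \<or> a = group_cnt s"
          using a by auto
        have r: "group_ret s \<noteq> pg (group_cnt (lo + j))" "group_ret (lo + j) \<noteq> pg (group_cnt s)"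
          "group_ret s \<noteq> group_ret (lo + j)" "group_cnt s \<noteq> group_cnt (lo + j)"
          using ne group_end(1)[OF s] unfolding group_page(3)[OF s] group_page(3)[OF gj] by auto
        show False
          by (rule areas_disjoint[OF a' in_Ws(1)[OF j(3)] own_dis[OF s gj ne] not_own(1)[OF s]
            not_own(1)[OF gj] not_own(2)[OF s] not_own(2)[OF gj] r(3,4,1,2)]) simp_all
      qed
      have "Suc (nt (Suc s) - s) \<le> Suc B" using group_end[OF s] pre_facts(5) by auto
      then have gl: "length gk \<le> B" "length gp \<le> Suc B" using r(1,2) by auto
      have "node_at B m3 (group_ret s) h gk gp"
        using node_at_cong[OF r(3), of m3] own_s gl B_ge group_pos(1)[OF s] by auto
      moreover have "m3 (group_cnt s) = Num (length gk)" using r(4) own_s by simp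
      moreover have "list_all2 (tree_at B m3 D1 (h - 1) (B div 2)) gp gx"
      proof (rule list_all2_mono[OF r(5)])
        fix p x assume "tree_at B mi ?D (h - 1) (B div 2) p x"
        then show "tree_at B m3 D1 (h - 1) (B div 2) p x"
          by (rule tree_at_cong) (use own_s own_sub[OF s] B_ge in auto)
      qed
      moreover have "map (group_X s) [s..<Suc (nt (Suc s))] = left_tree s # map X [Suc s..<nt (Suc s)] @ [right_tree (nt (Suc s))]"
      proof -
        have "[s..<Suc (nt (Suc s))] = s # [Suc s..<nt (Suc s)] @ [nt (Suc s)]"
          using group_end(3)[OF s] by (simp add: upt_conv_Cons)
        then show ?thesis using group_end(3)[OF s] by simp
      qed
      ultimately have "group_done m3 s gk gp gx" unfolding group_done_def using r by simp
      then show ?thesis by blast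
    qed
    then obtain gk gp gx where "\<And>s. grp s \<Longrightarrow> group_done m3 s (gk s) (gp s) (gx s)" by metis
    then show "thr 2 is rest m3 R Wr wk sp Q" using cont m3(1) frame by blast
  next
    have "(\<Sum>i<length ?ls. wks i) = (\<Sum>s\<in>{lo..<hi}. if grp s then 160 * (nt (Suc s) - s) * (h - g) else 0)"
      unfolding len wks_def using pre_facts(3)
      by (intro sum.reindex_bij_witness[where i = "\<lambda>s. s - lo" and j = "\<lambda>i. lo + i"]) auto
    also have "\<dots> = 160 * (\<Sum>s\<in>{lo..<hi}. if grp s then nt (Suc s) - s else 0) * (h - g)"
      unfolding sum_distrib_left sum_distrib_right by (intro sum.cong) auto
    also have "\<dots> \<le> 160 * (hi - lo) * (h - g)"
      by (intro mult_right_mono mult_left_mono sum_groups_le) auto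
    finally show "(\<Sum>i<length ?ls. wks i) + wk \<le> 160 * (hi - lo) * (h - g) + wk" by simp
  qed (use rest m2 in auto)
qed

end

section \<open>One recursive call: building the new nodes\<close>

lemma stored_append:
  assumes "stored m a xs" "stored m (a + length xs) ys"
  shows "stored m a (xs @ ys)"
  unfolding stored_def
proof (intro allI impI)
  fix i assume i: "i < length (xs @ ys)"
  show "m (a + i) = (xs @ ys) ! i"
  proof (cases "i < length xs")
    case True then show ?thesis using assms(1) unfolding stored_def by (simp add: nth_append)
  next
    case False
    then have "i - length xs < length ys" using i by simp
    then have "m (a + length xs + (i - length xs)) = ys ! (i - length xs)"
      using assms(2) unfolding stored_def by blast
    then show ?thesis using False by (simp add: nth_append)
  qed
qed

context join_call begin

abbreviation "PB \<equiv> ptr_buf B rg"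

abbreviation "KB \<equiv> key_buf B rg"

text \<open>A buffer receives up to \<open>(B + 1) * (B + 1)\<close> words; the extra
  \<open>B\<close> accounts for the second block that a copy reads beyond its source.\<close>

lemma buf_size: "Suc B * Suc B + B \<le> (B + 2) * (4 * B)"
proof -
  have "(B + 2) * (2 * B + 1) \<le> (B + 2) * (4 * B)" using B_ge by (intro mult_left_mono) auto
  then show ?thesis by (simp add: algebra_simps)
qed

lemma PB_KB: "PB + (B + 2) * (4 * B) = KB"
  unfolding ptr_buf_def key_buf_def by (simp add: algebra_simps)

lemma PB_page:
  assumes "x \<le> Suc B * Suc B + B"
  shows "rg + 3 + B \<le> pg (PB + x)" "pg (PB + x) < rg + 7 + 3 * B"
proof -
  have "x < (B + 3) * (4 * B)" using assms buf_size B_ge by (simp add: algebra_simps)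
  then have "rg + 3 + B \<le> pg (PB + x)" "pg (PB + x) < rg + 3 + B + (B + 3)"
    using page_interval[of B "rg + 3 + B" "PB + x" "B + 3"] unfolding ptr_buf_def by simp_all
  then show "rg + 3 + B \<le> pg (PB + x)" "pg (PB + x) < rg + 7 + 3 * B" by simp_all
qed

lemma KB_page:
  assumes "x < Suc B * Suc B + B"
  shows "rg + 5 + 2 * B \<le> pg (KB + x)" "pg (KB + x) < rg + 7 + 3 * B"
proof -
  have "x < (B + 2) * (4 * B)" using assms buf_size by linarith
  then have "rg + 5 + 2 * B \<le> pg (KB + x)" "pg (KB + x) < rg + 5 + 2 * B + (B + 2)"
    using page_interval[of B "rg + 5 + 2 * B" "KB + x" "B + 2"] unfolding key_buf_def by simp_all
  then show "rg + 5 + 2 * B \<le> pg (KB + x)" "pg (KB + x) < rg + 7 + 3 * B" by simp_all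
qed

lemma region_pages:
  assumes "rg \<le> x" "x \<le> rg + 7 + 4 * B"
  shows "x \<in> own B f d lo hi" "x \<notin> own B f (Suc d) lo' hi'" "x < page_limit B f"
proof -
  have i: "x - rg < region_size B" "rg + (x - rg) = x" using assms unfolding region_size_def by auto
  show "x \<in> own B f d lo hi" "x \<notin> own B f (Suc d) lo' hi'" "x < page_limit B f"
    using rg_own[OF i(1)] rg_not_deeper[OF i(1)] rg_limit[OF i(1)] unfolding i(2) by auto
qed

lemma read_word: "x \<in> job_reads B (Copy s n t) \<Longrightarrow> x div 4 = pg s \<or> x div 4 = pg (s + B)"
  by (rule job_reads_page) auto

lemma sep_word: "i < 2 * B \<Longrightarrow> pg (q * B + i + B) < f" "i < 2 * B \<Longrightarrow> pg (q * B + i) < f"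
  using sep_page[of "i + B"] sep_page[of i] by (simp_all add: add.assoc)

definition "group_count gk s = (if grp s then length (gk s) else 0)"

context
  fixes m3 :: "'a mem" and gk :: "nat \<Rightarrow> 'a list" and gp :: "nat \<Rightarrow> nat list" and gx :: "nat \<Rightarrow> 'a list list"
  assumes m3: "mem_ok W m3" "\<And>a. pg a \<notin> own B f (Suc d) lo hi \<Longrightarrow> pg a \<notin> {rg..rg + 2 + B} \<Longrightarrow> m3 a = m a"
    and gd: "\<And>s. grp s \<Longrightarrow> group_done m3 s (gk s) (gp s) (gx s)"
begin

abbreviation "P3 \<equiv> tree_at B m3 D1 (h - 1) (B div 2)"

abbreviation "cn \<equiv> group_count gk"

abbreviation "plen \<equiv> ptr_len lo hi T nkeys cn"

abbreviation "klen \<equiv> key_len lo hi T nkeys cn"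

abbreviation "oP j \<equiv> sum plen {lo..<j}"

abbreviation "oK j \<equiv> sum klen {lo..<j}"

lemma m3_old: "pg a < f \<Longrightarrow> m3 a = m a"
  using rg_ge by (intro m3(2)) (auto dest: own_ge)

lemma sequence:
  assumes "h \<noteq> 0"
  shows "join_sequence B lo hi T X ((!) ks) rp rx rk gp gx gk P3"
proof
  show "lo < hi" using pre_facts(3) .
next
  fix j assume j: "lo \<le> j" "j \<le> hi" "T j"
  have "list_all2 P3 (rp j) (rx j)"
  proof (rule list_all2_mono)
    show "list_all2 (tree_at B m D0 (h - 1) (B div 2)) (rp j) (rx j)" using root(6)[of j] j assms by simp
    show "tree_at B m D0 (h - 1) (B div 2) p x \<Longrightarrow> P3 p x" for p x
      by (rule tree_at_cong[where D = D0]) (use m3_old B_ge in auto)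
  qed
  then show "length (rp j) = Suc (length (rk j)) \<and> rk j \<noteq> [] \<and> length (rk j) \<le> B \<and> X j = weave (rx j) (rk j) \<and> list_all2 P3 (rp j) (rx j)"
    using root[of j] j assms by simp
next
  fix s assume s: "grp s"
  show "length (gp s) = Suc (length (gk s)) \<and>
         length (gp s) \<le> Suc (next_tall T hi (Suc s) - s) \<and>
         list_all2 P3 (gp s) (gx s) \<and>
         weave (gx s) (gk s) =
         weave ((if T s then last (rx s) else X s) # map X [Suc s..<next_tall T hi (Suc s)] @
           [if T (next_tall T hi (Suc s)) then hd (rx (next_tall T hi (Suc s))) else X (next_tall T hi (Suc s))])
          (map ((!) ks) [s..<next_tall T hi (Suc s)])"
    using gd[OF s] unfolding group_done_def left_tree_def right_tree_def by blast
qed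

text \<open>The arithmetic of the coordinator agrees with the lists of the abstract regrouping,
  whose bounds then show that the buffers are large enough.\<close>

lemma lengths:
  assumes "h \<noteq> 0"
  shows "\<And>j. lo \<le> j \<Longrightarrow> j \<le> hi \<Longrightarrow> length (join_sequence.seg lo hi T rp gp j) = plen j"
    "\<And>j. lo \<le> j \<Longrightarrow> j \<le> hi \<Longrightarrow> length (join_sequence.seg_keys lo hi T ((!) ks) rk gk j) = klen j"
    "\<And>j. j \<le> Suc hi \<Longrightarrow> length (join_sequence.all_ptrs lo hi T rp gp j) = oP j"
    "\<And>j. j \<le> Suc hi \<Longrightarrow> length (join_sequence.all_keys lo hi T ((!) ks) rk gk j) = oK j"
    "oP (Suc hi) \<le> Suc B * Suc B" "oK (Suc hi) < Suc B * Suc B"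
    "oP (Suc hi) = Suc (oK (Suc hi))" "oP (Suc hi) \<le> Suc (hi - lo) * Suc B"
proof -
  interpret js: join_sequence B lo hi T X "(!) ks" rp rx rk gp gx gk P3 by (rule sequence[OF assms])
  have s: "length (js.seg rp gp j) = plen j" if "lo \<le> j" "j \<le> hi" for j
    using js.tall[OF that] js.group[of j] assms
    unfolding js.seg_def ptr_len_def own_ptrs_def nkeys_def group_count_def by auto
  have k: "length (js.seg_keys j) = klen j" if "lo \<le> j" "j \<le> hi" for j
    using js.tall[OF that] assms
    unfolding js.seg_keys_def key_len_def nkeys_def group_count_def by auto
  show "lo \<le> j \<Longrightarrow> j \<le> hi \<Longrightarrow> length (js.seg rp gp j) = plen j"
    "lo \<le> j \<Longrightarrow> j \<le> hi \<Longrightarrow> length (js.seg_keys j) = klen j" for j using s k by auto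
  have ap: "length (js.all_ptrs j) = oP j" if "j \<le> Suc hi" for j
    unfolding js.all_ptrs_def length_concat map_map comp_def interv_sum_list_conv_sum_set_nat
    using s that by (intro sum.cong) auto
  have ak: "length (js.all_keys j) = oK j" if "j \<le> Suc hi" for j
    unfolding js.all_keys_def length_concat map_map comp_def interv_sum_list_conv_sum_set_nat
    using k that by (intro sum.cong) auto
  show "j \<le> Suc hi \<Longrightarrow> length (js.all_ptrs j) = oP j" "j \<le> Suc hi \<Longrightarrow> length (js.all_keys j) = oK j" for j
    using ap ak by auto
  have pt: "length (js.all_ptrs (Suc hi)) = length (js.all_trees (Suc hi))"
    using js.all_P[of "Suc hi"] by (auto dest: list_all2_lengthD)
  show e: "oP (Suc hi) = Suc (oK (Suc hi))"
    using js.regroup(1) pt ap[of "Suc hi"] ak[of "Suc hi"] by simp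
  have "oP (Suc hi) \<le> (Suc hi - lo) * Suc B"
    using js.regroup(3) unfolding pt[symmetric] ap[OF order_refl] .
  moreover have "Suc hi - lo = Suc (hi - lo)" using pre_facts(3) by simp
  ultimately show o: "oP (Suc hi) \<le> Suc (hi - lo) * Suc B" by simp
  have "Suc (hi - lo) * Suc B \<le> Suc B * Suc B" using pre_facts(5) by (intro mult_right_mono) auto
  then show "oP (Suc hi) \<le> Suc B * Suc B" using o by linarith
  then show "oK (Suc hi) < Suc B * Suc B" using e by linarith
qed

lemma offsets_mono: "i \<le> j \<Longrightarrow> oP i \<le> oP j" "i \<le> j \<Longrightarrow> oK i \<le> oK j"
  by (intro sum_mono2; auto)+

lemma offset_Suc: "lo \<le> j \<Longrightarrow> oP (Suc j) = oP j + plen j" "lo \<le> j \<Longrightarrow> oK (Suc j) = oK j + klen j"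
  by simp_all

lemma phase3:
  assumes h: "h \<noteq> 0"
    and rest: "rest_ok rest" "arg rest 0 = B" "js rest = jobs3 B q h rg lo hi pt T nkeys cn"
    and cont: "\<And>m4. \<lbrakk>mem_ok W m4; \<And>a. pg a \<notin> {rg + 3 + B..<rg + 7 + 3 * B} \<Longrightarrow> m4 a = m3 a;
      stored m4 PB (map Num (join_sequence.all_ptrs lo hi T rp gp (Suc hi)));
      stored m4 KB (map Key (join_sequence.all_keys lo hi T ((!) ks) rk gk (Suc hi)))\<rbrakk>
      \<Longrightarrow> thr 2 is rest m4 R Wr wk sp Q"
  shows "thr 2 (fan 9 js @ is) rest m3 R Wr (16 * Suc (hi - lo) + wk) (36 + sp) Q"
proof -
  interpret jq: join_sequence B lo hi T X "(!) ks" rp rx rk gp gx gk P3 by (rule sequence[OF h])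
  note ln = lengths[OF h]
  let ?js = "jobs3 B q h rg lo hi pt T nkeys cn"
  let ?ow = "own_ptrs lo hi T nkeys"
  define F where "F = (\<lambda>j. (if T j then
       [Copy (4 * pt j * B + 2 * B + drop_left T lo j) (?ow j) (PB + oP j),
        Copy (4 * pt j * B + B) (nkeys j) (KB + oK j)] else []) @
     (if grp j then
       [Copy (4 * group_ret j * B + 2 * B) (Suc (cn j)) (PB + oP j + ?ow j),
        Copy (4 * group_ret j * B + B) (cn j) (KB + oK j + (if T j then nkeys j else 0))]
      else if adjacent T lo hi j then [Copy (q * B + j) 1 (KB + oK j + nkeys j)] else []))"
  have js: "?js = concat (map F [lo..<Suc hi])" unfolding jobs3_def F_def Let_def using h by (simp del: upt_Suc)
  have len: "length ?js \<le> 4 * Suc (hi - lo)"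
    using length_concat_map_le[of "[lo..<Suc hi]" F 4] pre_facts(3) unfolding js F_def by (simp add: Suc_diff_le)
  have nk: "nkeys j \<le> B" "pt j \<in> D0" "nkeys j = length (rk j)" if "T j" "lo \<le> j" "j \<le> hi" for j
    using root(2,8)[of j] that h unfolding nkeys_def by auto
  have cnB: "Suc (cn s) \<le> Suc B" "cn s = length (gk s)" "length (gp s) = Suc (cn s)" if "grp s" for s
    using gd[OF that] group_end[OF that] pre_facts(5) that unfolding group_done_def group_count_def by auto
  have dl: "drop_left T lo j \<le> 1" for j unfolding drop_left_def by simp
  have ow: "?ow j \<le> Suc (nkeys j)" for j unfolding own_ptrs_def by simp
  have sepj: "lo \<le> j" "j < hi" "T j" "j < b" "j < B" if "adjacent T lo hi j" for j
    using that pre_facts(4,5) unfolding adjacent_def by auto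
  have pl: "plen j = ?ow j + (if grp j then Suc (cn j) else 0)" for j unfolding ptr_len_def ..
  have kl: "klen j = (if T j then nkeys j else 0) + (if grp j then cn j else if adjacent T lo hi j then 1 else 0)" for j
    unfolding key_len_def ..
  have endP: "oP j + plen j \<le> Suc B * Suc B" if "lo \<le> j" "j \<le> hi" for j
    using offsets_mono(1)[of "Suc j" "Suc hi"] offset_Suc(1)[OF that(1)] that(2) ln(5) by linarith
  have endK: "oK j + klen j < Suc B * Suc B" if "lo \<le> j" "j \<le> hi" for j
    using offsets_mono(2)[of "Suc j" "Suc hi"] offset_Suc(2)[OF that(1)] that(2) ln(6) by linarith
  have PK: "PB + (oP j + plen j) \<le> KB" if "lo \<le> j" "j \<le> hi" for j
    using endP[OF that] buf_size PB_KB by linarith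
  have Frng: "jobs_range (F j) \<subseteq> {PB + oP j..<PB + (oP j + plen j)} \<union> {KB + oK j..<KB + (oK j + klen j)}" for j
    unfolding F_def pl kl by (auto simp: adjacent_def)
  have Pp: "pg (PB + x) \<in> {rg + 3 + B..<rg + 7 + 3 * B}" if "x \<le> Suc B * Suc B" for x
    using PB_page[of x] that by simp
  have Kp: "pg (KB + x) \<in> {rg + 3 + B..<rg + 7 + 3 * B}" if "x < Suc B * Suc B" for x
    using KB_page[of x] that by simp
  have rng: "pg a \<in> {rg + 3 + B..<rg + 7 + 3 * B}" if a: "a \<in> jobs_range ?js" for a
  proof -
    obtain j where j: "j \<in> {lo..<Suc hi}" "a \<in> jobs_range (F j)" using a unfolding js concat_upt by auto
    then have lh: "lo \<le> j" "j \<le> hi" by auto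
    from subsetD[OF Frng j(2)] show ?thesis
    proof
      assume "a \<in> {PB + oP j..<PB + (oP j + plen j)}"
      then have "a - PB \<le> Suc B * Suc B" "PB + (a - PB) = a"
        using endP[OF lh] unfolding atLeastLessThan_iff by linarith+
      then show ?thesis using Pp[of "a - PB"] by metis
    next
      assume "a \<in> {KB + oK j..<KB + (oK j + klen j)}"
      then have "a - KB < Suc B * Suc B" "KB + (a - KB) = a"
        using endK[OF lh] unfolding atLeastLessThan_iff by linarith+
      then show ?thesis using Kp[of "a - KB"] by metis
    qed
  qed
  have PWlim: "x < page_limit B f \<and> x \<in> own B f d lo hi" if "x \<in> {rg + 3 + B..<rg + 7 + 3 * B}" for x
    using region_pages[of x] that by simp
  have Wb: "PB + x < W" if "x \<le> Suc B * Suc B" for x using PWlim[OF Pp[OF that]] by (intro W_word) blast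
  have Wk: "KB + x < W" if "x < Suc B * Suc B" for x using PWlim[OF Kp[OF that]] by (intro W_word) blast
  have gpage: "pg (4 * group_ret s * B + x) = group_ret s" if "x < 4 * B" for s x by (rule page_div[OF that])
  have gw: "4 * group_ret s * B + x < W" if "grp s" "x < 4 * B" for s x
  proof (rule W_word)
    show "pg (4 * group_ret s * B + x) < page_limit B f"
      unfolding gpage[OF that(2)] using rg_limit[OF group_page(2)[OF that(1)]] by (simp only: add.assoc)
  qed
  have ow_w: "4 * pt j * B + x < W" if "T j" "lo \<le> j" "j \<le> hi" "x < 4 * B" for j x
    using page_div[OF that(4), of "pt j"] nk(2)[OF that(1-3)] by (intro W_old) simp
  show ?thesis
  proof (rule thr_fan_pages[where ?js0.0 = ?js and PR = "{..<f} \<union> {rg + 3..<rg + 3 + B}" and PW = "{rg + 3 + B..<rg + 7 + 3 * B}"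
        and wk = wk and sp = sp])
    show "length ?js \<le> 9 * B" using len pre_facts(3,5) B_ge by simp
    show "job_ok B W j'" if j': "j' \<in> set ?js" for j'
    proof -
      obtain j where j: "j \<in> {lo..<Suc hi}" "j' \<in> set (F j)" using j' unfolding js concat_upt by auto
      then have lh: "lo \<le> j" "j \<le> hi" by auto
      have d: "PB + oP j < W" "PB + oP j + ?ow j < W" "KB + oK j < W" "KB + (oK j + klen j) < W"
        "T j \<Longrightarrow> KB + oK j + nkeys j < W"
        using Wb[of "oP j"] Wb[of "oP j + ?ow j"] Wk[of "oK j"] Wk[of "oK j + klen j"] Wk[of "oK j + nkeys j"]
          endP[OF lh] endK[OF lh] pl[of j] kl[of j] by (auto simp: add.assoc)
      have t1: "job_ok B W (Copy (4 * pt j * B + 2 * B + drop_left T lo j) (?ow j) (PB + oP j))" if "T j"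
        using ow_w[OF that lh, of "2 * B + drop_left T lo j"] dl[of j] ow[of j] nk(1)[OF that lh] d(1) B_ge by (simp add: add.assoc)
      have t2: "job_ok B W (Copy (4 * pt j * B + B) (nkeys j) (KB + oK j))" if "T j"
        using ow_w[OF that lh, of B] nk(1)[OF that lh] d(3) by simp
      have t3: "job_ok B W (Copy (4 * group_ret j * B + 2 * B) (Suc (cn j)) (PB + oP j + ?ow j))" if "grp j"
        using gw[OF that, of "2 * B"] cnB(1)[OF that] d(2) by simp
      have t4: "job_ok B W (Copy (4 * group_ret j * B + B) (cn j) (KB + oK j + (if T j then nkeys j else 0)))" if "grp j"
        using gw[OF that, of B] cnB(1)[OF that] d(3,5) by simp
      have t5: "job_ok B W (Copy (q * B + j) 1 (KB + oK j + nkeys j))" if "adjacent T lo hi j"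
        using sep_word(2)[of j] sepj[OF that] d(5) W_old[of "q * B + j"] by simp
      show ?thesis using j(2) t1 t2 t3 t4 t5 unfolding F_def by (auto simp del: job_ok.simps split: if_splits)
    qed
    show "jobs_disjoint ?js" unfolding js
    proof (rule jobs_disjoint_concat)
      show "jobs_disjoint (F j)" if "j \<in> {lo..<Suc hi}" for j
      proof -
        have "PB + (oP j + plen j) \<le> KB" using PK that by simp
        then show ?thesis unfolding F_def pl by (auto split: if_splits)
      qed
      show "jobs_range (F i) \<inter> jobs_range (F j) = {}" if ij: "lo \<le> i" "i < j" "j < Suc hi" for i j
      proof -
        have o: "oP i + plen i \<le> oP j" "oK i + klen i \<le> oK j"
          using offsets_mono[of "Suc i" j] offset_Suc[OF ij(1)] ij by auto
        have k: "PB + (oP i + plen i) \<le> KB" "PB + (oP j + plen j) \<le> KB" using PK[of i] PK[of j] ij by auto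
        have "({PB + oP i..<PB + (oP i + plen i)} \<union> {KB + oK i..<KB + (oK i + klen i)}) \<inter>
           ({PB + oP j..<PB + (oP j + plen j)} \<union> {KB + oK j..<KB + (oK j + klen j)}) = {}"
          using o k by (auto simp del: sum.op_ivl_Suc)
        then show ?thesis using Frng[of i] Frng[of j] by blast
      qed
    qed
    show "x div 4 \<in> {..<f} \<union> {rg + 3..<rg + 3 + B}" if x: "x \<in> jobs_reads B ?js" for x
    proof -
      obtain j where j: "j \<in> {lo..<Suc hi}" "x \<in> jobs_reads B (F j)" using x unfolding js concat_upt by auto
      then have lh: "lo \<le> j" "j \<le> hi" by auto
      have t: "x div 4 < f" if "T j" "x \<in> job_reads B (Copy (4 * pt j * B + y) n t)" "y < 4 * B" for y n t
        using node_reads[OF _ that(2,3)] nk(2)[OF that(1) lh] by simp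
      \<comment> \<open>An offset below \<open>3 * B\<close> ensures that the second block read
        still belongs to the result page; the page behind the last of them is a buffer that is being
        written.\<close>
      have g: "x div 4 \<in> {rg + 3..<rg + 3 + B}" if "grp j" "x \<in> job_reads B (Copy (4 * group_ret j * B + y) n t)" "y < 3 * B" for y n t
      proof -
        have "x div 4 = group_ret j"
          using read_word[OF that(2)] gpage[of y j] gpage[of "y + B" j] that(3) by (simp add: add.assoc)
        then show ?thesis
          unfolding atLeastLessThan_iff using group_end(1,2)[OF that(1)] pre_facts(5) by linarith
      qed
      have s: "x div 4 < f" if "adjacent T lo hi j" "x \<in> job_reads B (Copy (q * B + j) n t)" for n t
        using read_word[OF that(2)] sep_word[of j] sepj[OF that(1)] by auto
      consider (a) "T j" "x \<in> job_reads B (Copy (4 * pt j * B + (2 * B + drop_left T lo j)) (?ow j) (PB + oP j))"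
        | (b) "T j" "x \<in> job_reads B (Copy (4 * pt j * B + B) (nkeys j) (KB + oK j))"
        | (c) "grp j" "x \<in> job_reads B (Copy (4 * group_ret j * B + 2 * B) (Suc (cn j)) (PB + oP j + ?ow j))"
        | (d) "grp j" "x \<in> job_reads B (Copy (4 * group_ret j * B + B) (cn j) (KB + oK j + (if T j then nkeys j else 0)))"
        | (e) "adjacent T lo hi j" "x \<in> job_reads B (Copy (q * B + j) 1 (KB + oK j + nkeys j))"
        using j(2) unfolding F_def by (auto simp: add.assoc simp del: job_reads.simps split: if_splits)
      then show ?thesis
      proof cases
        case a then show ?thesis using t[OF a] dl[of j] B_ge by simp
      next
        case b then show ?thesis using t[OF b] by simp
      next
        case c then show ?thesis using g[OF c] by simp
      next
        case d then show ?thesis using g[OF d] by simp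
      next
        case e then show ?thesis using s[OF e] by simp
      qed
    qed
    show "({..<f} \<union> {rg + 3..<rg + 3 + B}) \<inter> {rg + 3 + B..<rg + 7 + 3 * B} = {}" using rg_ge by auto
    show "x \<in> R" if "x div 4 \<in> {..<f} \<union> {rg + 3..<rg + 3 + B}" for x
      using that in_R[of x] region_pages(1)[of "x div 4"] by auto
    show "jobs_range ?js \<subseteq> Wr" using rng PWlim in_Wr by blast
    show "4 * length ?js + wk \<le> 16 * Suc (hi - lo) + wk" using len by simp
    fix m4 assume m4: "mem_ok W m4" "jobs_done m3 ?js m4"
    have dn: "job_done m3 jb m4" if "jb \<in> set (F j)" "lo \<le> j" "j \<le> hi" for j jb
      by (rule jobs_done_concat[OF m4(2)[unfolded js] _ that(1)]) (use that in auto)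
    have ptrs: "stored m4 (PB + oP j) (map Num (jq.seg rp gp j))" if lh: "lo \<le> j" "j \<le> hi" for j
    proof -
      have "stored m4 (PB + oP j) (map Num (if T j then drop (drop_left T lo j) (take (length (rp j) - drop_right T hi j) (rp j)) else []))
        \<and> length (if T j then drop (drop_left T lo j) (take (length (rp j) - drop_right T hi j) (rp j)) else []) = ?ow j"
      proof (cases "T j")
        case True
        have "job_done m3 (Copy (4 * pt j * B + 2 * B + drop_left T lo j) (?ow j) (PB + oP j)) m4"
          by (rule dn[OF _ lh]) (simp add: F_def True)
        then have e: "m4 (PB + oP j + i) = m3 (4 * pt j * B + (2 * B + drop_left T lo j + i))" if "i < ?ow j" for i
          using that by (simp add: add.assoc)
        have l: "length (rp j) = Suc (nkeys j)" using nk(3)[OF True lh] root(3)[of j] True h lh by simp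
        have "m4 (PB + oP j + i) = Num (rp j ! (drop_left T lo j + i))" if i: "i < ?ow j" for i
        proof -
          have i': "drop_left T lo j + i < length (rp j)" using i True l unfolding own_ptrs_def by auto
          then have "drop_left T lo j + i < 2 * B" using l nk(1)[OF True lh] B_ge by linarith
          then have "pg (4 * pt j * B + (2 * B + drop_left T lo j + i)) = pt j" by (intro page_div) linarith
          then have "m4 (PB + oP j + i) = m (4 * pt j * B + (2 * B + drop_left T lo j + i))"
            using e[OF i] nk(2)[OF True lh] by (simp add: m3_old)
          also have "\<dots> = Num (rp j ! (drop_left T lo j + i))"
            using root(4)[of j] True h lh i' unfolding node_at_iff by (simp add: add.assoc)
          finally show ?thesis .
        qed
        then show ?thesis using True l unfolding stored_def own_ptrs_def by auto
      qed (simp add: stored_def own_ptrs_def)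
      moreover have "stored m4 (PB + oP j + ?ow j) (map Num (if grp j then gp j else []))"
      proof (cases "grp j")
        case True
        have "job_done m3 (Copy (4 * group_ret j * B + 2 * B) (Suc (cn j)) (PB + oP j + ?ow j)) m4"
          by (rule dn[OF _ lh]) (simp add: F_def True)
        then show ?thesis using True gd[OF True] cnB(3)[OF True] unfolding group_done_def node_at_iff stored_def by simp
      qed (simp add: stored_def)
      ultimately show ?thesis unfolding jq.seg_def map_append by (intro stored_append) auto
    qed
    have keys: "stored m4 (KB + oK j) (map Key (jq.seg_keys j))" if lh: "lo \<le> j" "j \<le> hi" for j
    proof -
      have "stored m4 (KB + oK j) (map Key (if T j then rk j else []))"
      proof (cases "T j")
        case True
        have "job_done m3 (Copy (4 * pt j * B + B) (nkeys j) (KB + oK j)) m4"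
          by (rule dn[OF _ lh]) (simp add: F_def True)
        then have e: "m4 (KB + oK j + i) = m3 (4 * pt j * B + (B + i))" if "i < nkeys j" for i
          using that by (simp add: add.assoc)
        have "m4 (KB + oK j + i) = Key (rk j ! i)" if i: "i < nkeys j" for i
        proof -
          have "B + i < 4 * B" using i nk(1)[OF True lh] by linarith
          then have "pg (4 * pt j * B + (B + i)) = pt j" by (rule page_div)
          then have "m4 (KB + oK j + i) = m (4 * pt j * B + (B + i))"
            using e[OF i] nk(2)[OF True lh] by (simp add: m3_old)
          also have "\<dots> = Key (rk j ! i)"
            using root(4)[of j] True h lh i nk(3)[OF True lh] unfolding node_at_iff by (simp add: add.assoc)
          finally show ?thesis .
        qed
        then show ?thesis using True nk(3)[OF True lh] unfolding stored_def by auto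
      qed (simp add: stored_def)
      moreover have "stored m4 (KB + oK j + (if T j then nkeys j else 0))
        (map Key (if grp j then gk j else if adjacent T lo hi j then [ks ! j] else []))"
      proof -
        consider "grp j" | "\<not> grp j" "adjacent T lo hi j" | "\<not> grp j" "\<not> adjacent T lo hi j" by blast
        then show ?thesis
        proof cases
          case 1
          have "job_done m3 (Copy (4 * group_ret j * B + B) (cn j) (KB + oK j + (if T j then nkeys j else 0))) m4"
            by (rule dn[OF _ lh]) (simp add: F_def 1)
          then show ?thesis using 1 gd[OF 1] cnB(2)[OF 1] unfolding group_done_def node_at_iff stored_def by simp
        next
          case 2
          have "job_done m3 (Copy (q * B + j) 1 (KB + oK j + nkeys j)) m4"
            by (rule dn[OF _ lh]) (simp add: F_def 2)
          then have "m4 (KB + oK j + nkeys j) = m3 (q * B + j)" by simp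
          also have "\<dots> = m (q * B + j)" using sep_word(2)[of j] sepj[OF 2(2)] by (simp add: m3_old)
          also have "\<dots> = Key (ks ! j)" using pre_facts(1) sepj[OF 2(2)] b(3) unfolding input_mem_def stored_def by simp
          finally show ?thesis using 2 sepj[OF 2(2)] unfolding stored_def by simp
        next
          case 3 then show ?thesis unfolding stored_def by simp
        qed
      qed
      moreover have "length (if T j then rk j else []) = (if T j then nkeys j else 0)" using nk(3)[OF _ lh] by simp
      ultimately show ?thesis unfolding jq.seg_keys_def map_append by (intro stored_append) auto
    qed
    show "thr 2 is rest m4 R Wr wk sp Q"
    proof (rule cont[OF m4(1)])
      show "m4 a = m3 a" if "pg a \<notin> {rg + 3 + B..<rg + 7 + 3 * B}" for a
        using m4(2) rng that unfolding jobs_done_def by blast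
      have "stored m4 PB (concat (map (\<lambda>j. map Num (jq.seg rp gp j)) [lo..<Suc hi]))"
      proof (rule stored_concat)
        fix j assume j: "lo \<le> j" "j < Suc hi"
        have "length (concat (map (\<lambda>j. map Num (jq.seg rp gp j) :: 'a word list) [lo..<j])) = oP j"
          using ln(3)[of j] j unfolding jq.all_ptrs_def by (simp add: length_concat comp_def)
        then show "stored m4 (PB + length (concat (map (\<lambda>j. map Num (jq.seg rp gp j) :: 'a word list) [lo..<j]))) (map Num (jq.seg rp gp j))"
          using ptrs[of j] j by simp
      qed
      then show "stored m4 PB (map Num (jq.all_ptrs (Suc hi)))" unfolding jq.all_ptrs_def map_concat map_map comp_def .
      have "stored m4 KB (concat (map (\<lambda>j. map Key (jq.seg_keys j)) [lo..<Suc hi]))"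
      proof (rule stored_concat)
        fix j assume j: "lo \<le> j" "j < Suc hi"
        have "length (concat (map (\<lambda>j. map Key (jq.seg_keys j)) [lo..<j])) = oK j"
          using ln(4)[of j] j unfolding jq.all_keys_def by (simp add: length_concat comp_def)
        then show "stored m4 (KB + length (concat (map (\<lambda>j. map Key (jq.seg_keys j)) [lo..<j]))) (map Key (jq.seg_keys j))"
          using keys[of j] j by simp
      qed
      then show "stored m4 KB (map Key (jq.all_keys (Suc hi)))" unfolding jq.all_keys_def map_concat map_map comp_def .
    qed
  qed (use rest m3(1) rng in simp_all)
qed

end

lemma node_pages:
  assumes "i \<le> B"
  shows "new_node B rg i \<in> own B f d lo hi" "new_node B rg i \<notin> own B f (Suc d) lo' hi'"
    "new_node B rg i < page_limit B f" "f \<le> new_node B rg i" "new_node B rg i \<noteq> 0" "new_node B rg i \<noteq> ret"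
    "new_node B rg i \<noteq> pg cnt"
proof -
  have n: "rg \<le> new_node B rg i" "new_node B rg i \<le> rg + 7 + 4 * B" unfolding new_node_def using assms by auto
  show o: "new_node B rg i \<in> own B f d lo hi" "new_node B rg i \<notin> own B f (Suc d) lo' hi'"
    "new_node B rg i < page_limit B f" by (rule region_pages[OF n])+
  show "f \<le> new_node B rg i" using n(1) rg_ge by linarith
  show "new_node B rg i \<noteq> 0" unfolding new_node_def by simp
  show "new_node B rg i \<noteq> ret" "new_node B rg i \<noteq> pg cnt" using o(1) ret(2) cnt(2) by auto
qed

text \<open>The upper bound on \<open>length ps\<close> limits the new nodes to one per joined tree,
  so their pointers fit on the result page. The lower bound \<open>L\<close> on
  \<open>length kk\<close> matters if only one node arises.\<close>

lemma phase4_pos: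
  fixes m4 :: "'a mem" and xs :: "'a list list" and kk :: "'a list"
  assumes h: "h \<noteq> 0"
    and m4: "mem_ok W m4" "stored m4 PB (map Num ps)" "stored m4 KB (map Key kk)"
      "list_all2 (tree_at B m4 D1 (h - 1) (B div 2)) ps xs"
    and len: "length ps = Suc (length kk)" "length ps \<le> Suc (hi - lo) * Suc B" "L \<le> length kk"
    and wv: "weave xs kk = weave (map X [lo..<Suc hi]) (map ((!) ks) [lo..<hi])"
    and rest: "rest_ok rest" "arg rest 0 = B" "js rest = jobs4 B q h rg lo hi (length ps) ret cnt"
    and cont: "\<And>m5. \<lbrakk>mem_ok W m5; call_result m5 (D0 \<union> own B f d lo hi) h L lo hi X ret cnt\<rbrakk>
      \<Longrightarrow> thr 2 is rest m5 R Wr wk sp Q"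
  shows "thr 2 (fan 9 js @ is) rest m4 R Wr (20 * Suc (hi - lo) + 8 + wk) (36 + sp) Q"
proof -
  let ?n = "length ps"
  let ?js = "jobs4 B q h rg lo hi ?n ret cnt"
  define r where "r = num_nodes B ?n"
  define x where "x = new_node B rg"
  define bd where "bd = cut ?n r"
  define F where "F = (\<lambda>i. [Copy (PB + bd i) (bd (Suc i) - bd i) (4 * x i * B + 2 * B),
        Copy (KB + bd i) (bd (Suc i) - bd i - 1) (4 * x i * B + B),
        Store 2 (4 * x i * B) h (bd (Suc i) - bd i - 1),
        Store 1 (4 * ret * B + 2 * B + i) (x i) 0] @
       (if Suc i < r then [Copy (KB + (bd (Suc i) - 1)) 1 (4 * ret * B + B + i)] else []))"
  define H0 where "H0 = [Store 2 (4 * ret * B) (Suc h) (r - 1), Store 1 cnt (r - 1) 0]"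
  have js: "?js = H0 @ concat (map F [0..<r])"
    unfolding jobs4_def F_def H0_def r_def x_def bd_def Let_def using h by simp
  have n0: "0 < ?n" using len(1) by simp
  have r0: "0 < r" unfolding r_def by (rule num_nodes_pos[OF n0])
  have rw: "r \<le> Suc (hi - lo)" unfolding r_def by (rule num_nodes_le[OF len(2)])
  have rB: "r \<le> Suc B" using rw pre_facts(5) by linarith
  have wB: "Suc (hi - lo) * Suc B \<le> Suc B * Suc B" using pre_facts(5) by (intro mult_right_mono) auto
  have nB: "?n \<le> Suc B * Suc B" using len(2) wB by linarith
  have up: "?n \<le> Suc B * r" using num_nodes_bounds(1)[of ?n B] unfolding r_def by (simp add: mult.commute)
  have bd0: "bd 0 = 0" "bd r = ?n" unfolding bd_def using r0 by simp_all
  have c_le: "bd (Suc i) \<le> bd i + Suc B" for i unfolding bd_def by (rule cut_size_le[OF up r0])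
  \<comment> \<open>A single node gets all keys, at least \<open>L\<close> of them; for several
    nodes \<open>half_full\<close> applies. \<open>Suc l\<close> counts children, one more than
    keys.\<close>
  define l where "l = (if r = 1 then L else B div 2)"
  have "Suc l * r \<le> ?n"
  proof (cases "r = 1")
    case True then show ?thesis using len(1,3) unfolding l_def by simp
  next
    case False
    then have "2 \<le> r" using r0 by simp
    moreover have "(r - 1) * Suc B < ?n" using num_nodes_bounds(2)[OF n0, of B] unfolding r_def .
    ultimately have "Suc (B div 2) * r \<le> ?n" by (rule half_full)
    then show ?thesis using False unfolding l_def by simp
  qed
  then have c_ge: "bd i + Suc l \<le> bd (Suc i)" for i unfolding bd_def using cut_size_ge[OF _ r0] by blast
  have c_lt: "bd i < bd (Suc i)" for i using c_ge[of i] by simp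
  have bd_mono: "i \<le> j \<Longrightarrow> bd i \<le> bd j" for i j by (rule lift_Suc_mono_le[of bd]) (use c_lt less_imp_le in auto)
  have bd_n: "bd (Suc i) \<le> ?n" if "i < r" for i using bd_mono[of "Suc i" r] that bd0(2) by simp
  have iB: "i \<le> B" if "i < r" for i using that rB by simp
  have xp: "x i \<in> own B f d lo hi" "x i \<notin> own B f (Suc d) lo' hi'" "x i < page_limit B f" "f \<le> x i" "x i \<noteq> 0" "x i \<noteq> ret" "x i \<noteq> pg cnt"
    if "i < r" for i lo' hi' using node_pages[OF iB[OF that]] unfolding x_def by auto
  have xinj: "x i = x j \<longleftrightarrow> i = j" for i j unfolding x_def new_node_def by simp
  have pgx: "pg (4 * x i * B + y) = x i" if "y < 4 * B" for i y by (rule page_div[OF that])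
  have pgr: "pg (4 * ret * B + y) = ret" if "y < 4 * B" for y by (rule page_div[OF that])
  \<comment> \<open>The targets for node \<open>i\<close>: its own page, its pointer on the result
    page and, unless it is the last node, the separator behind it.\<close>
  define A where "A = (\<lambda>i. {a. pg a = x i} \<union> {4 * ret * B + 2 * B + i} \<union> (if Suc i < r then {4 * ret * B + B + i} else {}))"
  have in_x: "{4 * x i * B + y..<4 * x i * B + y + z} \<subseteq> {a. pg a = x i}" if "y + z \<le> 4 * B" for i y z
  proof
    fix a assume a: "a \<in> {4 * x i * B + y..<4 * x i * B + y + z}"
    then have "4 * x i * B + (a - 4 * x i * B) = a" "a - 4 * x i * B < 4 * B" using that by auto
    then show "a \<in> {a. pg a = x i}" using pgx[of "a - 4 * x i * B" i] by simp
  qed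
  have Frng: "jobs_range (F i) \<subseteq> A i" if i: "i < r" for i
  proof -
    have "{4 * x i * B + 2 * B..<4 * x i * B + 2 * B + (bd (Suc i) - bd i)} \<subseteq> {a. pg a = x i}"
      using c_le[of i] B_ge by (intro in_x) simp
    moreover have "{4 * x i * B + B..<4 * x i * B + B + (bd (Suc i) - bd i - 1)} \<subseteq> {a. pg a = x i}"
      using c_le[of i] B_ge by (intro in_x) simp
    moreover have "{4 * x i * B..<4 * x i * B + 2} \<subseteq> {a. pg a = x i}"
      using in_x[of 0 2 i] B_ge by simp
    ultimately show ?thesis unfolding F_def A_def by auto
  qed
  have Apg: "pg a = x i \<or> pg a = ret" if "a \<in> A i" "i < r" for a i
  proof -
    have "pg (4 * ret * B + (2 * B + i)) = ret" "pg (4 * ret * B + (B + i)) = ret"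
      using iB[OF that(2)] B_ge by (intro pgr; simp)+
    then show ?thesis using that(1) unfolding A_def by (auto simp: add.assoc split: if_splits)
  qed
  have H0rng: "jobs_range H0 = {4 * ret * B, Suc (4 * ret * B), cnt}" unfolding H0_def by auto
  have H0pg: "pg (4 * ret * B) = ret" "pg (Suc (4 * ret * B)) = ret" using pgr[of 0] pgr[of 1] B_ge by auto
  let ?PW = "x ` {..<r} \<union> {ret, pg cnt}"
  have rng: "pg a \<in> ?PW" "a \<in> Wr" if a: "a \<in> jobs_range ?js" for a
  proof -
    have "a \<in> {4 * ret * B, Suc (4 * ret * B), cnt} \<or> (\<exists>i<r. a \<in> A i)"
      using a Frng unfolding js jobs_range_simps(3) concat_upt H0rng by fastforce
    then have c: "pg a = ret \<or> a = cnt \<or> (\<exists>i<r. pg a = x i)" using H0pg Apg by auto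
    then show "pg a \<in> ?PW" by auto
    show "a \<in> Wr" using c xp(1) unfolding call_writes_def by auto
  qed
  have not_cnt: "cnt \<notin> A i" if "i < r" for i using Apg[of cnt i] that xp(7)[OF that] cnt(4) by auto
  have jdone: "jobs_disjoint ?js"
    unfolding js jobs_disjoint_append
  proof (intro conjI)
    have "cnt \<noteq> 4 * ret * B" "cnt \<noteq> Suc (4 * ret * B)" using H0pg cnt(4) by metis+
    then show "jobs_disjoint H0" unfolding H0_def by auto
    show "jobs_disjoint (concat (map F [0..<r]))"
    proof (rule jobs_disjoint_concat)
      fix i assume "i \<in> {0..<r}"
      then have i: "i < r" by simp
      have "pg (4 * ret * B + (2 * B + i)) = ret" "pg (4 * ret * B + (B + i)) = ret"
        using iB[OF i] B_ge by (intro pgr; simp)+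
      then have n: "4 * ret * B + 2 * B + i \<notin> {a. pg a = x i}" "4 * ret * B + B + i \<notin> {a. pg a = x i}"
        using xp(6)[OF i] by (auto simp: add.assoc)
      have a1: "{4 * x i * B + 2 * B..<4 * x i * B + 2 * B + (bd (Suc i) - bd i)} \<subseteq> {a. pg a = x i}"
        using c_le[of i] B_ge by (intro in_x) simp
      have a2: "{4 * x i * B + B..<4 * x i * B + B + (bd (Suc i) - bd i - 1)} \<subseteq> {a. pg a = x i}"
        using c_le[of i] B_ge by (intro in_x) simp
      have a3: "{4 * x i * B..<4 * x i * B + 2} \<subseteq> {a. pg a = x i}"
        using in_x[of 0 2 i] B_ge by simp
      have d1: "{4 * x i * B + 2 * B..<4 * x i * B + 2 * B + (bd (Suc i) - bd i)} \<inter> {4 * x i * B + B..<4 * x i * B + B + (bd (Suc i) - bd i - 1)} = {}"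
        "{4 * x i * B + 2 * B..<4 * x i * B + 2 * B + (bd (Suc i) - bd i)} \<inter> {4 * x i * B..<4 * x i * B + 2} = {}"
        "{4 * x i * B + B..<4 * x i * B + B + (bd (Suc i) - bd i - 1)} \<inter> {4 * x i * B..<4 * x i * B + 2} = {}"
        using c_le[of i] B_ge by auto
      show "jobs_disjoint (F i)"
        unfolding F_def using n d1 subsetD[OF a1] subsetD[OF a2] subsetD[OF a3] B_ge by (auto split: if_splits)
    next
      fix i j assume ij: "0 \<le> i" "i < j" "j < r"
      have "A i \<inter> A j = {}"
      proof (rule ccontr)
        assume "A i \<inter> A j \<noteq> {}"
        then obtain a where a: "a \<in> A i" "a \<in> A j" by blast
        have ne: "x i \<noteq> x j" using xinj ij by simp
        have xr: "x i \<noteq> ret" "x j \<noteq> ret" using xp(6) ij by auto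
        have p: "pg (4 * ret * B + (2 * B + i)) = ret" "pg (4 * ret * B + (B + i)) = ret"
          "pg (4 * ret * B + (2 * B + j)) = ret" "pg (4 * ret * B + (B + j)) = ret"
          using iB[of i] iB[of j] ij B_ge by (intro pgr; simp)+
        show False
        proof (cases "pg a = ret")
          case True
          \<comment> \<open>Pointer and key positions on the result page cannot coincide: a
            separator of index \<open>i\<close> satisfies \<open>Suc i < r \<le> B + 1\<close>,
            hence \<open>B + i < 2 * B\<close>.\<close>
          then have "a = 4 * ret * B + 2 * B + i \<or> a = 4 * ret * B + B + i" "a = 4 * ret * B + 2 * B + j \<or> a = 4 * ret * B + B + j \<and> Suc j < r"
            using a xr unfolding A_def by (auto split: if_splits)
          then show False using ij rB by auto
        next
          case False
          then have "pg a = x i" "pg a = x j" using a p unfolding A_def by (auto simp: add.assoc split: if_splits)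
          then show False using ne by simp
        qed
      qed
      then show "jobs_range (F i) \<inter> jobs_range (F j) = {}" using Frng[of i] Frng[of j] ij by fastforce
    qed
    have "{4 * ret * B, Suc (4 * ret * B), cnt} \<inter> A i = {}" if i: "i < r" for i
      using not_cnt[OF i] H0pg xp(6)[OF i] B_ge unfolding A_def by (auto split: if_splits)
    then show "jobs_range H0 \<inter> jobs_range (concat (map F [0..<r])) = {}"
      unfolding H0rng concat_upt using Frng by fastforce
  qed
  have jlen: "length ?js \<le> 2 + 5 * Suc (hi - lo)"
  proof -
    have "length (concat (map F [0..<r])) \<le> 5 * length [0..<r]" by (rule length_concat_map_le) (simp add: F_def)
    then show ?thesis unfolding js H0_def using rw by simp
  qed
  let ?PR = "{..<f} \<union> {rg + 3 + B..<rg + 7 + 3 * B}"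
  have Wpage: "pg a \<in> ?PW \<Longrightarrow> a < W" for a
    using xp(3) ret(3) cnt(3) by (intro W_word) auto
  have Wx: "4 * x i * B + y < W" if "i < r" "y < 4 * B" for i y
    using pgx[OF that(2)] xp(3)[OF that(1)] by (intro W_word) simp
  have Wret: "4 * ret * B + y < W" if "y < 4 * B" for y
    using pgr[OF that] ret(3) by (intro W_word) simp
  have Wbuf: "PB + y < W" "y < Suc B * Suc B \<Longrightarrow> KB + y < W" if "y \<le> Suc B * Suc B" for y
    using PB_page[of y] KB_page[of y] that region_pages(3)[of "pg (PB + y)"] region_pages(3)[of "pg (KB + y)"]
    by (intro W_word; simp)+
  have h_W: "Suc h < W" "r < W" "bd (Suc i) - bd i - 1 < W" for i
  proof -
    show "Suc h < W" using pre_facts(6) f_limit by (intro W_page) linarith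
    show "r < W" using rB B_limit B_ge by (intro W_page) linarith
    show "bd (Suc i) - bd i - 1 < W" using c_le[of i] B_limit B_ge by (intro W_page) linarith
  qed
  show ?thesis
  proof (rule thr_fan_pages[where ?js0.0 = ?js and PR = ?PR and PW = ?PW and wk = wk and sp = sp])
    show "length ?js \<le> 9 * B" using jlen pre_facts(3,5) B_ge by simp
    show "jobs_disjoint ?js" by (rule jdone)
    show "job_ok B W j'" if j': "j' \<in> set ?js" for j'
    proof -
      have "job_ok B W j'" if "j' \<in> set H0"
        using that h_W Wret[of 0] W_word[OF cnt(3)] W_ge unfolding H0_def by auto
      moreover have "job_ok B W j'" if "i < r" "j' \<in> set (F i)" for i
      proof -
        note i = that(1)
        have b1: "bd i < Suc B * Suc B" "bd (Suc i) - 1 < Suc B * Suc B" using bd_n[OF i] c_lt[of i] nB by linarith+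
        have "job_ok B W (Copy (PB + bd i) (bd (Suc i) - bd i) (4 * x i * B + 2 * B))"
          using c_le[of i] Wx[OF i, of "2 * B"] Wbuf(1)[of "bd i"] b1 by simp
        moreover have "job_ok B W (Copy (KB + bd i) (bd (Suc i) - bd i - 1) (4 * x i * B + B))"
          using c_le[of i] Wx[OF i, of "B"] Wbuf(2)[of "bd i"] b1 by simp
        moreover have "job_ok B W (Store 2 (4 * x i * B) h (bd (Suc i) - bd i - 1))"
          using Wx[OF i, of 0] h_W(1) h_W(3)[of i] by simp
        moreover have "job_ok B W (Store 1 (4 * ret * B + 2 * B + i) (x i) 0)"
          using Wret[of "2 * B + i"] iB[OF i] xp(3)[OF i] W_page[of "x i"] W_ge B_ge by (simp add: add.assoc)
        moreover have "job_ok B W (Copy (KB + (bd (Suc i) - 1)) 1 (4 * ret * B + B + i))"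
          using Wret[of "B + i"] iB[OF i] Wbuf(2)[of "bd (Suc i) - 1"] b1 B_ge by (simp add: add.assoc)
        ultimately show ?thesis using that(2) unfolding F_def by (auto simp del: job_ok.simps split: if_splits)
      qed
      ultimately show ?thesis using j' unfolding js set_append concat_upt by auto
    qed
    show "y div 4 \<in> ?PR" if y: "y \<in> jobs_reads B ?js" for y
    proof -
      have st: "y div 4 \<in> ?PR" if "y \<in> {0, 1}" for y using that b(5) by auto
      have pb: "y div 4 \<in> ?PR" if "y \<in> job_reads B (Copy (PB + v) k t)" "v \<le> Suc B * Suc B" for y v k t
        using read_word[OF that(1)] PB_page[of v] PB_page[of "v + B"] that(2) by (auto simp: add.assoc)
      have kb: "y div 4 \<in> ?PR" if "y \<in> job_reads B (Copy (KB + v) k t)" "v < Suc B * Suc B" for y v k t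
        using read_word[OF that(1)] KB_page[of v] KB_page[of "v + B"] that(2) by (auto simp: add.assoc)
      consider "y \<in> jobs_reads B H0" | i where "i < r" "y \<in> jobs_reads B (F i)"
        using y unfolding js jobs_reads_simps(3) concat_upt by auto
      then show ?thesis
      proof cases
        case 1 then show ?thesis by (intro st) (auto simp: H0_def)
      next
        case (2 i)
        have b1: "bd i \<le> Suc B * Suc B" "bd i < Suc B * Suc B" "bd (Suc i) - 1 < Suc B * Suc B"
          using bd_n[OF 2(1)] c_lt[of i] nB by linarith+
        have "y \<in> {0, 1} \<or> y \<in> job_reads B (Copy (PB + bd i) (bd (Suc i) - bd i) (4 * x i * B + 2 * B)) \<or>
          y \<in> job_reads B (Copy (KB + bd i) (bd (Suc i) - bd i - 1) (4 * x i * B + B)) \<or>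
          y \<in> job_reads B (Copy (KB + (bd (Suc i) - 1)) 1 (4 * ret * B + B + i))"
          using 2(2) unfolding F_def by (auto simp del: job_reads.simps(1) split: if_splits)
        then show ?thesis
          by (elim disjE) (rule st pb[OF _ b1(1)] kb[OF _ b1(2)] kb[OF _ b1(3)], assumption)+
      qed
    qed
    show "?PR \<inter> ?PW = {}"
    proof -
      have o: "p \<in> own B f d lo hi" if "p \<in> {rg + 3 + B..<rg + 7 + 3 * B}" for p
        using that by (intro region_pages(1)) simp_all
      have "ret \<notin> ?PR" "pg cnt \<notin> ?PR" using ret(1,2) cnt(1,2) o by (meson UnE lessThan_iff not_less)+
      moreover have "x i \<notin> ?PR" if "i < r" for i using xp(4)[OF that] unfolding x_def new_node_def by auto
      ultimately show ?thesis by blast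
    qed
    show "y \<in> R" if "y div 4 \<in> ?PR" for y
      using that
    proof
      assume "y div 4 \<in> {rg + 3 + B..<rg + 7 + 3 * B}"
      then show "y \<in> R" by (intro in_R(2) region_pages(1)) simp_all
    qed (simp add: in_R(1))
    show "4 * length ?js + wk \<le> 20 * Suc (hi - lo) + 8 + wk" using jlen by simp
    fix m5 assume m5: "mem_ok W m5" "jobs_done m4 ?js m5"
    have dF: "job_done m4 jb m5" if "i < r" "jb \<in> set (F i)" for i jb
      using m5(2) that unfolding jobs_done_def js by auto
    have dH: "job_done m4 jb m5" if "jb \<in> set H0" for jb
      using m5(2) that unfolding jobs_done_def js by auto
    have m5_old: "m5 a = m4 a" if "pg a \<notin> ?PW" for a
      using m5(2) rng(1) that unfolding jobs_done_def by blast
    define ks' where "ks' = map (\<lambda>i. kk ! (bd (Suc i) - 1)) [0..<r - 1]"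
    define ps' where "ps' = map x [0..<r]"
    define xss where "xss = map (\<lambda>i. weave (slice (bd i) (bd (Suc i)) xs) (slice (bd i) (bd (Suc i) - 1) kk)) [0..<r]"
    have lx: "length xs = length ps" using m4(4) by (auto dest: list_all2_lengthD)
    have lens: "length ps' = Suc (length ks')" "length ps' \<le> Suc (hi - lo)" "length xss = length ps'"
      "length ks' = r - 1"
      unfolding ps'_def ks'_def xss_def using r0 rw by auto
    have "weave xss ks' = weave xs kk"
      unfolding xss_def ks'_def using lx len(1) bd0 r0 c_lt by (intro weave_cut) auto
    then have w: "weave xss ks' = weave (map X [lo..<Suc hi]) (map ((!) ks) [lo..<hi])" using wv by simp
    have node: "node_at B m5 ret (Suc h) ks' ps'"
      unfolding node_at_iff
    proof (intro conjI allI impI)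
      have e: "job_done m4 (Store 2 (4 * ret * B) (Suc h) (r - 1)) m5" by (rule dH) (simp add: H0_def)
      have "m5 (4 * ret * B + i) = Num (if i = 0 then Suc h else r - 1)" if "i < 2" for i
        using e that by simp
      from this[of 0] this[of 1] show "m5 (4 * ret * B) = Num (Suc h)" "m5 (4 * ret * B + 1) = Num (length ks')" using lens(4) by simp_all
      fix i assume "i < length ps'"
      then have i: "i < r" unfolding ps'_def by simp
      have "job_done m4 (Store 1 (4 * ret * B + 2 * B + i) (x i) 0) m5" by (rule dF[OF i]) (simp add: F_def)
      then show "m5 (4 * ret * B + 2 * B + i) = Num (ps' ! i)" using i unfolding ps'_def by simp
    next
      fix i assume "i < length ks'"
      then have i: "Suc i < r" "i < r" using lens(4) by auto
      have "job_done m4 (Copy (KB + (bd (Suc i) - 1)) 1 (4 * ret * B + B + i)) m5"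
        by (rule dF[OF i(2)]) (simp add: F_def i(1))
      then have e: "m5 (4 * ret * B + B + i) = m4 (KB + (bd (Suc i) - 1))" by simp
      have "bd (Suc i) < bd r" using c_lt[of "Suc i"] bd_mono[of "Suc (Suc i)" r] i by simp
      then have "bd (Suc i) - 1 < length kk" using bd0(2) len(1) c_lt[of i] by simp
      then have "m4 (KB + (bd (Suc i) - 1)) = Key (kk ! (bd (Suc i) - 1))" using m4(3) unfolding stored_def by simp
      then show "m5 (4 * ret * B + B + i) = Key (ks' ! i)" using e i unfolding ks'_def by simp
    qed
    have c: "m5 cnt = Num (length ks')"
    proof -
      have "job_done m4 (Store 1 cnt (r - 1) 0) m5" by (rule dH) (simp add: H0_def)
      then show ?thesis using lens(4) by simp
    qed
    \<comment> \<open>The collected trees lie on input pages and on pages of deeper calls, whereas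
      this phase writes only new nodes of depth \<open>d\<close> and the two pages designated by the
      caller.\<close>
    have old: "tree_at B m5 (D0 \<union> own B f d lo hi) (h - 1) (B div 2) p t" if "tree_at B m4 D1 (h - 1) (B div 2) p t" for p t
    proof (rule tree_at_cong[OF that])
      show "D1 \<subseteq> D0 \<union> own B f d lo hi" using own_mono[of d "Suc d" lo lo hi hi B f] by auto
      have "own B f (Suc d) lo hi \<subseteq> own B f d lo hi" by (rule own_mono) auto
      then have "ret \<notin> D1" "pg cnt \<notin> D1" using ret(1,2) cnt(1,2) by auto
      moreover have "x i \<notin> D1" if "i < r" for i using xp(2)[OF that, of lo hi] xp(4)[OF that] by auto
      ultimately have "D1 \<inter> ?PW = {}" by blast
      then show "m5 a = m4 a" if "pg a \<in> D1" for a using m5_old that by blast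
    qed (rule B_ge)
    obtain h' where h': "h = Suc h'" using h by (cases h) auto
    have tr: "tree_at B m5 (D0 \<union> own B f d lo hi) h l (x i) (xss ! i)" if i: "i < r" for i
    proof -
      let ?ks = "slice (bd i) (bd (Suc i) - 1) kk" and ?ps = "slice (bd i) (bd (Suc i)) ps" and ?xs = "slice (bd i) (bd (Suc i)) xs"
      have bn: "bd (Suc i) \<le> length ps" "bd (Suc i) \<le> length xs" "bd (Suc i) - 1 \<le> length kk" using bd_n[OF i] lx len(1) by auto
      have sl: "length ?ks = bd (Suc i) - bd i - 1" "length ?ps = bd (Suc i) - bd i" "length ?xs = bd (Suc i) - bd i"
        using length_slice[OF bn(1), of "bd i"] length_slice[OF bn(2), of "bd i"] length_slice[OF bn(3), of "bd i"] by auto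
      have "node_at B m5 (x i) h ?ks ?ps"
        unfolding node_at_iff
      proof (intro conjI allI impI)
        have e: "job_done m4 (Store 2 (4 * x i * B) h (bd (Suc i) - bd i - 1)) m5" by (rule dF[OF i]) (simp add: F_def)
        have "m5 (4 * x i * B + y) = Num (if y = 0 then h else bd (Suc i) - bd i - 1)" if "y < 2" for y
          using e that by simp
        from this[of 0] this[of 1] show "m5 (4 * x i * B) = Num h" "m5 (4 * x i * B + 1) = Num (length ?ks)"
          using sl(1) by simp_all
        fix y assume y: "y < length ?ks"
        have "job_done m4 (Copy (KB + bd i) (bd (Suc i) - bd i - 1) (4 * x i * B + B)) m5" by (rule dF[OF i]) (simp add: F_def)
        then have "m5 (4 * x i * B + B + y) = m4 (KB + bd i + y)" using y sl(1) by simp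
        also have "\<dots> = Key (kk ! (bd i + y))" using m4(3) y sl(1) bn(3) unfolding stored_def by (simp add: add.assoc)
        also have "kk ! (bd i + y) = ?ks ! y" using nth_slice[OF bn(3), of y "bd i"] y sl(1) by simp
        finally show "m5 (4 * x i * B + B + y) = Key (?ks ! y)" .
      next
        fix y assume y: "y < length ?ps"
        have "job_done m4 (Copy (PB + bd i) (bd (Suc i) - bd i) (4 * x i * B + 2 * B)) m5" by (rule dF[OF i]) (simp add: F_def)
        then have "m5 (4 * x i * B + 2 * B + y) = m4 (PB + bd i + y)" using y sl(2) by simp
        also have "\<dots> = Num (ps ! (bd i + y))" using m4(2) y sl(2) bn(1) unfolding stored_def by (simp add: add.assoc)
        also have "ps ! (bd i + y) = ?ps ! y" using nth_slice[OF bn(1), of y "bd i"] y sl(2) by simp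
        finally show "m5 (4 * x i * B + 2 * B + y) = Num (?ps ! y)" .
      qed
      moreover have "tree_at B m5 (D0 \<union> own B f d lo hi) h' (B div 2) (?ps ! y) (?xs ! y)" if y: "y < length ?ps" for y
      proof -
        have "tree_at B m4 D1 (h - 1) (B div 2) (ps ! (bd i + y)) (xs ! (bd i + y))"
          using list_all2_nthD[OF m4(4), of "bd i + y"] y sl(2) bn(1) by simp
        then show ?thesis
          using old nth_slice[OF bn(1), of y "bd i"] nth_slice[OF bn(2), of y "bd i"] y sl(2) h' by simp
      qed
      moreover have "l \<le> length ?ks" "length ?ks \<le> B" "length ?ps = Suc (length ?ks)"
        using c_ge[of i] c_le[of i] c_lt[of i] sl by linarith+
      moreover have "xss ! i = weave ?xs ?ks" unfolding xss_def using i by simp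
      moreover have "x i \<in> own B f d lo hi" "x i \<noteq> 0" using xp(1,5)[OF i] by auto
      ultimately show ?thesis unfolding h' tree_at.simps using sl h'
        by (intro conjI exI[of _ ?ks] exI[of _ ?ps] exI[of _ ?xs]) auto
    qed
    have "list_all2 (tree_at B m5 (D0 \<union> own B f d lo hi) h (if ks' = [] then L else B div 2)) ps' xss"
    proof (rule list_all2_all_nthI)
      have "(if ks' = [] then L else B div 2) = l"
        unfolding l_def using lens(4) r0 by (cases "r = 1") (auto simp: length_0_conv[symmetric] simp del: length_0_conv)
      then show "i < length ps' \<Longrightarrow> tree_at B m5 (D0 \<union> own B f d lo hi) h (if ks' = [] then L else B div 2) (ps' ! i) (xss ! i)" for i
        using tr[of i] unfolding ps'_def by simp
    qed (use lens in simp)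
    then have "call_result m5 (D0 \<union> own B f d lo hi) h L lo hi X ret cnt"
      unfolding call_result_def using lens node c w by blast
    then show "thr 2 is rest m5 R Wr wk sp Q" by (rule cont[OF m5(1)])
  qed (use rest m4(1) rng in \<open>simp_all del: Un_iff\<close>, blast+)
qed

end

section \<open>Correctness of the program\<close>

context join_call begin

text \<open>All traversals are empty, and null pointers satisfy \<open>tree_at\<close> at height 0
  for every lower bound, so the separators alone make up the result.\<close>

lemma phase4_zero:
  fixes m3 :: "'a mem"
  assumes h: "h = 0" and m3: "mem_ok W m3" "\<And>a. pg a < f \<Longrightarrow> m3 a = m a"
    and rest: "rest_ok rest" "arg rest 0 = B" "js rest = jobs4 B q h rg lo hi n ret cnt"
    and cont: "\<And>m5. \<lbrakk>mem_ok W m5; call_result m5 (D0 \<union> own B f d lo hi) h L lo hi X ret cnt\<rbrakk>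
      \<Longrightarrow> thr 2 is rest m5 R Wr wk sp Q"
  shows "thr 2 (fan 9 js @ is) rest m3 R Wr (20 * Suc (hi - lo) + 8 + wk) (36 + sp) Q"
proof -
  let ?js = "jobs4 B q h rg lo hi n ret cnt"
  let ?w = "hi - lo"
  define F where "F = (\<lambda>i. [Store 1 (4 * ret * B + 2 * B + i) 0 0])"
  define H0 where "H0 = [Copy (q * B + lo) ?w (4 * ret * B + B), Store 2 (4 * ret * B) 1 ?w, Store 1 cnt ?w 0]"
  have js: "?js = H0 @ concat (map F [0..<Suc ?w])"
    unfolding jobs4_def F_def H0_def using h by (simp add: concat_map_singleton del: upt_Suc)
  have w: "?w \<le> B" "0 < ?w" "lo < B" using pre_facts(3,5) by auto
  have pgr: "pg (4 * ret * B + y) = ret" if "y < 4 * B" for y by (rule page_div[OF that])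
  have cnt_ne: "cnt \<noteq> 4 * ret * B + y" if "y < 4 * B" for y using pgr[OF that] cnt(4) by metis
  have rng: "a = cnt \<or> (\<exists>y<4 * B. a = 4 * ret * B + y)" if "a \<in> jobs_range ?js" for a
  proof -
    have r: "\<exists>y<4 * B. a = 4 * ret * B + y" if "4 * ret * B \<le> a" "a < 4 * ret * B + 4 * B"
      using that by (intro exI[of _ "a - 4 * ret * B"]) auto
    have "a = cnt \<or> 4 * ret * B \<le> a \<and> a < 4 * ret * B + 4 * B"
      using that w B_ge unfolding js jobs_range_simps(3) concat_upt H0_def F_def by auto
    then show ?thesis using r by blast
  qed
  have rng_page: "pg a \<in> {ret, pg cnt}" "a \<in> Wr" if "a \<in> jobs_range ?js" for a
    using rng[OF that] pgr unfolding call_writes_def by auto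
  have Wret: "4 * ret * B + y < W" if "y < 4 * B" for y
    using pgr[OF that] ret(3) by (intro W_word) simp
  have wW: "?w < W" using w(1) B_limit B_ge by (intro W_page) linarith
  show ?thesis
  proof (rule thr_fan_pages[where ?js0.0 = ?js and PR = "{..<f}" and PW = "{ret, pg cnt}" and wk = wk and sp = sp])
    show "length ?js \<le> 9 * B" unfolding js H0_def F_def concat_map_singleton using w B_ge by simp
    show "4 * length ?js + wk \<le> 20 * Suc ?w + 8 + wk" unfolding js H0_def F_def concat_map_singleton by simp
    show "jobs_disjoint ?js"
      unfolding js jobs_disjoint_append
    proof (intro conjI)
      have "{4 * ret * B + B..<4 * ret * B + B + ?w} \<inter> {4 * ret * B..<4 * ret * B + 2} = {}" using B_ge by auto
      moreover have "cnt \<notin> {4 * ret * B + B..<4 * ret * B + B + ?w}"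
      proof
        assume c: "cnt \<in> {4 * ret * B + B..<4 * ret * B + B + ?w}"
        then have "cnt - 4 * ret * B < 4 * B" "cnt = 4 * ret * B + (cnt - 4 * ret * B)"
          using w(1) unfolding atLeastLessThan_iff by linarith+
        then show False using cnt_ne by blast
      qed
      moreover have "cnt \<notin> {4 * ret * B..<4 * ret * B + 2}"
        using cnt_ne[of 0] cnt_ne[of 1] B_ge by auto
      ultimately show "jobs_disjoint H0" unfolding H0_def by auto
      show "jobs_disjoint (concat (map F [0..<Suc ?w]))" by (rule jobs_disjoint_concat) (auto simp: F_def)
      have "cnt \<noteq> 4 * ret * B + 2 * B + i" if "i \<le> ?w" for i
        using cnt_ne[of "2 * B + i"] that w B_ge by (simp add: add.assoc)
      then show "jobs_range H0 \<inter> jobs_range (concat (map F [0..<Suc ?w])) = {}"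
        unfolding concat_upt H0_def F_def using w B_ge by auto
    qed
    show "job_ok B W j'" if "j' \<in> set ?js" for j'
    proof -
      have "job_ok B W (Copy (q * B + lo) ?w (4 * ret * B + B))"
        using w Wret[of B] sep_word(2)[of lo] W_old[of "q * B + lo"] by simp
      moreover have "job_ok B W (Store 2 (4 * ret * B) 1 ?w)" "job_ok B W (Store 1 cnt ?w 0)"
        using Wret[of 0] wW W_ge W_word[OF cnt(3)] by simp_all
      moreover have "job_ok B W (Store 1 (4 * ret * B + 2 * B + i) 0 0)" if "i \<le> ?w" for i
        using Wret[of "2 * B + i"] that w W_ge B_ge by (simp add: add.assoc)
      ultimately show ?thesis using that unfolding js set_append concat_upt H0_def F_def by (auto simp del: job_ok.simps)
    qed
    show "x div 4 \<in> {..<f}" if "x \<in> jobs_reads B ?js" for x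
    proof -
      have "x \<in> job_reads B (Copy (q * B + lo) ?w (4 * ret * B + B)) \<or> x \<in> {0, 1}"
        using that unfolding js jobs_reads_simps(3) concat_upt H0_def F_def by (auto simp del: job_reads.simps(1))
      then show ?thesis
      proof
        assume "x \<in> job_reads B (Copy (q * B + lo) ?w (4 * ret * B + B))"
        from read_word[OF this] show ?thesis using sep_word[of lo] w by auto
      qed (use b(5) in auto)
    qed
    show "{..<f} \<inter> {ret, pg cnt} = {}" using ret(1) cnt(1) by auto
    fix m5 assume m5: "mem_ok W m5" "jobs_done m3 ?js m5"
    have dn: "job_done m3 jb m5" if "jb \<in> set ?js" for jb using m5(2) that unfolding jobs_done_def by blast
    let ?ks = "map ((!) ks) [lo..<hi]" and ?ps = "replicate (Suc ?w) 0" and ?xs = "map X [lo..<Suc hi]"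
    have e: "job_done m3 (Copy (q * B + lo) ?w (4 * ret * B + B)) m5" "job_done m3 (Store 2 (4 * ret * B) 1 ?w) m5"
      "job_done m3 (Store 1 cnt ?w 0) m5"
      by (rule dn; simp add: js H0_def)+
    have e4: "m5 (4 * ret * B + 2 * B + i) = Num 0" if "i < Suc ?w" for i
    proof -
      have "job_done m3 (Store 1 (4 * ret * B + 2 * B + i) 0 0) m5"
        by (rule dn) (use that in \<open>simp add: js F_def concat_map_singleton del: upt_Suc\<close>)
      then show ?thesis by simp
    qed
    have hdr: "m5 (4 * ret * B + i) = Num (if i = 0 then 1 else ?w)" if "i < 2" for i using e(2) that by simp
    have "m5 (4 * ret * B + B + i) = Key (ks ! (lo + i))" if i: "i < ?w" for i
    proof -
      have "m5 (4 * ret * B + B + i) = m3 (q * B + (lo + i))" using e(1) i by (simp add: add.assoc)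
      also have "\<dots> = m (q * B + (lo + i))" using sep_word(2)[of "lo + i"] i w pre_facts(5) by (intro m3(2)) auto
      also have "\<dots> = Key (ks ! (lo + i))"
        using pre_facts(1,4) i b(3) unfolding input_mem_def stored_def by simp
      finally show ?thesis .
    qed
    then have "node_at B m5 ret (Suc h) ?ks ?ps"
      unfolding node_at_iff using hdr[of 0] hdr[of 1] e4 h by (simp del: replicate_Suc)
    moreover have "list_all2 (tree_at B m5 (D0 \<union> own B f d lo hi) h l) ?ps ?xs" for l
    proof (rule list_all2_all_nthI)
      fix i assume i: "i < length ?ps"
      then have j: "lo \<le> lo + i" "lo + i \<le> hi" using w by auto
      have "X (lo + i) = []" using trees[OF j] h by auto
      moreover have "?xs ! i = X (lo + i)" using j by (simp del: upt_Suc)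
      moreover have "?ps ! i = 0" using i by (simp del: replicate_Suc)
      ultimately show "tree_at B m5 (D0 \<union> own B f d lo hi) h l (?ps ! i) (?xs ! i)" using h by simp
    qed (use w in \<open>simp del: upt_Suc\<close>)
    moreover have "m5 cnt = Num (length ?ks)" using e(3) by simp
    ultimately have "call_result m5 (D0 \<union> own B f d lo hi) h L lo hi X ret cnt"
      unfolding call_result_def by (intro exI[of _ ?ks] exI[of _ ?ps] exI[of _ ?xs]) simp
    then show "thr 2 is rest m5 R Wr wk sp Q" by (rule cont[OF m5(1)])
  qed (use rest m3(1) rng_page in_R(1) in \<open>simp_all del: insert_iff\<close>, blast+)
qed

lemma call_runs:
  assumes IH: "\<And>h'. h = Suc h' \<Longrightarrow> call_spec h'"
  shows "runs M (interp codes) (map Num [2, 0, B, q, f, d, lo, hi, pL, pR, ret, cnt]) m R Wr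
      (160 * (hi - lo) * (Suc h - g)) (160 * (Suc h - g))
      (\<lambda>_ m'. call_result m' (D0 \<union> own B f d lo hi) h L lo hi X ret cnt)"
proof -
  let ?Q = "\<lambda>_ m'. call_result m' (D0 \<union> own B f d lo hi) h L lo hi X ret cnt"
  let ?S = "Suc (hi - lo)"
  have gh: "g \<le> h" using tallest trees by blast
  have "thr 2 call_code rest0 m R Wr (14 + 12 * ?S + (160 * (hi - lo) * (h - g) + (1 + (16 * ?S + (20 * ?S + 8 + 0)))))
     (86 + (160 * (h - g) + (1 + (36 + (36 + 0))))) ?Q"
  proof (rule scouting)
    fix rest m2 assume m2: "mem_ok W m2" "\<And>a. pg a \<notin> {rg, rg + 1} \<Longrightarrow> m2 a = m a"
      and rest: "rest_ok rest" "length rest = 10 + 14 * B" and ex: "\<And>ys. \<exists>zs. rest @ ys = rest1 @ zs"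
      and dec: "\<And>ys. call_height (rest @ ys) = h" "\<And>ys. call_tall (rest @ ys) = T"
      "\<And>ys. call_info 8 1 (rest @ ys) = nkeys" "\<And>ys. call_info 8 2 (rest @ ys) = first_child"
      "\<And>ys. call_info 8 3 (rest @ ys) = last_child"
    have args: "arg (rest @ ys) 0 = B" "arg (rest @ ys) 1 = q" "arg (rest @ ys) 2 = f" "arg (rest @ ys) 3 = d"
      "arg (rest @ ys) 4 = lo" "arg (rest @ ys) 5 = hi" "arg (rest @ ys) 8 = ret" "arg (rest @ ys) 9 = cnt"
      "call_region (rest @ ys) = rg" "call_ptr (rest @ ys) = pt" for ys
    proof -
      obtain zs where z: "rest @ ys = rest1 @ zs" using ex by blast
      show "arg (rest @ ys) 0 = B" "arg (rest @ ys) 1 = q" "arg (rest @ ys) 2 = f" "arg (rest @ ys) 3 = d"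
      "arg (rest @ ys) 4 = lo" "arg (rest @ ys) 5 = hi" "arg (rest @ ys) 8 = ret" "arg (rest @ ys) 9 = cnt"
      "call_region (rest @ ys) = rg" "call_ptr (rest @ ys) = pt"
        unfolding z by (rule args_rest1 region_rest1 ptr_rest1)+
    qed
    note args0 = args[of "[]", simplified append_Nil2] and dec0 = dec[of "[]", simplified append_Nil2]
    show "thr 2 call_code2 rest m2 R Wr (160 * (hi - lo) * (h - g) + (1 + (16 * ?S + (20 * ?S + 8 + 0))))
      (160 * (h - g) + (1 + (36 + (36 + 0)))) ?Q"
      unfolding call_code2_def append_Cons append_Nil
    proof (rule phase_groups[OF IH m2 rest(1)])
      show "AFork (calls (arg rest 0) (arg rest 1) (arg rest 2) (arg rest 3) (call_region rest) (arg rest 4) (arg rest 5)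
        (call_ptr rest) (call_tall rest) (call_info 8 2 rest) (call_info 8 3 rest)) = AFork (calls B q f d rg lo hi pt T first_child last_child)"
        unfolding args0 dec0 ..
      fix m3 gk gp gx assume m3: "mem_ok W m3" "\<And>a. pg a \<notin> own B f (Suc d) lo hi \<Longrightarrow> pg a \<notin> {rg..rg + 2 + B} \<Longrightarrow> m3 a = m a"
        and gd: "\<And>s. grp s \<Longrightarrow> group_done m3 s (gk s) (gp s) (gx s)"
      let ?f3 = "fan 9 (\<lambda>rest. jobs3 (arg rest 0) (arg rest 1) (call_height rest) (call_region rest) (arg rest 4) (arg rest 5)
        (call_ptr rest) (call_tall rest) (call_info 8 1 rest) (call_count rest))"
      let ?f4 = "fan 9 (\<lambda>rest. jobs4 (arg rest 0) (arg rest 1) (call_height rest) (call_region rest) (arg rest 4) (arg rest 5)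
        (sum (ptr_len (arg rest 4) (arg rest 5) (call_tall rest) (call_info 8 1 rest) (call_count rest))
          {arg rest 4..<Suc (arg rest 5)}) (arg rest 8) (arg rest 9))"
      show "thr 2 (read_blocks 1 (\<lambda>rest. 4 * (call_region rest + 2)) @ ?f3 @ ?f4) rest m3 R Wr
        (1 + (16 * ?S + (20 * ?S + 8 + 0))) (1 + (36 + (36 + 0))) ?Q"
      proof (rule thr_read_blocks[where j = "4 * (rg + 2)"])
        let ?ys = "map m3 [4 * (rg + 2) * B..<(4 * (rg + 2) + 1) * B]"
        assume ok: "rest_ok (rest @ ?ys)"
        have cn: "call_count (rest @ ?ys) = group_count gk"
        proof
          fix s
          show "call_count (rest @ ?ys) s = group_count gk s"
          proof (cases "grp s")
            case True
            have l: "s - lo < B" using group_end(1,2)[OF True] pre_facts(5) by linarith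
            have e: "(4 * (rg + 2) + 1) * B = 4 * (rg + 2) * B + B" by (simp add: algebra_simps)
            have "(rest @ ?ys) ! (10 + 14 * B + (s - lo)) = m3 (group_cnt s)"
              using map_upt_nth[OF l, of rest m3 "4 * (rg + 2) * B"] unfolding rest(2) e .
            also have "\<dots> = Num (length (gk s))" using gd[OF True] unfolding group_done_def by blast
            finally show ?thesis using True unfolding call_count_def args dec group_count_def by simp
          next
            case False then show ?thesis unfolding call_count_def args dec group_count_def by simp
          qed
        qed
        show "thr 2 (?f3 @ ?f4) (rest @ ?ys) m3 R Wr (16 * ?S + (20 * ?S + 8 + 0)) (36 + (36 + 0)) ?Q"
        proof (cases "h = 0")
          case True
          have "thr 2 (?f4 @ []) (rest @ ?ys) m3 R Wr (20 * ?S + 8 + 0) (36 + 0) ?Q"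
          proof (rule phase4_zero[OF True m3(1) _ ok args(1)])
            show "m3 a = m a" if "pg a < f" for a by (rule m3_old[OF m3 gd that])
            show "jobs4 (arg (rest @ ?ys) 0) (arg (rest @ ?ys) 1) (call_height (rest @ ?ys)) (call_region (rest @ ?ys)) (arg (rest @ ?ys) 4) (arg (rest @ ?ys) 5)
              (sum (ptr_len (arg (rest @ ?ys) 4) (arg (rest @ ?ys) 5) (call_tall (rest @ ?ys)) (call_info 8 1 (rest @ ?ys)) (call_count (rest @ ?ys)))
                {arg (rest @ ?ys) 4..<Suc (arg (rest @ ?ys) 5)}) (arg (rest @ ?ys) 8) (arg (rest @ ?ys) 9) =
              jobs4 B q h rg lo hi (sum (ptr_len lo hi T nkeys (group_count gk)) {lo..<Suc hi}) ret cnt"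
              unfolding args dec cn ..
            fix m5 assume "mem_ok W m5" "?Q undefined m5"
            then show "thr 2 [] (rest @ ?ys) m5 R Wr 0 0 ?Q" by (intro thr_nil ok) simp_all
          qed
          then have f4: "thr 2 ?f4 (rest @ ?ys) m3 R Wr (20 * ?S + 8 + 0) (36 + 0) ?Q" by simp
          show ?thesis
          \<comment> \<open>At height 0 there are no roots to dissolve: the forks of this round have
            no children and leave the memory unchanged.\<close>
          proof (rule thr_fan_pages[where ?js0.0 = "[]" and PR = "{}" and PW = "{}" and wk = "20 * ?S + 8 + 0" and sp = "36 + 0"])
            show "jobs3 (arg (rest @ ?ys) 0) (arg (rest @ ?ys) 1) (call_height (rest @ ?ys)) (call_region (rest @ ?ys)) (arg (rest @ ?ys) 4) (arg (rest @ ?ys) 5)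
              (call_ptr (rest @ ?ys)) (call_tall (rest @ ?ys)) (call_info 8 1 (rest @ ?ys)) (call_count (rest @ ?ys)) = []"
              unfolding dec jobs3_def using True by simp
            fix m' assume "jobs_done m3 [] m'"
            then have "m' = m3" unfolding jobs_done_def by auto
            then show "thr 2 ?f4 (rest @ ?ys) m' R Wr (20 * ?S + 8 + 0) (36 + 0) ?Q" using f4 by simp
          qed (use ok args m3(1) in simp_all)
        next
          case False
          note sq = sequence[OF m3 gd False]
          interpret jq: join_sequence B lo hi T X "(!) ks" rp rx rk gp gx gk "tree_at B m3 D1 (h - 1) (B div 2)" by (rule sq)
          note ln = lengths[OF m3 gd False]
          show ?thesis
          proof (rule phase3[OF m3 gd False ok args(1)])
            show "jobs3 (arg (rest @ ?ys) 0) (arg (rest @ ?ys) 1) (call_height (rest @ ?ys)) (call_region (rest @ ?ys)) (arg (rest @ ?ys) 4) (arg (rest @ ?ys) 5)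
              (call_ptr (rest @ ?ys)) (call_tall (rest @ ?ys)) (call_info 8 1 (rest @ ?ys)) (call_count (rest @ ?ys)) =
              jobs3 B q h rg lo hi pt T nkeys (group_count gk)" unfolding args dec cn ..
            fix m4 assume m4: "mem_ok W m4" "\<And>a. pg a \<notin> {rg + 3 + B..<rg + 7 + 3 * B} \<Longrightarrow> m4 a = m3 a"
              "stored m4 PB (map Num (jq.all_ptrs (Suc hi)))" "stored m4 KB (map Key (jq.all_keys (Suc hi)))"
            have "thr 2 (?f4 @ []) (rest @ ?ys) m4 R Wr (20 * ?S + 8 + 0) (36 + 0) ?Q"
            proof (rule phase4_pos[OF False m4(1,3,4) _ _ _ _ jq.regroup(2) ok args(1)])
              show "list_all2 (tree_at B m4 D1 (h - 1) (B div 2)) (jq.all_ptrs (Suc hi)) (jq.all_trees (Suc hi))"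
              proof (rule list_all2_mono[OF jq.all_P[OF order_refl]])
                fix p t assume "tree_at B m3 D1 (h - 1) (B div 2) p t"
                then show "tree_at B m4 D1 (h - 1) (B div 2) p t"
                proof (rule tree_at_cong)
                  show "m4 a = m3 a" if a: "pg a \<in> D1" for a
                  proof (rule m4(2))
                    show "pg a \<notin> {rg + 3 + B..<rg + 7 + 3 * B}"
                    proof
                      assume p: "pg a \<in> {rg + 3 + B..<rg + 7 + 3 * B}"
                      then have "pg a \<notin> own B f (Suc d) lo hi" by (intro region_pages(2)) simp_all
                      then show False using a p rg_ge by auto
                    qed
                  qed
                qed (use B_ge in simp_all)
              qed
              show "length (jq.all_ptrs (Suc hi)) = Suc (length (jq.all_keys (Suc hi)))"
                using ln(3)[of "Suc hi"] ln(4)[of "Suc hi"] ln(7) by simp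
              show "length (jq.all_ptrs (Suc hi)) \<le> Suc (hi - lo) * Suc B"
                using ln(3)[of "Suc hi"] ln(8) by simp
              obtain j where "lo \<le> j" "j \<le> hi" "T j" "L \<le> length (rk j)" using tallest_keys[OF False] by blast
              then show "L \<le> length (jq.all_keys (Suc hi))" using jq.length_all_keys[of j] by simp
              show "jobs4 (arg (rest @ ?ys) 0) (arg (rest @ ?ys) 1) (call_height (rest @ ?ys)) (call_region (rest @ ?ys)) (arg (rest @ ?ys) 4) (arg (rest @ ?ys) 5)
                (sum (ptr_len (arg (rest @ ?ys) 4) (arg (rest @ ?ys) 5) (call_tall (rest @ ?ys)) (call_info 8 1 (rest @ ?ys)) (call_count (rest @ ?ys)))
                  {arg (rest @ ?ys) 4..<Suc (arg (rest @ ?ys) 5)}) (arg (rest @ ?ys) 8) (arg (rest @ ?ys) 9) =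
                jobs4 B q h rg lo hi (length (jq.all_ptrs (Suc hi))) ret cnt"
                using ln(3)[of "Suc hi"] unfolding args dec cn by (simp del: sum.op_ivl_Suc)
              fix m5 assume "mem_ok W m5" "?Q undefined m5"
              then show "thr 2 [] (rest @ ?ys) m5 R Wr 0 0 ?Q" by (intro thr_nil ok) simp_all
            qed
            then show "thr 2 ?f4 (rest @ ?ys) m4 R Wr (20 * ?S + 8 + 0) (36 + 0) ?Q" by simp
          qed
        qed
      next
        show "4 * (call_region (rest @ ys) + 2) = 4 * (rg + 2)" for ys unfolding args ..
        have "(4 * (rg + 2)) div 4 = rg + 2" by simp
        then have "4 * (rg + 2) \<in> R" using region_pages(1)[of "rg + 2"] in_R(2)[of "4 * (rg + 2)"] by auto
        moreover have "x = 4 * (rg + 2)" if "x \<in> {4 * (rg + 2)..<4 * (rg + 2) + 1}" for x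
          using that unfolding atLeastLessThan_iff by linarith
        ultimately show "{4 * (rg + 2)..<4 * (rg + 2) + 1} \<subseteq> R" by blast
        show "length rest + 1 * B \<le> 62 * B" using rest(2) B_ge by simp
      qed (use rest m3 in auto)
    qed
  qed
  then have "thr 2 call_code rest0 m R Wr (160 * (hi - lo) * (Suc h - g)) (160 * (Suc h - g)) ?Q"
  \<comment> \<open>Apart from the recursive calls, the span is
    \<open>86 + 1 + 36 + 36 = 159\<close>. The work is \<open>23 + 48 * ?S\<close>, where
    \<open>?S \<le> 2 * (hi - lo)\<close>, hence at most \<open>119 * (hi - lo)\<close>. Both fit
    into the 160 allotted to one level.\<close>
  proof (rule thr_weaken)
    have "Suc h - g = Suc (h - g)" using gh by simp
    then show "14 + 12 * ?S + (160 * (hi - lo) * (h - g) + (1 + (16 * ?S + (20 * ?S + 8 + 0)))) \<le> 160 * (hi - lo) * (Suc h - g)"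
      "86 + (160 * (h - g) + (1 + (36 + (36 + 0)))) \<le> 160 * (Suc h - g)"
      using pre_facts(3) by simp_all
  qed auto
  moreover have "codes 2 = (call_code :: 'a code)" unfolding codes_def by simp
  ultimately have "thr 2 (codes 2) rest0 m R Wr (160 * (hi - lo) * (Suc h - g)) (160 * (Suc h - g)) ?Q" by simp
  from thr_start[OF this] show ?thesis by simp
qed

end

lemma (in btree_join) call_spec: "call_spec h"
proof (induction h rule: less_induct)
  case (less h)
  show ?case unfolding call_spec_def
  proof (intro allI impI)
    fix m d lo hi pL pR ret cnt L g X H assume "call_pre m d lo hi pL pR ret cnt h L g X H"
    then interpret jc: join_call M B W q f b ks ops m d lo hi pL pR ret cnt h L g X H
      by (intro join_call.intro btree_join_axioms join_call_axioms.intro)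
    show "runs M (interp codes) (map Num [2, 0, B, q, f, d, lo, hi, pL, pR, ret, cnt]) m
      (call_reads d lo hi) (call_writes d lo hi ret cnt)
      (160 * (hi - lo) * (Suc h - g)) (160 * (Suc h - g))
      (\<lambda>_ m'. call_result m' (D0 \<union> own B f d lo hi) h L lo hi X ret cnt)"
      using less by (intro jc.call_runs) simp
  qed
qed

section \<open>The main thread\<close>

lemma (in fork_join) thr_stop:
  assumes "rest_ok rest" "t < 4" "mem_ok W m" "i rest = AStop p" "p < W" "Q [Num p] m"
  shows "thr t (i # is) rest m R Wr wk sp Q"
  unfolding thr_def
proof (intro allI impI)
  fix pc assume pc: "pc \<le> length (cd t)" "drop pc (cd t) = i # is"
  show "runs M (interp cd) (Num t # Num pc # rest) m R Wr wk sp Q"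
  proof (rule runs_fork[where ls = "[]" and l' = "[Num p]" and ?sp1.0 = 0 and wk = wk and sp = sp
        and Rs = "\<lambda>_. {}" and Ws = "\<lambda>_. {}" and wks = "\<lambda>_. 0" and Qs = "\<lambda>_ _. True"])
    show "local_ok M (Num t # Num pc # rest)" by (rule local_okI[OF assms(1,2) pc(1)])
    show "interp cd (Num t # Num pc # rest) = Fork [] [Num p]"
      using interp_step[OF assms(1) pc(2)] assms(4) by simp
    show "word_keys (\<Union> (set ` set []) \<union> set [Num p]) \<subseteq> word_keys (set (Num t # Num pc # rest))"
      by (simp add: word_keys_def)
    fix m' assume m': "mem_ok (word_bound M) m'" "\<And>a. \<forall>j<length ([]::'k local list). a \<notin> {} \<Longrightarrow> m' a = m a"
    then have "m' = m" by auto
    have "1 * 1 \<le> cache M * B" using cache_ge B_ge by (intro mult_le_mono) auto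
    then have "local_ok M [Num p]" using assms(5) unfolding local_ok_def words_ok_def by simp
    then show "runs M (interp cd) [Num p] m' R Wr wk sp Q"
      using assms(3,6) \<open>m' = m\<close> by (intro runs_halt) (auto simp: interp_def)
  qed (use assms in auto)
qed

text \<open>The four initial words carry no code number; the free step for length 4 puts code 0 and
  program counter 0 in front of them.\<close>

lemma runs_init:
  assumes "fork_join M B W cd" "fork_join.thr M cd 0 (cd 0) [a1, a2, a3, a4] m R Wr wk sp Q"
    "words_ok M {a1, a2, a3, a4}" "mem_ok W m"
  shows "runs M (interp cd) [a1, a2, a3, a4] m R Wr wk sp Q"
proof -
  interpret fork_join M B W cd by (rule assms(1))
  show ?thesis
  proof (rule runs_fork[where ls = "[]" and l' = "[Num 0, Num 0, a1, a2, a3, a4]" and ?sp1.0 = 0 and wk = wk and sp = sp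
        and Rs = "\<lambda>_. {}" and Ws = "\<lambda>_. {}" and wks = "\<lambda>_. 0" and Qs = "\<lambda>_ _. True"])
    have "64 * 2 \<le> cache M * B" using cache_ge B_ge by (intro mult_le_mono) auto
    then show "local_ok M [a1, a2, a3, a4]" using assms(3) unfolding local_ok_def by simp
    show "interp cd [a1, a2, a3, a4] = Fork [] [Num 0, Num 0, a1, a2, a3, a4]" unfolding interp_def by simp
    show "word_keys (\<Union> (set ` set []) \<union> set [Num 0, Num 0, a1, a2, a3, a4]) \<subseteq> word_keys (set [a1, a2, a3, a4])"
      by (simp add: word_keys_def)
    fix m' assume m': "\<And>a. \<forall>j<length ([]::'a local list). a \<notin> {} \<Longrightarrow> m' a = m a"
    then have "m' = m" by auto
    then show "runs M (interp cd) [Num 0, Num 0, a1, a2, a3, a4] m' R Wr wk sp Q"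
      using assms(2) unfolding thr_def by simp
  qed (use assms(4) in auto)
qed

context btree_join begin

abbreviation "root_page \<equiv> region B f 0 B"

text \<open>The region of depth 0 and separator \<open>B\<close> lies outside the area of the
  outermost call, whose separators are below \<open>b \<le> B\<close>.\<close>

lemma root_page:
  shows "f \<le> root_page" "root_page \<notin> own B f d lo b" "root_page + 1 \<notin> own B f d lo b"
    "root_page + 1 < page_limit B f"
proof -
  have z: "0 < region_size B" "1 < region_size B" unfolding region_size_def by auto
  show "f \<le> root_page" unfolding region_def by simp
  show "root_page \<notin> own B f d lo b" "root_page + 1 \<notin> own B f d lo b"
    using region_not_own[OF z(1), where l = B and hi = b] region_not_own[OF z(2), where l = B and hi = b] b(2) by auto
  have "Suc B * region_size B \<le> Suc f * Suc B * region_size B" by (intro mult_right_mono) auto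
  then have "B * region_size B + region_size B \<le> Suc f * Suc B * region_size B" by (simp only: mult_Suc add.commute)
  then show "root_page + 1 < page_limit B f" unfolding region_def page_limit_def mult_0 add_0 using z(2) by linarith
qed

text \<open>The 4 extra transfers are the two pointer blocks before the call and the header and
  first pointer block of the result page after it.\<close>

lemma main_runs:
  assumes "input_mem m" and pre: "call_pre m 0 0 b (ops ! 0) (ops ! b) root_page (4 * (root_page + 1) * B) h 1 g X H"
    and qw: "q < W" "f < W"
  shows "runs M (interp codes) [Num B, Num b, Num q, Num f] m UNIV UNIV
    (160 * b * (Suc h - g) + 4) (160 * (Suc h - g) + 4)
    (\<lambda>l m'. \<exists>p h' D. l = [Num p] \<and> D \<subseteq> {p. 4 * p + 4 \<le> 4 * page_limit B f} \<and>
       tree_at B m' D h' 1 p (weave (map X [0..<Suc b]) ks))"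
    (is "runs _ _ _ _ _ _ ?wk ?sp ?Q")
proof -
  let ?cnt = "4 * (root_page + 1) * B"
  let ?r0 = "map Num [B, b, q, f] :: 'k word list"
  have m: "mem_ok W m" using assms(1) unfolding input_mem_def by simp
  have lim: "Suc (page_limit B f) \<le> W"
  proof -
    have "1 * Suc (page_limit B f) \<le> 4 * B * Suc (page_limit B f)" by (intro mult_right_mono) (use B_ge in auto)
    from order_trans[OF this W] show ?thesis by simp
  qed
  have "4 * B * 1 \<le> 4 * B * Suc (page_limit B f)" by (intro mult_left_mono) auto
  then have BW: "B < W" "b < W" using W b(2) B_ge by linarith+
  have r0: "rest_ok ?r0" using BW qw B_ge by (intro rest_ok_map_Num) auto
  let ?r1 = "?r0 @ map m [(q + 1) * B..<(q + 1 + 2) * B]"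
  have a: "arg (?r0 @ ys) 0 = B" "arg (?r0 @ ys) 1 = b" "arg (?r0 @ ys) 2 = q" "arg (?r0 @ ys) 3 = f"
    "main_ret (?r0 @ ys) = root_page" for ys
    unfolding main_ret_def by simp_all
  have ptr: "arg (?r1 @ ys) (4 + j) = ops ! j" if "j \<le> b" for j ys
  proof -
    have j: "j < 2 * B" using that b(2) B_ge by linarith
    have e: "(q + 1 + 2) * B = (q + 1) * B + 2 * B" by (simp add: algebra_simps)
    have l: "length ?r0 = 4" by simp
    have "?r1 ! (4 + j) = m ((q + 1) * B + j)"
      using map_upt_nth[OF j, of ?r0 m "(q + 1) * B"] unfolding e l .
    moreover have "(?r1 @ ys) ! (4 + j) = ?r1 ! (4 + j)"
      by (rule nth_append_left) (use j in \<open>simp add: algebra_simps\<close>)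
    moreover have "m ((q + 1) * B + j) = Num (ops ! j)"
      using assms(1) that b(4) unfolding input_mem_def stored_def by simp
    ultimately show ?thesis by simp
  qed
  let ?call = "[2, 0, B, q, f, 0, 0, b, ops ! 0, ops ! b, root_page, ?cnt]"
  let ?i1 = "\<lambda>rest :: 'k word list. AFork [[2, 0, arg rest 0, arg rest 2, arg rest 3, 0, 0, arg rest 1, arg rest 4, arg rest (4 + arg rest 1),
        main_ret rest, 4 * (main_ret rest + 1) * arg rest 0]] :: 'k act"
  let ?i2 = "\<lambda>rest :: 'k word list. AStop (if arg rest (4 + 2 * arg rest 0 + 1) = 0 then arg rest (4 + 3 * arg rest 0) else main_ret rest) :: 'k act"
  have "thr 0 (read_blocks 2 (\<lambda>rest. arg rest 2 + 1) @ [?i1] @ read_blocks 1 (\<lambda>rest. 4 * main_ret rest) @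
     read_blocks 1 (\<lambda>rest. 4 * main_ret rest + 2) @ [?i2]) ?r0 m UNIV UNIV
     (2 + (160 * b * (Suc h - g) + (1 + (1 + 0)))) (2 + (160 * (Suc h - g) + (1 + (1 + 0)))) ?Q"
  proof (rule thr_read_blocks[where j = "q + 1"])
    show "arg (?r0 @ ys) 2 + 1 = q + 1" for ys by simp
    assume r1: "rest_ok ?r1"
    show "thr 0 ([?i1] @ read_blocks 1 (\<lambda>rest. 4 * main_ret rest) @ read_blocks 1 (\<lambda>rest. 4 * main_ret rest + 2) @ [?i2]) ?r1 m UNIV UNIV
      (160 * b * (Suc h - g) + (1 + (1 + 0))) (160 * (Suc h - g) + (1 + (1 + 0))) ?Q"
      unfolding append_Cons append_Nil
    proof (rule thr_fork[where ls = "[?call]" and Rs = "\<lambda>_. call_reads 0 0 b" and Ws = "\<lambda>_. call_writes 0 0 b root_page ?cnt"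
          and wks = "\<lambda>_. 160 * b * (Suc h - g)" and ?sp1.0 = "160 * (Suc h - g)"
          and Qs = "\<lambda>_ m'. call_result m' (D0 \<union> own B f 0 0 b) h 1 0 b X root_page ?cnt" and wk = "1 + (1 + 0)" and sp = "1 + (1 + 0)"])
      show "?i1 ?r1 = AFork [?call]"
        using a[of "map m [(q + 1) * B..<(q + 1 + 2) * B]"] ptr[of 0 "[]"] ptr[of b "[]"] by simp
      show "runs M (interp codes) (map Num ([?call] ! i)) m (call_reads 0 0 b) (call_writes 0 0 b root_page ?cnt)
          (160 * b * (Suc h - g)) (160 * (Suc h - g))
          (\<lambda>_ m'. call_result m' (D0 \<union> own B f 0 0 b) h 1 0 b X root_page ?cnt)" if "i < length [?call]" for i
        using call_spec[of h] pre that unfolding call_spec_def by fastforce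
      fix m3 assume m3: "mem_ok W m3" "\<And>i. i < length [?call] \<Longrightarrow> \<exists>mi. call_result mi (D0 \<union> own B f 0 0 b) h 1 0 b X root_page ?cnt \<and>
          (\<forall>a. (\<forall>j<length [?call]. j \<noteq> i \<longrightarrow> a \<notin> call_writes 0 0 b root_page ?cnt) \<longrightarrow> m3 a = mi a)"
      obtain mi where "call_result mi (D0 \<union> own B f 0 0 b) h 1 0 b X root_page ?cnt" "\<And>a. m3 a = mi a"
        using m3(2)[of 0] by auto
      then have "call_result m3 (D0 \<union> own B f 0 0 b) h 1 0 b X root_page ?cnt" by (metis ext)
      then obtain ks' ps xss where cr: "length ps = Suc (length ks')" "length ps \<le> Suc b" "node_at B m3 root_page (Suc h) ks' ps"
        "list_all2 (tree_at B m3 (D0 \<union> own B f 0 0 b) h (if ks' = [] then 1 else B div 2)) ps xss"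
        "weave xss ks' = weave (map X [0..<Suc b]) (map ((!) ks) [0..<b])"
        unfolding call_result_def by auto
      have kseq: "map ((!) ks) [0..<b] = ks" using b(3) map_nth[of ks] by simp
      let ?r2 = "?r1 @ map m3 [4 * root_page * B..<(4 * root_page + 1) * B]"
      let ?r3 = "?r2 @ map m3 [(4 * root_page + 2) * B..<(4 * root_page + 2 + 1) * B]"
      have a1: "main_ret (?r1 @ ys) = root_page" for ys using a(5) by simp
      show "thr 0 (read_blocks 1 (\<lambda>rest. 4 * main_ret rest) @ read_blocks 1 (\<lambda>rest. 4 * main_ret rest + 2) @ [?i2]) ?r1 m3 UNIV UNIV
        (1 + (1 + 0)) (1 + (1 + 0)) ?Q"
      proof (rule thr_read_blocks[where j = "4 * root_page"])
        show "4 * main_ret (?r1 @ ys) = 4 * root_page" for ys unfolding a1 ..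
        assume r2: "rest_ok ?r2"
        show "thr 0 (read_blocks 1 (\<lambda>rest. 4 * main_ret rest + 2) @ [?i2]) ?r2 m3 UNIV UNIV (1 + 0) (1 + 0) ?Q"
        proof (rule thr_read_blocks[where j = "4 * root_page + 2"])
          show "4 * main_ret (?r2 @ ys) + 2 = 4 * root_page + 2" for ys using a1 by simp
          assume r3: "rest_ok ?r3"
          have l1: "length ?r1 = 4 + 2 * B" by (simp add: algebra_simps)
          have l2: "length ?r2 = 4 + 3 * B" using l1 by (simp add: algebra_simps)
          have n0: "arg ?r3 (4 + 2 * B + 1) = length ks'"
          proof -
            have e: "(4 * root_page + 1) * B = 4 * root_page * B + B" by (simp add: algebra_simps)
            have "?r2 ! (4 + 2 * B + 1) = m3 (4 * root_page * B + 1)"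
              using map_upt_nth[of 1 B ?r1 m3 "4 * root_page * B"] B_ge unfolding l1 e by simp
            moreover have "?r3 ! (4 + 2 * B + 1) = ?r2 ! (4 + 2 * B + 1)"
              by (rule nth_append_left) (use l2 B_ge in linarith)
            ultimately show ?thesis using cr(3) unfolding node_at_iff by simp
          qed
          have n1: "arg ?r3 (4 + 3 * B) = ps ! 0"
          proof -
            have e: "(4 * root_page + 2 + 1) * B = (4 * root_page + 2) * B + B" "(4 * root_page + 2) * B = 4 * root_page * B + 2 * B"
              by (simp_all add: algebra_simps)
            have "?r3 ! (4 + 3 * B + 0) = m3 ((4 * root_page + 2) * B + 0)"
              using map_upt_nth[of 0 B ?r2 m3 "(4 * root_page + 2) * B"] B_ge unfolding l2 e(1) by simp
            moreover have "\<forall>i<length ps. m3 (4 * root_page * B + 2 * B + i) = Num (ps ! i)"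
              using cr(3) unfolding node_at_iff by (elim conjE)
            then have "m3 (4 * root_page * B + 2 * B + 0) = Num (ps ! 0)" using cr(1) by (elim allE[of _ 0]) simp
            ultimately show ?thesis unfolding e(2) add_0_right by simp
          qed
          have rp3: "arg ?r3 0 = B" "main_ret ?r3 = root_page" using a by simp_all
          define p where "p = (if ks' = [] then ps ! 0 else root_page)"
          have i2: "?i2 ?r3 = AStop p" unfolding rp3 n0 n1 p_def by simp
          let ?D = "insert root_page (D0 \<union> own B f 0 0 b)"
          have Dl: "x < page_limit B f" if "x \<in> ?D" for x
            using that own_lt[of x B f 0 0 b] root_page(4) unfolding page_limit_def by auto
          have lx: "length xss = length ps" using cr(4) by (auto dest: list_all2_lengthD)
          have ins: "tree_at B m3 ?D hh l y t" if "tree_at B m3 (D0 \<union> own B f 0 0 b) hh l y t" for hh l y t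
            by (rule tree_at_cong[OF that]) (use B_ge in auto)
          have tr: "\<exists>h'. tree_at B m3 ?D h' 1 p (weave (map X [0..<Suc b]) ks)"
          proof (cases "ks' = []")
            case True
            then obtain y t where yt: "ps = [y]" "xss = [t]" using cr(1) lx by (auto simp: length_Suc_conv)
            then have "tree_at B m3 ?D h 1 y t" using cr(4) True ins by simp
            then show ?thesis using cr(5) yt True kseq unfolding p_def by auto
          next
            case False
            have "root_page \<noteq> 0" using root_page(1) b(5) by linarith
            moreover have "tree_at B m3 ?D h (B div 2) (ps ! i) (xss ! i)" if "i < length ps" for i
              using ins list_all2_nthD[OF cr(4) that] False by simp
            moreover have "1 \<le> length ks'" "length ks' \<le> B" using False cr(1,2) b(2) by (auto simp: Suc_le_eq)
            ultimately have "tree_at B m3 ?D (Suc h) 1 root_page (weave (map X [0..<Suc b]) ks)"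
              unfolding tree_at.simps using cr(1,3,5) lx kseq
              by (intro conjI exI[of _ ks'] exI[of _ ps] exI[of _ xss]) auto
            moreover have "p = root_page" using False unfolding p_def by simp
            ultimately show ?thesis by blast
          qed
          have pW: "p < W"
          proof -
            obtain h' where "tree_at B m3 ?D h' 1 p (weave (map X [0..<Suc b]) ks)" using tr by blast
            then have "p = 0 \<or> p \<in> ?D" by (cases h') auto
            then show ?thesis using Dl[of p] lim W_ge by auto
          qed
          have "?D \<subseteq> {p. 4 * p + 4 \<le> 4 * page_limit B f}" using Dl by fastforce
          then have Q: "?Q [Num p] m3" using tr by blast
          show "thr 0 [?i2] ?r3 m3 UNIV UNIV 0 0 ?Q"
            by (rule thr_stop[where p = p], rule r3, simp, rule m3(1), rule i2, rule pW, rule Q)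
        qed (use r2 m3 B_ge in \<open>auto simp: algebra_simps\<close>)
      qed (use r1 m3 B_ge in \<open>auto simp: algebra_simps\<close>)
    qed (use r1 m B_ge in auto)
  qed (use r0 m B_ge in auto)
  then have "thr 0 main_code ?r0 m UNIV UNIV ?wk ?sp ?Q" unfolding main_code_def by (rule thr_weaken) simp_all
  moreover have "codes 0 = (main_code :: 'k code)" unfolding codes_def by simp
  ultimately have t: "thr 0 (codes 0) [Num B, Num b, Num q, Num f] m UNIV UNIV ?wk ?sp ?Q" by simp
  show ?thesis
    by (rule runs_init[OF fork_join_axioms t]) (use BW qw m in \<open>auto simp: words_ok_def\<close>)
qed

end

text \<open>With \<open>s = B + f\<close>, a region has at most \<open>6 * s\<close> pages and there
  are at most \<open>s * s\<close> regions, so \<open>page_limit B f\<close> is at most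
  \<open>s + 6 * s ^ 3\<close>. The remaining estimates \<open>7 * s ^ 3 \<le> s ^ 5\<close> and
  \<open>4 * B \<le> s ^ 2\<close> come from \<open>5 \<le> s\<close>.\<close>

lemma power_bound:
  fixes B f :: nat
  assumes "2 \<le> B" "3 \<le> f"
  shows "4 * B * Suc (page_limit B f) \<le> (B + f) ^ 7"
proof -
  define s where "s = B + f"
  have s: "5 \<le> s" "B \<le> s" "Suc B \<le> s" "f \<le> s" "Suc f \<le> s" unfolding s_def using assms by auto
  have z: "region_size B \<le> 4 * s + 8" unfolding region_size_def using s by simp
  then have z: "region_size B \<le> 6 * s" using s(1) by linarith
  have s2: "5 * s \<le> s ^ 2" "25 * s \<le> s ^ 3"
    using mult_right_mono[OF s(1), of s] mult_mono[OF s(1) mult_right_mono[OF s(1), of s]]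
    by (simp_all add: power2_eq_square power3_eq_cube)
  have "Suc f * Suc B * region_size B \<le> s * s * (6 * s)"
    using s z by (intro mult_le_mono) auto
  then have "Suc (page_limit B f) \<le> Suc s + 6 * s ^ 3" unfolding page_limit_def using s(4) by (simp add: power3_eq_cube)
  also have "\<dots> \<le> 7 * s ^ 3" using s2(2) s(1) by linarith
  also have "\<dots> \<le> s ^ 2 * s ^ 3" using s2(1) s(1) by (intro mult_right_mono) linarith+
  finally have 1: "Suc (page_limit B f) \<le> s ^ 5" by (simp add: power_add[symmetric])
  have "4 * B \<le> s ^ 2" using s2(1) s(2) by linarith
  then have "4 * B * Suc (page_limit B f) \<le> s ^ 2 * s ^ 5" using 1 by (rule mult_le_mono)
  then show ?thesis unfolding s_def by (simp add: power_add[symmetric])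
qed

theorem mainTheorem2:
  shows "\<exists>(P :: 'k::linorder program) (c :: nat).
    \<forall>(B::nat) (b::nat) (ks :: 'k list) (ts :: 'k btree list) (m :: 'k mem)
      (q::nat) (f::nat) (W::nat).
      2 \<le> B \<longrightarrow> 1 \<le> b \<longrightarrow> b \<le> B \<longrightarrow>
      length ks = b \<longrightarrow> length ts = b + 1 \<longrightarrow>
      (\<forall>t\<in>set ts. B_tree B t) \<longrightarrow> separated ks ts \<longrightarrow>
      join_input B m f q ks ts \<longrightarrow>
      (B + f) ^ c \<le> W \<longrightarrow> (\<forall>a v. m a = Num v \<longrightarrow> v < W) \<longrightarrow>
      (\<exists>r p f' T.
        exec (fork_join_machine c B (card (join_keys ks ts)) W) P
             [Num B, Num b, Num q, Num f] m r \<and>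
        final_local r = [Num p] \<and> btree_at B (final_mem r) f' p T \<and>
        B_tree B T \<and> tree_keys T = join_keys ks ts \<and>
        io_span r \<le> c * max 1 (h_max ts - h_min ts) \<and>
        io_work r \<le> c * (b * max 1 (h_max ts - h_min ts)))"
\<comment> \<open>The constant 400 exceeds the cost factor \<open>2 * 160 + 4 = 324\<close>, the
  exponent 7 of \<open>power_bound\<close>, and the 64 blocks and argument words that
  \<open>fork_join\<close> asks for.\<close>
proof (intro exI[of _ "interp codes"] exI[of _ 400] allI impI)
  fix B b :: nat and ks :: "'k list" and ts :: "'k btree list" and m :: "'k mem" and q f W :: nat
  assume B: "2 \<le> B" and b: "1 \<le> b" "b \<le> B" and lens: "length ks = b" "length ts = b + 1"
    and ts: "\<forall>t\<in>set ts. B_tree B t" and sep: "separated ks ts" and inp: "join_input B m f q ks ts"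
    and W: "(B + f) ^ 400 \<le> W" and mok: "\<forall>a v. m a = Num v \<longrightarrow> v < W"
  let ?M = "fork_join_machine 400 B (card (join_keys ks ts)) W"
  let ?h = "h_max ts" and ?g = "h_min ts"
  from inp obtain ops where qf: "q + 3 \<le> f" and st: "stored m (q * B) (map Key ks)" "stored m ((q + 1) * B) (map Num ops)"
    and ops: "length ops = length ts" "\<And>i. i < length ts \<Longrightarrow> btree_at B m f (ops ! i) (ts ! i)"
    unfolding join_input_def by auto
  have pw: "(B + f) ^ 7 \<le> W" by (rule order_trans[OF power_increasing W]) (use B in simp_all)
  have s5: "5 \<le> B + f" using B qf by simp
  have "(5::nat) ^ 7 \<le> (B + f) ^ 7" by (rule power_mono[OF s5]) simp
  then have W60: "60 < W" using pw by simp
  have lim: "4 * B * Suc (page_limit B f) \<le> W" using power_bound[OF B] qf pw by (meson le_trans le_add2)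
  interpret bj: btree_join ?M B W q f b ks ops
  proof
    show "length (codes t :: 'k code) < W" for t using length_codes[of t] W60 by (meson le_less_trans)
    show "(codes 1 :: 'k code) = job_code" unfolding codes_def by simp
  qed (use B b lens ops qf lim W60 in \<open>auto simp: fork_join_machine_def\<close>)
  have im: "bj.input_mem m" unfolding bj.input_mem_def mem_ok_def using st mok by simp
  have "\<forall>i. \<exists>xs. i < length ts \<longrightarrow> tree_at B m bj.D0 (height (ts ! i)) 1 (ops ! i) xs \<and> set xs = tree_keys (ts ! i) \<and> sorted_wrt (<) xs"
    using btree_at_tree_at[of B 1 _ m f] ts ops(2) unfolding B_tree_def by (metis nth_mem)
  then obtain X where X: "\<And>i. i < length ts \<Longrightarrow> tree_at B m bj.D0 (height (ts ! i)) 1 (ops ! i) (X i)"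
    "\<And>i. i < length ts \<Longrightarrow> set (X i) = tree_keys (ts ! i)" "\<And>i. i < length ts \<Longrightarrow> sorted_wrt (<) (X i)" by metis
  define H where "H = (\<lambda>j. if j \<le> b then height (ts ! j) else 0)"
  have hts: "height ` set ts = (\<lambda>i. height (ts ! i)) ` {..b}"
    using lens(2) by (auto simp: set_conv_nth less_Suc_eq_le)
  have hb: "?g \<le> height (ts ! j) \<and> height (ts ! j) \<le> ?h" if "j \<le> b" for j
    unfolding h_min_def h_max_def hts using that by auto
  have "?h \<in> (\<lambda>i. height (ts ! i)) ` {..b}" unfolding h_max_def hts by (rule Max_in) auto
  then obtain jm where jm: "jm \<le> b" "height (ts ! jm) = ?h" by auto
  have fin: "bj.D0 \<subseteq> {..<f}" by auto
  \<comment> \<open>The input trees use pages below \<open>f\<close> only, which bounds their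
    heights and thereby the depth of the recursion.\<close>
  have "?h \<le> card bj.D0"
    using tree_at_height_le[OF X(1)[of jm]] jm lens(2) finite_subset[OF fin] by simp
  also have "\<dots> \<le> card {..<f}" by (rule card_mono[OF _ fin]) simp
  finally have hf: "?h \<le> f" by simp
  have tp: "bj.tree_ptr 0 b (ops ! 0) (ops ! b) j = ops ! j" if "j \<le> b" for j
    using that unfolding bj.tree_ptr_def by auto
  have pgc: "4 * (bj.root_page + 1) * B div (4 * B) = bj.root_page + 1"
    using page_div[of 0 B "bj.root_page + 1"] B by simp
  have pre: "bj.call_pre m 0 0 b (ops ! 0) (ops ! b) bj.root_page (4 * (bj.root_page + 1) * B) ?h 1 ?g X H"
    unfolding bj.call_pre_def pgc
  proof (intro conjI allI impI)
    show "tree_at B m bj.D0 (H j) 1 (bj.tree_ptr 0 b (ops ! 0) (ops ! b) j) (X j)" "?g \<le> H j" "H j \<le> ?h" if "0 \<le> j \<and> j \<le> b" for j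
      using that X(1)[of j] hb[of j] tp[of j] lens(2) unfolding H_def by auto
    show "\<exists>j\<ge>0. j \<le> b \<and> H j = ?h \<and> tree_at B m bj.D0 ?h 1 (bj.tree_ptr 0 b (ops ! 0) (ops ! b) j) (X j)"
      using jm X(1)[of jm] tp[of jm] lens(2) unfolding H_def by (intro exI[of _ jm]) auto
    show "H j = 0" if "j < 0 \<or> b < j" for j using that unfolding H_def by auto
  qed (use im b hf B bj.root_page in auto)
  have "page_limit B f < W"
  proof -
    have "1 * Suc (page_limit B f) \<le> 4 * B * Suc (page_limit B f)" using B by (intro mult_right_mono) auto
    from order_trans[OF this lim] show ?thesis by simp
  qed
  then have qw: "q < W" "f < W" using qf unfolding page_limit_def by auto
  from bj.main_runs[OF im pre qw] obtain r p h' D where r: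
    "exec ?M (interp codes) [Num B, Num b, Num q, Num f] m r"
    "io_work r \<le> 160 * b * (Suc ?h - ?g) + 4" "io_span r \<le> 160 * (Suc ?h - ?g) + 4" "final_local r = [Num p]"
    "D \<subseteq> {p. 4 * p + 4 \<le> 4 * page_limit B f}" "tree_at B (final_mem r) D h' 1 p (weave (map X [0..<Suc b]) ks)"
    unfolding runs_def by blast
  have lX: "length (map X [0..<Suc b]) = Suc (length ks)" using lens(1) by simp
  have srt: "sorted_wrt (<) (weave (map X [0..<Suc b]) ks)"
    unfolding sorted_weave[OF lX]
  proof (intro conjI allI impI ballI)
    show "sorted_wrt (<) x" if "x \<in> set (map X [0..<Suc b])" for x using that X(3) lens(2) by auto
    show "sorted_wrt (<) ks" using sep unfolding separated_def by simp
    fix i assume i: "i < length ks"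
    then have e: "map X [0..<Suc b] ! i = X i" "map X [0..<Suc b] ! Suc i = X (Suc i)"
      using lens(1) by (simp_all del: upt_Suc)
    show "x < ks ! i" if "x \<in> set (map X [0..<Suc b] ! i)" for x
      using that sep i X(2)[of i] lens unfolding e separated_def by auto
    show "ks ! i < y" if "y \<in> set (map X [0..<Suc b] ! Suc i)" for y
      using that sep i X(2)[of "Suc i"] lens unfolding e separated_def by auto
  qed
  have "(\<Union>x\<in>set (map X [0..<Suc b]). set x) = (\<Union>i<length ts. tree_keys (ts ! i))"
    using X(2) lens(2) by (auto simp del: upt_Suc simp: atLeast0LessThan)
  also have "\<dots> = (\<Union>t\<in>set ts. tree_keys t)" by (auto simp: set_conv_nth)
  finally have keys: "set (weave (map X [0..<Suc b]) ks) = join_keys ks ts"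
    unfolding set_weave[OF lX] join_keys_def by blast
  obtain T where T: "btree_at B (final_mem r) (4 * page_limit B f) p T" "node_bounds B 1 T" "external_depths T = {h'}"
    "tree_keys T = join_keys ks ts"
    using tree_at_btree_at[OF r(6) srt r(5)] keys by auto
  have gh: "?g \<le> ?h" using hb[of 0] by linarith
  \<comment> \<open>Trees of equal height still require one level, whence the maximum with 1 and the
    factor 2 in the estimate of \<open>Suc ?h - ?g\<close>.\<close>
  define mx where "mx = max 1 (?h - ?g)"
  have mx: "1 \<le> mx" "Suc ?h - ?g \<le> 2 * mx" unfolding mx_def using gh by auto
  have "io_span r \<le> 400 * mx" using r(3) mx by linarith
  moreover have "io_work r \<le> 400 * (b * mx)"
  proof -
    have "b * (Suc ?h - ?g) \<le> b * (2 * mx)" using mx(2) by (intro mult_left_mono) auto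
    moreover have "1 * 1 \<le> b * mx" using b(1) mx(1) by (intro mult_le_mono) auto
    moreover have "io_work r \<le> 160 * (b * (Suc ?h - ?g)) + 4" using r(2) by (simp add: mult.assoc)
    moreover have "b * (2 * mx) = 2 * (b * mx)" by simp
    ultimately show ?thesis by linarith
  qed
  ultimately show "\<exists>r p f' T. exec ?M (interp codes) [Num B, Num b, Num q, Num f] m r \<and>
        final_local r = [Num p] \<and> btree_at B (final_mem r) f' p T \<and>
        B_tree B T \<and> tree_keys T = join_keys ks ts \<and>
        io_span r \<le> 400 * max 1 (h_max ts - h_min ts) \<and>
        io_work r \<le> 400 * (b * max 1 (h_max ts - h_min ts))"
    using r(1,4) T(1,2,4) T(3) unfolding mx_def B_tree_def
    by (intro exI[of _ r] exI[of _ p] exI[of _ "4 * page_limit B f"] exI[of _ T]) simp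
qed

end
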